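(* Let $n\in\{3,4,5\}$, let $\Omega\subset\mathbb{R}^n$ be the open unit ball centered at the origin, and for $\delta,\lambda\in\mathbb{R}$ consider the problem $$-\Delta u+\delta\,\frac{x}{|x|^2}\cdot\nabla u=\lambda u+|u|^{4/(n-2-\delta)}u\quad\text{in }\Omega,\qquad u\in H_0^1(\Omega).\qquad ( * )$$ Then: (i) If $n=3$ and $\delta\in(-1,1/2)$, then $( * )$ has a unique positive radial solution $u\in H_0^1(\Omega)$ provided $$j_{-(1-\delta)/2,1}^2<\lambda<j_{(1-\delta)/2,1}^2,$$ and has no positive radial solutions for $\lambda$ outside that range. (ii) If $n=4$ and $\delta\in(0,1)$, then $( * )$ has a unique positive radial solution $u\in H_0^1(\Omega)$ provided $$j_{-(2-\delta)/2,1}^2<\lambda<j_{(2-\delta)/2,1}^2,$$ and has no positive radial solutions for $\lambda$ outside that range. (iii) If $n=5$ and $\delta\in(1,3/2)$, then $( * )$ has a unique positive radial solution $u\in H_0^1(\Omega)$ provided $$j_{-(3-\delta)/2,1}^2<\lambda<j_{(3-\delta)/2,1}^2,$$ and has no positive radial solutions for $\lambda$ outside that range.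
   Context: $j_{k,\ell}$ denotes the $\ell$-th positive zero of the Bessel function of the first kind $J_k(t)$ (real order $k$). Solutions are understood to be smooth. A positive radial solution is a solution of the form $u(x)=u(|x|)$ with $u>0$ in $\Omega$; with $r=|x|$ and $d=n-\delta$ it satisfies $-u''-\frac{d-1}{r}u'=\lambda u+|u|^{4/(d-2)}u$ on $(0,1)$ with $u'(0)=0$ and $u(1)=0$. *)

theory Defs
  imports "HOL-Analysis.Analysis"
begin

text \<open>Because of the real powers, \<open>bessel_J k t\<close> is meaningful for \<open>t > 0\<close> only. The reciprocal
  Gamma function takes the value 0 at the poles of Gamma, so every real order is covered.\<close>

definition bessel_J :: "real \<Rightarrow> real \<Rightarrow> real" where
  "bessel_J k t =
     (\<Sum>m. (-1) ^ m / fact m * rGamma (real m + k + 1) * (t / 2) powr (2 * real m + k))"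

text \<open>The \<open>l\<close>-th positive zero, for \<open>l \<ge> 1\<close>. A positive cardinality entails finiteness.\<close>

definition bessel_zero :: "real \<Rightarrow> nat \<Rightarrow> real" where
  "bessel_zero k l =
     (THE t. t > 0 \<and> bessel_J k t = 0 \<and> card {s. 0 < s \<and> s \<le> t \<and> bessel_J k s = 0} = l)"

definition partial_deriv :: "'a::euclidean_space \<Rightarrow> ('a \<Rightarrow> real) \<Rightarrow> 'a \<Rightarrow> real" where
  "partial_deriv b u x = frechet_derivative u (at x) b"

definition grad :: "('a::euclidean_space \<Rightarrow> real) \<Rightarrow> 'a \<Rightarrow> 'a" where
  "grad u x = (\<Sum>b\<in>Basis. partial_deriv b u x *\<^sub>R b)"

definition laplacian :: "('a::euclidean_space \<Rightarrow> real) \<Rightarrow> 'a \<Rightarrow> real" where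
  "laplacian u x = (\<Sum>b\<in>Basis. partial_deriv b (partial_deriv b u) x)"

text \<open>\<open>Ck_on k S f\<close> and \<open>smooth_on S f\<close> are intended for open \<open>S\<close>; values of \<open>f\<close> outside \<open>S\<close>
  are then irrelevant.\<close>

fun Ck_on :: "nat \<Rightarrow> 'a::euclidean_space set \<Rightarrow> ('a \<Rightarrow> real) \<Rightarrow> bool" where
  "Ck_on 0 S f \<longleftrightarrow> continuous_on S f"
| "Ck_on (Suc k) S f \<longleftrightarrow>
     (\<forall>x\<in>S. f differentiable (at x)) \<and> (\<forall>b\<in>Basis. Ck_on k S (partial_deriv b f))"

definition smooth_on :: "'a::euclidean_space set \<Rightarrow> ('a \<Rightarrow> real) \<Rightarrow> bool" where
  "smooth_on S f \<longleftrightarrow> (\<forall>k. Ck_on k S f)"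

definition test_function :: "'a::euclidean_space set \<Rightarrow> ('a \<Rightarrow> real) \<Rightarrow> bool" where
  "test_function S \<phi> \<longleftrightarrow>
     smooth_on UNIV \<phi> \<and> compact (closure {x. \<phi> x \<noteq> 0}) \<and> closure {x. \<phi> x \<noteq> 0} \<subseteq> S"

definition L2_on :: "'a::euclidean_space set \<Rightarrow> ('a \<Rightarrow> 'b::euclidean_space) \<Rightarrow> bool" where
  "L2_on S f \<longleftrightarrow>
     f \<in> borel_measurable (lebesgue_on S) \<and> integrable (lebesgue_on S) (\<lambda>x. (norm (f x))\<^sup>2)"

text \<open>Membership \<open>u \<in> H\<^sup>1(S)\<close> with weak gradient \<open>g\<close>.\<close>

definition H1_with_grad :: "'a::euclidean_space set \<Rightarrow> ('a \<Rightarrow> real) \<Rightarrow> ('a \<Rightarrow> 'a) \<Rightarrow> bool" where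
  "H1_with_grad S u g \<longleftrightarrow> L2_on S u \<and> L2_on S g \<and>
     (\<forall>\<phi>. test_function S \<phi> \<longrightarrow>
        (LINT x|lebesgue_on S. u x *\<^sub>R grad \<phi> x) = - (LINT x|lebesgue_on S. \<phi> x *\<^sub>R g x))"

text \<open>\<open>H\<^sub>0\<^sup>1(S)\<close> is the closure of the test functions in the \<open>H\<^sup>1(S)\<close> norm.\<close>

definition H10 :: "'a::euclidean_space set \<Rightarrow> ('a \<Rightarrow> real) \<Rightarrow> bool" where
  "H10 S u \<longleftrightarrow> (\<exists>g. H1_with_grad S u g \<and>
     (\<exists>\<phi> :: nat \<Rightarrow> 'a \<Rightarrow> real. (\<forall>i. test_function S (\<phi> i)) \<and>
        (\<lambda>i. LINT x|lebesgue_on S. (\<phi> i x - u x)\<^sup>2 + (norm (grad (\<phi> i) x - g x))\<^sup>2)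
          \<longlonglongrightarrow> 0))"

text \<open>Smooth solutions in the open unit ball. The drift coefficient \<open>x / |x|\<^sup>2\<close> is undefined at the
  origin, so the equation is imposed at the other points, while smoothness is imposed at
  the origin as well. For a radial function this gives \<open>u'(0) = 0\<close>.\<close>

definition solution :: "real \<Rightarrow> real \<Rightarrow> ('a::euclidean_space \<Rightarrow> real) \<Rightarrow> bool" where
  "solution \<delta> lam u \<longleftrightarrow>
     smooth_on (ball 0 1) u \<and> H10 (ball 0 1) u \<and>
     (\<forall>x\<in>ball 0 1 - {0}.
        - laplacian u x + \<delta> * (((1 / (norm x)\<^sup>2) *\<^sub>R x) \<bullet> grad u x)
          = lam * u x + \<bar>u x\<bar> powr (4 / (real DIM('a) - 2 - \<delta>)) * u x)"

definition positive_radial_solution ::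
    "real \<Rightarrow> real \<Rightarrow> ('a::euclidean_space \<Rightarrow> real) \<Rightarrow> bool" where
  "positive_radial_solution \<delta> lam u \<longleftrightarrow>
     solution \<delta> lam u \<and> (\<forall>x\<in>ball 0 1. u x > 0) \<and>
     (\<exists>U :: real \<Rightarrow> real. \<forall>x\<in>ball 0 1. u x = U (norm x))"

end

theory Submission
  imports Defs "HOL-Analysis.Analysis" "HOL-Real_Asymp.Real_Asymp"
begin

text \<open>A radial solution feels the dimension and the drift only through \<open>\<nu> = (n - 2 - \<delta>) / 2\<close>: it
  satisfies \<open>u'' + (2 \<nu> + 1) u' / r + lam u + u\<^sup>q = 0\<close> with the critical exponent
  \<open>q = 1 + 2 / \<nu>\<close>, and \<open>0 < \<nu> < 1\<close> in each of the three cases. A solution smooth in the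
  ball is a smooth function of \<open>y = r\<^sup>2\<close>, and a smooth radial function with bounded gradient lies in
  \<open>H\<^sub>0\<^sup>1\<close> if and only if it vanishes on the sphere. In this way the problem becomes a singular boundary value
  problem for an ordinary differential equation (\<open>radial_ode_of_solution\<close>, \<open>H10_intro\<close>).

  With \<open>t = - ln r\<close> and \<open>w = r\<^sup>\<nu> u\<close> the equation takes the Emden-Fowler form
  \<open>w'' = (\<nu>\<^sup>2 - lam e\<^sup>-\<^sup>2\<^sup>t) w - w\<^sup>q\<close>, in which the critical power has a constant coefficient. The
  linear part has the solutions \<open>phi (\<plusminus>\<nu>)\<close>, which are \<open>J\<^sub>\<plusminus>\<^sub>\<nu>(sqrt lam r)\<close> up to a factor. Let \<open>a\<close> be
  a product of two linear solutions, \<open>N1\<close> and \<open>N2\<close> their Wronskians with \<open>w\<close>. The Pohozaev function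
  \<open>P = N1 N2 / 2 + a w\<^sup>q\<^sup>+\<^sup>1 / (q + 1)\<close> tends to \<open>0\<close> as \<open>t \<rightarrow> \<infinity>\<close>, and \<open>P'\<close> is a positive multiple of
  \<open>a' w\<^sup>q\<^sup>+\<^sup>1\<close>. For \<open>lam > 0\<close> a positive \<open>a\<close> that starts to decrease decreases forever
  (\<open>dmult_nonpos_after\<close>). The argument rests on these two facts.

  Nonexistence (\<open>lam_range\<close>). For \<open>lam \<le> 0\<close> the energy, monotone in \<open>t\<close>, excludes solutions
  (\<open>lam_pos\<close>). Let \<open>lam > 0\<close>. If \<open>phi \<nu>\<close> vanishes for some \<open>t \<ge> 0\<close>, it is not compatible
  with a positive \<open>w\<close>: the Wronskian \<open>N1\<close> would have the wrong sign at the last zero. If \<open>phi (-\<nu>)\<close>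
  has no zero for \<open>t > 0\<close>, then \<open>a = phi \<nu> phi (-\<nu>)\<close> is positive and increasing, so that \<open>P\<close> increases to
  \<open>0\<close>, while its limit at \<open>t = 0\<close> cannot be negative. The two cases are excluded precisely when
  \<open>lam\<close> lies strictly between the squares of the first zeros of \<open>J\<^sub>-\<^sub>\<nu>\<close> and \<open>J\<^sub>\<nu>\<close>.

  Uniqueness (\<open>central_value_unique\<close>). Let now the second factor of \<open>a\<close> vanish at \<open>t = 0\<close>. Then
  \<open>P\<close> is zero at both ends and rises before it falls, hence is nonnegative. For two solutions \<open>w\<close> and
  \<open>v\<close> with \<open>v / w = \<rho>\<close>, the function \<open>\<rho>\<^sup>q\<^sup>+\<^sup>1 P\<^sub>w - P\<^sub>v\<close> has the derivative \<open>(\<rho>\<^sup>q\<^sup>+\<^sup>1)' P\<^sub>w\<close>, so it is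
  monotone wherever \<open>\<rho>\<close> is; a comparison of its values at the ends of the last interval on which
  \<open>\<rho>\<close> increases shows that the values at the centre agree. The initial value problem at the centre
  is uniquely solvable (\<open>radial_ode_unique\<close>).

  Existence (\<open>shooting_solution_exists\<close>). Solve the initial value problem with the value \<open>\<gamma>\<close> at
  the centre. For small \<open>\<gamma>\<close> the solution is nearly linear and positive on the closed ball because
  \<open>lam\<close> is below the first zero of \<open>J\<^sub>\<nu>\<close>. For large \<open>\<gamma>\<close> it concentrates at the centre like the bubble
  \<open>\<gamma> (1 + B r\<^sup>2)\<^sup>-\<^sup>\<nu>\<close>. With \<open>a = phi \<nu> phi (-\<nu>)\<close>, and because \<open>\<nu> < 1\<close>, the function \<open>P\<close> is then negligible
  against \<open>N1\<^sup>2\<close>; away from the centre the solution is therefore nearly proportional to \<open>phi (-\<nu>)\<close>, which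
  is negative for some \<open>t > 0\<close> because \<open>lam\<close> is above the first zero of \<open>J\<^sub>-\<^sub>\<nu>\<close>. Some value of \<open>\<gamma>\<close> in
  between gives a solution that vanishes on the sphere.\<close>

section \<open>Calculus of k times continuously differentiable functions\<close>

lemma partial_deriv_eq:
  "(f has_derivative f') (at x) \<Longrightarrow> partial_deriv b f x = f' b"
  unfolding partial_deriv_def using frechet_derivative_at by metis

lemma partial_deriv_real:
  fixes g :: "real \<Rightarrow> real"
  assumes "(g has_real_derivative D) (at y)"
  shows "partial_deriv 1 g y = D"
  using partial_deriv_eq[OF assms[unfolded has_field_derivative_def], of 1] by simp

lemma has_real_derivative_partial_deriv:
  fixes g :: "real \<Rightarrow> real"
  assumes "g differentiable (at y)"
  shows "(g has_real_derivative partial_deriv 1 g y) (at y)"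
  using assms partial_deriv_real real_differentiable_def by metis

lemma has_derivative_eq_on_open:
  assumes "open S" "x \<in> S" "\<And>y. y \<in> S \<Longrightarrow> f y = g y" "(f has_derivative f') (at x)"
  shows "(g has_derivative f') (at x)"
  using has_derivative_transform_within_open[OF assms(4) assms(1,2)] assms(3) by blast

lemma partial_deriv_cong:
  assumes "open S" "x \<in> S" "\<And>y. y \<in> S \<Longrightarrow> f y = g y"
  shows "partial_deriv b f x = partial_deriv b g x"
proof -
  have "(f has_derivative f') (at x) \<longleftrightarrow> (g has_derivative f') (at x)" for f'
    using has_derivative_eq_on_open[of S x f g] has_derivative_eq_on_open[of S x g f] assms
    by auto
  then show ?thesis
    unfolding partial_deriv_def frechet_derivative_def by simp
qed

lemma Ck_on_cong:
  assumes "open S" "\<And>x. x \<in> S \<Longrightarrow> f x = g x" "Ck_on k S f"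
  shows "Ck_on k S g"
  using assms(2,3)
proof (induction k arbitrary: f g)
  case 0
  then show ?case by (metis Ck_on.simps(1) continuous_on_cong)
next
  case (Suc k)
  have "g differentiable (at x)" if "x \<in> S" for x
    using Suc.prems that has_derivative_eq_on_open[OF assms(1) that, of f g]
    unfolding differentiable_def Ck_on.simps by blast
  moreover have "Ck_on k S (partial_deriv b g)" if "b \<in> Basis" for b
    using Suc.IH[of "partial_deriv b f" "partial_deriv b g"] Suc.prems that
      partial_deriv_cong[OF assms(1), of _ f g] by auto
  ultimately show ?case by simp
qed

lemma Ck_on_Suc_imp: "Ck_on (Suc k) S f \<Longrightarrow> Ck_on k S f"
proof (induction k arbitrary: f)
  case 0
  then show ?case
    by (auto intro!: continuous_at_imp_continuous_on differentiable_imp_continuous_within)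
qed simp

lemma Ck_on_subset: "Ck_on k S f \<Longrightarrow> T \<subseteq> S \<Longrightarrow> Ck_on k T f"
  by (induction k arbitrary: f) (auto intro: continuous_on_subset)

lemma Ck_on_Un:
  "open S \<Longrightarrow> open T \<Longrightarrow> Ck_on k S f \<Longrightarrow> Ck_on k T f \<Longrightarrow> Ck_on k (S \<union> T) f"
  by (induction k arbitrary: f) (auto intro: continuous_on_open_Un)

lemma Ck_on_const: "Ck_on k S (\<lambda>x. c)"
proof (induction k arbitrary: c)
  case (Suc k)
  have "partial_deriv b (\<lambda>x. c) = (\<lambda>x. 0)" for b :: 'a
    by (rule ext) (rule partial_deriv_eq[OF has_derivative_const])
  then show ?case using Suc by simp
qed simp

lemma Ck_on_inner: "Ck_on k S (\<lambda>x. x \<bullet> b)"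
proof (cases k)
  case (Suc n)
  have "((\<lambda>x. x \<bullet> b) has_derivative (\<lambda>h. h \<bullet> b)) (at x)" for x :: 'a
    by (auto intro!: derivative_eq_intros)
  then have "(\<lambda>x. x \<bullet> b) differentiable (at x)" "partial_deriv c (\<lambda>x. x \<bullet> b) x = c \<bullet> b"
    for x c :: 'a
    using partial_deriv_eq unfolding differentiable_def by blast+
  then have "(\<lambda>x. x \<bullet> b) differentiable (at x)" "partial_deriv c (\<lambda>x. x \<bullet> b) = (\<lambda>x. c \<bullet> b)"
    for x c :: 'a
    by auto
  then show ?thesis using Suc by (simp add: Ck_on_const)
qed (auto intro!: continuous_intros)

lemma Ck_on_SucI:
  assumes "open S" "\<And>x. x \<in> S \<Longrightarrow> f differentiable (at x)"
    "\<And>b x. b \<in> Basis \<Longrightarrow> x \<in> S \<Longrightarrow> partial_deriv b f x = D b x"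
    "\<And>b. b \<in> Basis \<Longrightarrow> Ck_on k S (D b)"
  shows "Ck_on (Suc k) S f"
proof -
  have "Ck_on k S (partial_deriv b f)" if "b \<in> Basis" for b
    using assms that by (metis Ck_on_cong)
  then show ?thesis using assms(2) by simp
qed

lemma partial_deriv_add:
  assumes "f differentiable (at x)" "g differentiable (at x)"
  shows "partial_deriv b (\<lambda>x. f x + g x) x = partial_deriv b f x + partial_deriv b g x"
proof -
  have "((\<lambda>x. f x + g x) has_derivative
      (\<lambda>h. frechet_derivative f (at x) h + frechet_derivative g (at x) h)) (at x)"
    using assms by (intro has_derivative_add) (auto simp: frechet_derivative_works[symmetric])
  from partial_deriv_eq[OF this] show ?thesis by (simp add: partial_deriv_def)
qed

lemma partial_deriv_mult:
  assumes "f differentiable (at x)" "g differentiable (at x)"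
  shows "partial_deriv b (\<lambda>x. f x * g x) x = f x * partial_deriv b g x + partial_deriv b f x * g x"
proof -
  have "((\<lambda>x. f x * g x) has_derivative
      (\<lambda>h. f x * frechet_derivative g (at x) h + frechet_derivative f (at x) h * g x)) (at x)"
    using assms by (intro has_derivative_mult) (auto simp: frechet_derivative_works[symmetric])
  from partial_deriv_eq[OF this] show ?thesis by (simp add: partial_deriv_def)
qed

lemma Ck_on_add:
  assumes "open S" "Ck_on k S f" "Ck_on k S g"
  shows "Ck_on k S (\<lambda>x. f x + g x)"
  using assms(2,3)
proof (induction k arbitrary: f g)
  case (Suc k)
  show ?case
    by (rule Ck_on_SucI[OF assms(1), where D = "\<lambda>b x. partial_deriv b f x + partial_deriv b g x"])
      (use Suc in \<open>auto simp: partial_deriv_add\<close>)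
qed (auto intro!: continuous_intros)

lemma Ck_on_mult:
  assumes "open S" "Ck_on k S f" "Ck_on k S g"
  shows "Ck_on k S (\<lambda>x. f x * g x)"
  using assms(2,3)
proof (induction k arbitrary: f g)
  case (Suc k)
  have "Ck_on k S f" "Ck_on k S g"
    using Suc.prems Ck_on_Suc_imp by blast+
  then have "Ck_on k S (\<lambda>x. f x * partial_deriv b g x + partial_deriv b f x * g x)"
    if "b \<in> Basis" for b
    using that Suc.prems by (auto intro!: Ck_on_add[OF assms(1)] Suc.IH)
  then show ?case
    by (intro Ck_on_SucI[OF assms(1), where D = "\<lambda>b x. f x * partial_deriv b g x + partial_deriv b f x * g x"])
      (use Suc.prems in \<open>auto simp: partial_deriv_mult\<close>)
qed (auto intro!: continuous_intros)

lemma partial_deriv_compose: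
  fixes f :: "'a::euclidean_space \<Rightarrow> real"
  assumes "f differentiable (at x)" "(g has_real_derivative D) (at (f x))"
  shows "(\<lambda>x. g (f x)) differentiable (at x)"
    and "partial_deriv b (\<lambda>x. g (f x)) x = D * partial_deriv b f x"
proof -
  have *: "((\<lambda>x. g (f x)) has_derivative (\<lambda>h. D * frechet_derivative f (at x) h)) (at x)"
    using has_derivative_compose[of f _ x UNIV g "(*) D"] assms
    by (simp add: has_field_derivative_def frechet_derivative_works[symmetric])
  show "(\<lambda>x. g (f x)) differentiable (at x)"
    using * by (auto simp: differentiable_def)
  show "partial_deriv b (\<lambda>x. g (f x)) x = D * partial_deriv b f x"
    using partial_deriv_eq[OF *] by (simp add: partial_deriv_def)
qed

lemma Ck_on_compose:
  fixes f :: "'a::euclidean_space \<Rightarrow> real"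
  assumes "open S" "open T" "f ` S \<subseteq> T" "Ck_on k S f" "Ck_on k T g"
  shows "Ck_on k S (\<lambda>x. g (f x))"
  using assms(4,5)
proof (induction k arbitrary: g)
  case 0
  then show ?case using assms(3) by (auto intro: continuous_on_compose2)
next
  case (Suc k)
  have d: "f differentiable (at x)" "(g has_real_derivative partial_deriv 1 g (f x)) (at (f x))"
    if "x \<in> S" for x
    using Suc.prems that assms(3)
    by (auto intro!: has_real_derivative_partial_deriv)
  have "Ck_on k T g" "Ck_on k S f"
    using Suc.prems Ck_on_Suc_imp by blast+
  have "Ck_on k S (\<lambda>x. partial_deriv 1 g (f x) * partial_deriv b f x)" if "b \<in> Basis" for b
  proof (rule Ck_on_mult[OF assms(1)])
    show "Ck_on k S (\<lambda>x. partial_deriv 1 g (f x))"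
      using Suc.prems \<open>Ck_on k S f\<close> by (intro Suc.IH[where g = "partial_deriv 1 g"]) auto
    show "Ck_on k S (partial_deriv b f)"
      using Suc.prems that by simp
  qed
  then show ?case
    by (intro Ck_on_SucI[OF assms(1), where D = "\<lambda>b x. partial_deriv 1 g (f x) * partial_deriv b f x"])
      (use partial_deriv_compose[OF d] in auto)
qed

lemma Ck_on_real_SucI:
  fixes g g' :: "real \<Rightarrow> real"
  assumes "open S" "\<And>x. x \<in> S \<Longrightarrow> (g has_real_derivative g' x) (at x)" "Ck_on k S g'"
  shows "Ck_on (Suc k) S g"
proof -
  have "g differentiable (at x)" "partial_deriv 1 g x = g' x" if "x \<in> S" for x
    using assms(2)[OF that] partial_deriv_real by (auto simp: real_differentiable_def)
  then show ?thesis
    using assms by (intro Ck_on_SucI[where D = "\<lambda>_. g'"]) auto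
qed

lemma Ck_on_real_SucD:
  fixes g :: "real \<Rightarrow> real"
  assumes "Ck_on (Suc k) S g"
  shows "\<And>x. x \<in> S \<Longrightarrow> (g has_real_derivative partial_deriv 1 g x) (at x)"
    and "Ck_on k S (partial_deriv 1 g)"
  using assms by (auto intro!: has_real_derivative_partial_deriv)

lemma Ck_on_powr: "Ck_on k {0<..} (\<lambda>x::real. x powr a)"
proof (induction k arbitrary: a)
  case 0
  then show ?case by (auto intro!: continuous_intros)
next
  case (Suc k)
  have "((\<lambda>x. x powr a) has_real_derivative a * x powr (a - 1)) (at x)" if "x > 0" for x :: real
    using that by (auto intro!: derivative_eq_intros)
  then show ?case
    using Suc by (intro Ck_on_real_SucI[where g' = "\<lambda>x. a * x powr (a - 1)"])
      (auto intro!: Ck_on_mult Ck_on_const)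
qed

lemma Ck_on_sum:
  assumes "open S" "finite A" "\<And>i. i \<in> A \<Longrightarrow> Ck_on k S (f i)"
  shows "Ck_on k S (\<lambda>x. \<Sum>i\<in>A. f i x)"
  using assms(2,3) by (induction A rule: finite_induct)
    (auto intro!: Ck_on_const Ck_on_add[OF assms(1)])

lemma Ck_on_inner_self: "open S \<Longrightarrow> Ck_on k S (\<lambda>x::'a::euclidean_space. x \<bullet> x)"
proof -
  assume S: "open S"
  have "Ck_on k S (\<lambda>x::'a. \<Sum>b\<in>Basis. (x \<bullet> b) * (x \<bullet> b))"
    by (intro Ck_on_sum Ck_on_mult Ck_on_inner S) auto
  then show ?thesis by (simp add: euclidean_inner[symmetric])
qed

section \<open>A smooth cutoff\<close>

text \<open>The family \<open>y\<^sup>-\<^sup>k e\<^sup>-\<^sup>1\<^sup>/\<^sup>y\<close> is closed under differentiation up to linear combinations, which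
  is what makes the case \<open>k = 0\<close> smooth.\<close>

definition flat :: "nat \<Rightarrow> real \<Rightarrow> real" where
  "flat k y = (if y > 0 then exp (- 1 / y) / y ^ k else 0)"

lemma flat_nonneg: "flat k y \<ge> 0"
  by (simp add: flat_def)

lemma flat_tendsto_0: "((\<lambda>y. exp (- 1 / y) / y ^ k) \<longlongrightarrow> 0) (at_right (0::real))"
  by real_asymp

lemma has_real_derivative_flat:
  "(flat k has_real_derivative (flat (k + 2) y - k * flat (Suc k) y)) (at y)"
proof -
  consider "y < 0" | "y > 0" | "y = 0" by linarith
  then show ?thesis
  proof cases
    case 1
    have "((\<lambda>y. 0) has_real_derivative 0) (at y)" by simp
    then have "(flat k has_real_derivative 0) (at y)"
      by (rule has_field_derivative_transform_within_open[of _ _ _ "{..<0}"])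
        (use 1 in \<open>auto simp: flat_def\<close>)
    then show ?thesis using 1 by (simp add: flat_def)
  next
    case 2
    have "((\<lambda>y. exp (- 1 / y) / y ^ k) has_real_derivative
       (flat (k + 2) y - k * flat (Suc k) y)) (at y)"
      using 2
      by ((cases k; auto intro!: derivative_eq_intros simp: flat_def field_simps power2_eq_square),
          metis Suc_pred gr0I power_Suc)
    then show ?thesis
      by (rule has_field_derivative_transform_within_open[of _ _ _ "{0<..}"])
        (use 2 in \<open>auto simp: flat_def\<close>)
  next
    case 3
    have "((\<lambda>y. flat k y / y) \<longlongrightarrow> 0) (at_right 0)"
      by (rule Lim_transform_eventually[OF flat_tendsto_0[of "Suc k"]])
        (auto simp: eventually_at_filter flat_def)
    moreover have "((\<lambda>y. flat k y / y) \<longlongrightarrow> 0) (at_left 0)"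
      by (rule tendsto_eventually) (auto simp: eventually_at_filter flat_def)
    ultimately have "((\<lambda>y. flat k y / y) \<longlongrightarrow> 0) (at 0)"
      by (simp add: filterlim_at_split)
    then show ?thesis using 3 by (simp add: has_field_derivative_iff flat_def)
  qed
qed

lemma Ck_on_flat: "Ck_on n UNIV (flat k)"
proof (induction n arbitrary: k)
  case 0
  then show ?case
    using has_real_derivative_flat by (auto intro!: continuous_at_imp_continuous_on DERIV_isCont)
next
  case (Suc n)
  have "Ck_on n UNIV (\<lambda>y. flat (k + 2) y + (- real k) * flat (Suc k) y)"
    by (intro Ck_on_add Ck_on_mult Ck_on_const Suc) auto
  then have "Ck_on n UNIV (\<lambda>y. flat (k + 2) y - real k * flat (Suc k) y)"
    by simp
  then show ?case
    using has_real_derivative_flat by (intro Ck_on_real_SucI) auto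
qed

lemma flat_0_le_1: "flat 0 y \<le> 1"
  by (simp add: flat_def)

lemma exp_minus_inverse_le:
  fixes y :: real
  assumes "y > 0"
  shows "exp (- 1 / y) \<le> y" and "exp (- 1 / y) \<le> 2 * y\<^sup>2"
proof -
  have "1 + 1 / y + (1 / y)\<^sup>2 / 2 \<le> exp (1 / y)"
    using exp_lower_Taylor_quadratic[of "1 / y"] assms by simp
  moreover have "1 / y > 0" "(1 / y)\<^sup>2 / 2 \<ge> 0" using assms by auto
  ultimately have "1 / y \<le> exp (1 / y)" "(1 / y)\<^sup>2 / 2 \<le> exp (1 / y)"
    by linarith+
  then have "1 \<le> y * exp (1 / y)" "1 \<le> 2 * y\<^sup>2 * exp (1 / y)"
    using assms by (auto simp: field_simps power2_eq_square)
  then show "exp (- 1 / y) \<le> y" "exp (- 1 / y) \<le> 2 * y\<^sup>2"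
    by (auto simp: exp_minus field_simps)
qed

lemma flat_2_bound: "(y + 1) * flat 2 y \<le> 3"
proof (cases "y > 0")
  case True
  have "exp (- 1 / y) \<le> 1" using True by simp
  have "(y + 1) * exp (- 1 / y) \<le> 3 * y\<^sup>2"
  proof -
    have "y * exp (- 1 / y) \<le> y * y"
      using True exp_minus_inverse_le(1)[OF True] by (intro mult_left_mono) auto
    then show ?thesis
      using exp_minus_inverse_le(2)[OF True] by (simp add: algebra_simps power2_eq_square)
  qed
  then show ?thesis using True by (simp add: flat_def field_simps)
qed (simp add: flat_def)

text \<open>Radial cutoffs with values in \<open>[0, 1)\<close>: they vanish for \<open>|x|\<^sup>2 \<ge> 1 - 1 / j\<close>, tend to \<open>1\<close> in the unit ball,
  and have gradients of order at most \<open>j\<close>.\<close>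

definition cutoff :: "nat \<Rightarrow> 'a::euclidean_space \<Rightarrow> real" where
  "cutoff j x = flat 0 (real j * (1 - x \<bullet> x) - 1)"

lemma smooth_cutoff: "Ck_on k UNIV (cutoff j)"
  unfolding cutoff_def
proof (rule Ck_on_compose[of UNIV UNIV _ k "flat 0"])
  have "Ck_on k UNIV (\<lambda>x::'a. (real j - 1) + (- real j) * (x \<bullet> x))"
    by (intro Ck_on_add Ck_on_mult Ck_on_const Ck_on_inner_self) auto
  then show "Ck_on k UNIV (\<lambda>x::'a. real j * (1 - x \<bullet> x) - 1)"
    by (simp add: algebra_simps)
qed (auto simp: Ck_on_flat)

lemma partial_deriv_cutoff:
  "partial_deriv b (cutoff j) x = - 2 * real j * flat 2 (real j * (1 - x \<bullet> x) - 1) * (x \<bullet> b)"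
proof -
  have d: "((\<lambda>x. real j * (1 - x \<bullet> x) - 1) has_derivative (\<lambda>h. - 2 * real j * (x \<bullet> h))) (at x)"
    by (auto intro!: derivative_eq_intros simp: inner_commute algebra_simps)
  have "partial_deriv b (\<lambda>x. flat 0 (real j * (1 - x \<bullet> x) - 1)) x =
      flat 2 (real j * (1 - x \<bullet> x) - 1) * partial_deriv b (\<lambda>x. real j * (1 - x \<bullet> x) - 1) x"
    using partial_deriv_compose(2)[of "\<lambda>x. real j * (1 - x \<bullet> x) - 1" x "flat 0"] d
      has_real_derivative_flat[of 0 "real j * (1 - x \<bullet> x) - 1"]
    by (auto simp: differentiable_def numeral_2_eq_2)
  then show ?thesis
    unfolding cutoff_def using partial_deriv_eq[OF d, of b] by simp
qed

lemma cutoff_bounds: "0 \<le> cutoff j x" "cutoff j x \<le> 1"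
  by (auto simp: cutoff_def flat_nonneg flat_0_le_1)

lemma cutoff_tendsto:
  assumes "norm x < 1"
  shows "(\<lambda>j. cutoff j x) \<longlonglongrightarrow> 1"
    and "(\<lambda>j. real j * flat 2 (real j * (1 - x \<bullet> x) - 1)) \<longlonglongrightarrow> 0"
proof -
  define c where "c = 1 - x \<bullet> x"
  have c: "c > 0"
    using assms by (simp add: c_def dot_square_norm power_less_one_iff)
  have ev: "eventually (\<lambda>j. real j * c - 1 > 0) sequentially"
    using c by real_asymp
  have "(\<lambda>j. exp (- 1 / (real j * c - 1))) \<longlonglongrightarrow> 1"
    using c by real_asymp
  then show "(\<lambda>j. cutoff j x) \<longlonglongrightarrow> 1"
    by (rule Lim_transform_eventually)
      (use ev in \<open>auto elim!: eventually_mono simp: cutoff_def flat_def c_def\<close>)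
  have "(\<lambda>j. real j * (exp (- 1 / (real j * c - 1)) / (real j * c - 1) ^ 2)) \<longlonglongrightarrow> 0"
    using c by real_asymp
  then show "(\<lambda>j. real j * flat 2 (real j * (1 - x \<bullet> x) - 1)) \<longlonglongrightarrow> 0"
    by (rule Lim_transform_eventually)
      (use ev in \<open>auto elim!: eventually_mono simp: flat_def c_def\<close>)
qed

lemma cutoff_support:
  "\<exists>K. compact K \<and> K \<subseteq> ball 0 1 \<and> (\<forall>x. x \<notin> K \<longrightarrow> cutoff j (x::'a::euclidean_space) = 0)"
proof -
  let ?K = "cball 0 (sqrt (1 - 1 / real j)) :: 'a set"
  show ?thesis
  proof (cases "j = 0")
    case True
    then show ?thesis by (intro exI[of _ "{}"]) (auto simp: cutoff_def flat_def)
  next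
    case False
    then have "sqrt (1 - 1 / real j) < 1" by simp
    then have "?K \<subseteq> ball 0 1"
      unfolding subset_iff mem_ball_0 mem_cball_0 using order.strict_trans1 by blast
    moreover have "cutoff j x = 0" if "x \<notin> ?K" for x :: 'a
    proof -
      have "norm x > sqrt (1 - 1 / real j)" using that by auto
      then have "(norm x)\<^sup>2 > 1 - 1 / real j"
        by (metis norm_ge_zero not_less real_le_rsqrt real_sqrt_le_iff sqrt_le_D)
      then have "real j * (1 - x \<bullet> x) < 1"
        using False by (simp add: dot_square_norm field_simps)
      then show ?thesis by (simp add: cutoff_def flat_def)
    qed
    ultimately show ?thesis by (intro exI[of _ ?K]) auto
  qed
qed

section \<open>Integration by parts and boundary values in the unit ball\<close>

lemma compactly_supported_bounded:
  fixes f :: "'a::euclidean_space \<Rightarrow> real"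
  assumes "continuous_on UNIV f" "compact K" "\<And>x. x \<notin> K \<Longrightarrow> f x = 0"
  obtains M where "M \<ge> 0" "\<And>x. \<bar>f x\<bar> \<le> M"
proof -
  have "bounded (f ` K)"
    using assms by (meson compact_continuous_image compact_imp_bounded continuous_on_subset subset_UNIV)
  then obtain M where M: "\<And>x. x \<in> K \<Longrightarrow> \<bar>f x\<bar> \<le> M"
    unfolding bounded_iff by auto
  have "\<bar>f x\<bar> \<le> max 0 M" for x
    using M[of x] assms(3)[of x] by (cases "x \<in> K") auto
  then show ?thesis using that[of "max 0 M"] by auto
qed

lemma integrable_compactly_supported:
  fixes f :: "'a::euclidean_space \<Rightarrow> real"
  assumes "continuous_on UNIV f" "compact K" "\<And>x. x \<notin> K \<Longrightarrow> f x = 0"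
  shows "integrable lborel f"
proof -
  have "integrable lborel (\<lambda>x. indicator K x *\<^sub>R f x)"
    using assms by (intro borel_integrable_compact) (auto intro: continuous_on_subset)
  also have "(\<lambda>x. indicator K x *\<^sub>R f x) = f"
    using assms(3) by (intro ext) (auto simp: indicator_def)
  finally show ?thesis .
qed

lemma partial_deriv_outside_support:
  assumes "closed K" "\<And>x. x \<notin> K \<Longrightarrow> f x = 0" "x \<notin> K"
  shows "partial_deriv b f x = 0"
proof -
  have "partial_deriv b f x = partial_deriv b (\<lambda>x. 0) x"
    using assms by (intro partial_deriv_cong[of "- K"]) auto
  also have "\<dots> = 0"
    by (rule partial_deriv_eq[OF has_derivative_const])
  finally show ?thesis .
qed

lemma has_real_derivative_along:
  fixes f :: "'a::euclidean_space \<Rightarrow> real"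
  assumes "f differentiable (at (x + t *\<^sub>R b))"
  shows "((\<lambda>t. f (x + t *\<^sub>R b)) has_real_derivative partial_deriv b f (x + t *\<^sub>R b)) (at t)"
proof -
  let ?D = "frechet_derivative f (at (x + t *\<^sub>R b))"
  have D: "(f has_derivative ?D) (at (x + t *\<^sub>R b))"
    using assms frechet_derivative_works by blast
  have "((\<lambda>t. x + t *\<^sub>R b) has_derivative (\<lambda>h. h *\<^sub>R b)) (at t)"
    by (auto intro!: derivative_eq_intros)
  from has_derivative_compose[OF this D]
  have "((\<lambda>t. f (x + t *\<^sub>R b)) has_derivative (\<lambda>h. ?D (h *\<^sub>R b))) (at t)" .
  moreover have "?D (h *\<^sub>R b) = partial_deriv b f (x + t *\<^sub>R b) * h" for h
    using linear_cmul[OF has_derivative_linear[OF D]] by (simp add: partial_deriv_def)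
  ultimately show ?thesis
    unfolding has_field_derivative_def by simp
qed

text \<open>By translation invariance every difference quotient of \<open>f\<close> has integral zero; the difference
  quotients converge boundedly to the partial derivative.\<close>

lemma integral_partial_deriv_compactly_supported:
  fixes f :: "'a::euclidean_space \<Rightarrow> real"
  assumes f: "Ck_on 1 UNIV f" and K: "compact K" "\<And>x. x \<notin> K \<Longrightarrow> f x = 0" and b: "b \<in> Basis"
  shows "integrable lborel (partial_deriv b f)" and "(LINT x|lborel. partial_deriv b f x) = 0"
proof -
  define f' where "f' = partial_deriv b f"
  have diff: "f differentiable (at x)" for x
    using f by simp
  have cont: "continuous_on UNIV f" "continuous_on UNIV f'"
    using f b Ck_on_Suc_imp[of 0 UNIV f] by (auto simp: f'_def)
  have f'0: "f' x = 0" if "x \<notin> K" for x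
    unfolding f'_def using K that by (intro partial_deriv_outside_support compact_imp_closed)
  show "integrable lborel (partial_deriv b f)"
    using integrable_compactly_supported[OF cont(2) K(1) f'0] by (simp add: f'_def)
  obtain M where M: "M \<ge> 0" "\<And>x. \<bar>f' x\<bar> \<le> M"
    using compactly_supported_bounded[OF cont(2) K(1) f'0] by blast
  obtain R where R: "R > 0" "K \<subseteq> ball 0 R"
    using compact_imp_bounded[OF K(1)] bounded_subset_ballD by blast
  have nb: "norm b = 1" using b by simp
  define h where "h = (\<lambda>i. 1 / real (Suc i))"
  define q where "q = (\<lambda>i x. (f (h i *\<^sub>R b + x) - f x) / h i)"
  have h: "h i > 0" "h i \<le> 1" for i by (auto simp: h_def)
  have q_mvt: "\<exists>z. 0 < z \<and> z < h i \<and> q i x = f' (x + z *\<^sub>R b)" for i x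
  proof -
    have d: "((\<lambda>t. f (x + t *\<^sub>R b)) has_real_derivative f' (x + t *\<^sub>R b)) (at t)" for t
      unfolding f'_def by (rule has_real_derivative_along) (rule diff)
    obtain z where "0 < z" "z < h i"
      "f (x + h i *\<^sub>R b) - f (x + 0 *\<^sub>R b) = (h i - 0) * f' (x + z *\<^sub>R b)"
      using MVT2[OF h(1)[of i], of "\<lambda>t. f (x + t *\<^sub>R b)" "\<lambda>t. f' (x + t *\<^sub>R b)"] d by blast
    then show ?thesis
      using h(1)[of i] by (intro exI[of _ z]) (auto simp: q_def add.commute field_simps)
  qed
  have "(\<lambda>i. LINT x|lborel. q i x) \<longlonglongrightarrow> (LINT x|lborel. f' x)"
  proof (rule integral_dominated_convergence)
    show "f' \<in> borel_measurable lborel" "q i \<in> borel_measurable lborel" for i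
    proof -
      have "continuous_on UNIV (q i)"
        unfolding q_def
        using h(1)[of i] by (intro continuous_intros continuous_on_compose2[OF cont(1)]) auto
      then show "q i \<in> borel_measurable lborel" "f' \<in> borel_measurable lborel"
        using cont(2) by (auto intro: borel_measurable_continuous_onI)
    qed
    show "integrable lborel (\<lambda>x::'a. indicator (cball 0 (R + 1)) x *\<^sub>R M)"
      by (rule borel_integrable_compact) auto
    show "AE x in lborel. (\<lambda>i. q i x) \<longlonglongrightarrow> f' x"
    proof (rule AE_I2)
      fix x
      have "((\<lambda>t. (f (x + (0 + t) *\<^sub>R b) - f (x + 0 *\<^sub>R b)) / t) \<longlongrightarrow> f' (x + 0 *\<^sub>R b)) (at 0)"
        unfolding f'_def
        using has_real_derivative_along[OF diff, where x = x and t = 0 and b = b] by (simp add: DERIV_def)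
      moreover have "filterlim h (at 0) sequentially"
        unfolding filterlim_at using h(1) unfolding h_def
        using LIMSEQ_Suc[OF lim_1_over_n[where 'a = real]] by auto
      ultimately show "(\<lambda>i. q i x) \<longlonglongrightarrow> f' x"
        using filterlim_compose by (fastforce simp: q_def add.commute)
    qed
    show "AE x in lborel. norm (q i x) \<le> indicator (cball 0 (R + 1)) x *\<^sub>R M" for i
    proof (rule AE_I2)
      fix x
      obtain z where z: "0 < z" "z < h i" "q i x = f' (x + z *\<^sub>R b)"
        using q_mvt by blast
      show "norm (q i x) \<le> indicator (cball 0 (R + 1)) x *\<^sub>R M"
      proof (cases "x \<in> cball 0 (R + 1)")
        case False
        have "norm x \<le> norm (x + z *\<^sub>R b) + norm (z *\<^sub>R b)"
          by (metis add_diff_cancel norm_triangle_ineq4)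
        moreover have "norm (z *\<^sub>R b) \<le> 1" using z h(2)[of i] nb by simp
        ultimately have "x + z *\<^sub>R b \<notin> K" using R(2) False by auto
        then show ?thesis using f'0 z(3) False by simp
      qed (use M z in simp)
    qed
  qed
  moreover have "(LINT x|lborel. q i x) = 0" for i
  proof -
    have int: "integrable lborel f" using integrable_compactly_supported[OF cont(1) K] .
    have m: "f \<in> borel_measurable borel" using cont(1) by (rule borel_measurable_continuous_onI)
    have int': "integrable lborel (\<lambda>x. f (h i *\<^sub>R b + x))"
      using int integrable_distr_eq[where f = f and g = "(+) (h i *\<^sub>R b)" and M = lborel and N = borel] m
        lborel_distr_plus[of "h i *\<^sub>R b"] by simp
    have "(LINT x|lborel. f (h i *\<^sub>R b + x)) = integral\<^sup>L (distr lborel borel ((+) (h i *\<^sub>R b))) f"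
      using m by (intro integral_distr[symmetric]) auto
    also have "\<dots> = (LINT x|lborel. f x)"
      by (simp add: lborel_distr_plus)
    finally show ?thesis
      unfolding q_def using int int' by simp
  qed
  ultimately show "(LINT x|lborel. partial_deriv b f x) = 0"
    by (simp add: f'_def LIMSEQ_const_iff)
qed

lemma integral_lebesgue_on_support:
  fixes f :: "'a::euclidean_space \<Rightarrow> real"
  assumes "f \<in> borel_measurable borel" "\<And>x. x \<notin> S \<Longrightarrow> f x = 0" "S \<in> sets lebesgue"
  shows "(LINT x|lebesgue_on S. f x) = (LINT x|lborel. f x)"
proof -
  have "(LINT x|lebesgue_on S. f x) = (LINT x|lebesgue. indicator S x *\<^sub>R f x)"
    using assms(3) by (intro integral_restrict_space) auto
  also have "(\<lambda>x. indicator S x *\<^sub>R f x) = f"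
    using assms(2) by (intro ext) (auto simp: indicator_def)
  finally show ?thesis using assms(1) by (simp add: integral_completion)
qed

abbreviation unit_ball_measure :: "'a::euclidean_space measure" where
  "unit_ball_measure \<equiv> lebesgue_on (ball 0 1)"

lemma integral_partial_deriv_unit_ball:
  fixes f :: "'a::euclidean_space \<Rightarrow> real"
  assumes f: "Ck_on 1 UNIV f" and K: "compact K" "K \<subseteq> ball 0 1" "\<And>x. x \<notin> K \<Longrightarrow> f x = 0"
    and b: "b \<in> Basis"
  shows "(LINT x|unit_ball_measure. partial_deriv b f x) = 0"
proof -
  have "continuous_on UNIV (partial_deriv b f)" using f b by simp
  moreover have "partial_deriv b f x = 0" if "x \<notin> ball 0 1" for x
    using K that by (intro partial_deriv_outside_support[of K] compact_imp_closed) auto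
  ultimately have "(LINT x|unit_ball_measure. partial_deriv b f x) = (LINT x|lborel. partial_deriv b f x)"
    by (intro integral_lebesgue_on_support borel_measurable_continuous_onI) auto
  then show ?thesis
    using integral_partial_deriv_compactly_supported(2)[OF f K(1,3) b] by simp
qed

lemma finite_measure_unit_ball: "finite_measure unit_ball_measure"
  by (intro finite_measure_lebesgue_on) simp

lemma integrable_unit_ball:
  fixes f :: "'a::euclidean_space \<Rightarrow> real"
  assumes "continuous_on (ball 0 1) f" "\<And>x. x \<in> ball 0 1 \<Longrightarrow> \<bar>f x\<bar> \<le> C"
  shows "integrable unit_ball_measure f"
proof -
  interpret finite_measure "unit_ball_measure :: 'a measure" by (rule finite_measure_unit_ball)
  show ?thesis
    using assms
    by (intro integrable_const_bound[where B = C] AE_I2 continuous_imp_measurable_on_sets_lebesgue) auto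
qed

lemma integrable_unit_ball_UNIV:
  fixes f :: "'a::euclidean_space \<Rightarrow> real"
  assumes "continuous_on UNIV f"
  shows "integrable unit_ball_measure f"
proof -
  have "bounded (f ` cball 0 1)"
    using assms by (meson compact_cball compact_continuous_image compact_imp_bounded continuous_on_subset subset_UNIV)
  then obtain M where "\<forall>x\<in>cball 0 1. \<bar>f x\<bar> \<le> M"
    unfolding bounded_iff by (auto simp del: mem_cball_0 mem_cball)
  then show ?thesis
    using assms by (intro integrable_unit_ball[where C = M]) (auto intro: continuous_on_subset)
qed

lemma dominated_convergence_unit_ball:
  fixes f :: "'a::euclidean_space \<Rightarrow> real"
  assumes "\<And>i. s i \<in> borel_measurable unit_ball_measure" "f \<in> borel_measurable unit_ball_measure"
    "integrable unit_ball_measure w"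
    "\<And>x. x \<in> ball 0 1 \<Longrightarrow> (\<lambda>i. s i x) \<longlonglongrightarrow> f x"
    "\<And>i x. x \<in> ball 0 1 \<Longrightarrow> \<bar>s i x\<bar> \<le> w x"
  shows "(\<lambda>i. LINT x|unit_ball_measure. s i x) \<longlonglongrightarrow> (LINT x|unit_ball_measure. f x)"
  by (rule integral_dominated_convergence[where w = w]) (use assms in \<open>auto intro!: AE_I2\<close>)

lemma grad_inner: "b \<in> Basis \<Longrightarrow> grad u x \<bullet> b = partial_deriv b u x"
  by (simp add: grad_def inner_sum_left inner_Basis if_distrib sum.delta cong: if_cong)

lemma norm_sq_eq_sum_Basis: "(norm (v::'a::euclidean_space))\<^sup>2 = (\<Sum>b\<in>Basis. (v \<bullet> b)\<^sup>2)"
  unfolding power2_eq_square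
  by (simp only: power2_eq_square[symmetric] dot_square_norm[symmetric]) (simp add: euclidean_inner[of v v] power2_eq_square)

lemma continuous_on_grad:
  assumes "Ck_on 1 S u"
  shows "continuous_on S (grad u)"
  unfolding grad_def using assms by (auto intro!: continuous_intros)

lemma Ck_on_extend_zero:
  assumes "open S" "Ck_on k S f" "closed K" "K \<subseteq> S" "\<And>x. x \<notin> K \<Longrightarrow> f x = 0"
  shows "Ck_on k UNIV f"
proof -
  have "Ck_on k (- K) f"
    using assms(3,5) by (rule_tac Ck_on_cong[OF _ _ Ck_on_const[of k "- K" 0]]) auto
  with assms have "Ck_on k (S \<union> - K) f" by (intro Ck_on_Un) auto
  moreover have "S \<union> - K = UNIV" using assms(4) by auto
  ultimately show ?thesis by simp
qed

lemma test_functionI: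
  assumes "\<And>k. Ck_on k UNIV f" "compact K" "K \<subseteq> S" "\<And>x. x \<notin> K \<Longrightarrow> f x = 0"
  shows "test_function S f"
proof -
  have "closure {x. f x \<noteq> 0} \<subseteq> K"
    using assms(2,4) by (intro closure_minimal compact_imp_closed) auto
  moreover from this have "compact (closure {x. f x \<noteq> 0})"
    using assms(2) compact_closure compact_imp_bounded by (metis bounded_closure_image bounded_subset closure_closed closure_mono compact_eq_bounded_closed closed_closure)
  ultimately show ?thesis
    using assms(1,3) by (auto simp: test_function_def smooth_on_def)
qed

lemma test_functionD:
  assumes "test_function S f"
  shows "Ck_on k UNIV f"
    and "\<exists>K. compact K \<and> K \<subseteq> S \<and> (\<forall>x. x \<notin> K \<longrightarrow> f x = 0)"
proof -
  show "Ck_on k UNIV f"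
    using assms by (simp add: test_function_def smooth_on_def)
  have "f x = 0" if "x \<notin> closure {x. f x \<noteq> 0}" for x
    using that subsetD[OF closure_subset, of x "{x. f x \<noteq> 0}"] by auto
  then show "\<exists>K. compact K \<and> K \<subseteq> S \<and> (\<forall>x. x \<notin> K \<longrightarrow> f x = 0)"
    using assms unfolding test_function_def by blast
qed

text \<open>The products \<open>u * cutoff j\<close> are test functions. The gradient of the cutoff is of order \<open>j\<close>, but only
  where \<open>1 - |x|\<^sup>2\<close> is comparable to \<open>1 / j\<close>: its product with \<open>1 - |x|\<^sup>2\<close>, hence with \<open>u\<close>, is bounded
  uniformly in \<open>j\<close> and tends to \<open>0\<close> pointwise. Dominated convergence gives the approximation in the
  \<open>H\<^sup>1\<close> norm.\<close>

lemma H10_intro: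
  fixes u :: "'a::euclidean_space \<Rightarrow> real"
  assumes sm: "smooth_on (ball 0 1) u"
    and u: "\<And>x. x \<in> ball 0 1 \<Longrightarrow> \<bar>u x\<bar> \<le> C * (1 - x \<bullet> x)"
    and gu: "\<And>x b. x \<in> ball 0 1 \<Longrightarrow> b \<in> Basis \<Longrightarrow> \<bar>partial_deriv b u x\<bar> \<le> C"
  shows "H10 (ball 0 1) u"
proof -
  let ?B = "ball 0 1 :: 'a set"
  let ?M = "unit_ball_measure :: 'a measure"
  have Ck: "Ck_on k ?B u" for k using sm by (simp add: smooth_on_def)
  have du: "u differentiable (at x)" if "x \<in> ?B" for x
    using Ck[of 1] that by simp
  have cu: "continuous_on ?B u" using Ck[of 0] by simp
  have cd: "continuous_on ?B (partial_deriv b u)" if "b \<in> Basis" for b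
    using Ck[of 1] that by simp
  have cg: "continuous_on ?B (grad u)" using Ck by (intro continuous_on_grad)
  obtain b0 :: 'a where b0: "b0 \<in> Basis" using nonempty_Basis by blast
  have C: "C \<ge> 0" using gu[of 0 b0] b0 by simp
  have inn: "0 \<le> x \<bullet> x" "x \<bullet> x < 1" if "x \<in> ?B" for x
    using that by (auto simp: dot_square_norm power_less_one_iff)
  have uC: "\<bar>u x\<bar> \<le> C" if "x \<in> ?B" for x
  proof -
    have "C * (1 - x \<bullet> x) \<le> C * 1" using inn[OF that] C by (intro mult_left_mono) auto
    then show ?thesis using u[OF that] by simp
  qed
  have sq_le: "a\<^sup>2 \<le> c\<^sup>2" if "\<bar>a\<bar> \<le> c" for a c :: real
    using that by (metis abs_ge_zero abs_le_square_iff abs_of_nonneg order.trans)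
  have normg: "(norm (grad u x))\<^sup>2 = (\<Sum>b\<in>Basis. (partial_deriv b u x)\<^sup>2)" for x
    by (simp add: norm_sq_eq_sum_Basis grad_inner)
  have L2u: "L2_on ?B u"
    unfolding L2_on_def
    using cu uC sq_le by (auto intro!: continuous_imp_measurable_on_sets_lebesgue integrable_unit_ball[where C = "C\<^sup>2"] continuous_intros)
  have L2g: "L2_on ?B (grad u)"
    unfolding L2_on_def normg
    using cg cd sq_le[OF gu]
    by (intro conjI continuous_imp_measurable_on_sets_lebesgue Bochner_Integration.integrable_sum
        integrable_unit_ball[where C = "C\<^sup>2"] continuous_intros) auto
  have weak: "(LINT x|?M. u x *\<^sub>R grad \<phi> x) = - (LINT x|?M. \<phi> x *\<^sub>R grad u x)"
    if \<phi>: "test_function ?B \<phi>" for \<phi>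
  proof -
    obtain K where K0: "compact K" "K \<subseteq> ?B" "\<forall>x. x \<notin> K \<longrightarrow> \<phi> x = 0"
      using test_functionD(2)[OF \<phi>] by blast
    have K: "compact K" "K \<subseteq> ?B" "\<And>x. x \<notin> K \<Longrightarrow> \<phi> x = 0" "\<And>k. Ck_on k UNIV \<phi>"
      using K0 test_functionD(1)[OF \<phi>] by auto
    have cphi: "continuous_on UNIV \<phi>" "\<And>b. b \<in> Basis \<Longrightarrow> continuous_on UNIV (partial_deriv b \<phi>)"
      "continuous_on UNIV (grad \<phi>)"
      using K(4)[of 0] K(4)[of 1] by (auto intro!: continuous_on_grad)
    obtain P where P: "\<And>x. \<bar>\<phi> x\<bar> \<le> P"
      using compactly_supported_bounded[OF cphi(1) K(1,3)] by blast
    have "\<exists>Q. \<forall>x. \<bar>partial_deriv b \<phi> x\<bar> \<le> Q" if b: "b \<in> Basis" for b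
    proof -
      have "partial_deriv b \<phi> x = 0" if "x \<notin> K" for x
        using K(1,3) that by (intro partial_deriv_outside_support[of K]) (auto intro: compact_imp_closed)
      then show ?thesis
        using compactly_supported_bounded[OF cphi(2)[OF b] K(1)] by blast
    qed
    then have "\<forall>b\<in>Basis. \<exists>Q. \<forall>x. \<bar>partial_deriv b \<phi> x\<bar> \<le> Q" by blast
    from bchoice[OF this] obtain Q where Q: "\<And>b x. b \<in> Basis \<Longrightarrow> \<bar>partial_deriv b \<phi> x\<bar> \<le> Q b"
      by blast
    have i1: "integrable ?M (\<lambda>x. u x * partial_deriv b \<phi> x)" if b: "b \<in> Basis" for b
      using cu uC C Q[OF b] continuous_on_subset[OF cphi(2)[OF b]]
      by (intro integrable_unit_ball[where C = "C * Q b"] continuous_intros)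
        (auto simp: abs_mult intro!: mult_mono)
    have i2: "integrable ?M (\<lambda>x. \<phi> x * partial_deriv b u x)" if b: "b \<in> Basis" for b
      using cd[OF b] gu C P continuous_on_subset[OF cphi(1)] b order.trans[OF abs_ge_zero P]
      by (intro integrable_unit_ball[where C = "P * C"] continuous_intros)
        (auto simp: abs_mult intro!: mult_mono)
    show ?thesis
    proof (rule euclidean_eqI)
      fix b :: 'a assume b: "b \<in> Basis"
      define f where "f = (\<lambda>x. if x \<in> ?B then u x * \<phi> x else 0)"
      have fB: "Ck_on 1 ?B f"
        by (rule Ck_on_cong[OF _ _ Ck_on_mult[OF open_ball Ck Ck_on_subset[OF K(4)]]]) (auto simp: f_def)
      have f0: "f x = 0" if "x \<notin> K" for x using K that by (auto simp: f_def)
      have f1: "Ck_on 1 UNIV f"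
        using fB K f0 by (intro Ck_on_extend_zero[of ?B _ _ K]) (auto intro: compact_imp_closed)
      have "0 = (LINT x|?M. partial_deriv b f x)"
        using integral_partial_deriv_unit_ball[OF f1 K(1,2) f0 b] by simp
      also have "\<dots> = (LINT x|?M. u x * partial_deriv b \<phi> x + \<phi> x * partial_deriv b u x)"
      proof (rule Bochner_Integration.integral_cong)
        fix x assume "x \<in> space ?M"
        then have x: "x \<in> ?B" by simp
        have "partial_deriv b f x = partial_deriv b (\<lambda>x. u x * \<phi> x) x"
          using x by (intro partial_deriv_cong[of ?B]) (auto simp: f_def)
        then show "partial_deriv b f x = u x * partial_deriv b \<phi> x + \<phi> x * partial_deriv b u x"
          using partial_deriv_mult[of u x \<phi> b] du[OF x] K(4)[of 1] by simp
      qed simp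
      also have "\<dots> = (LINT x|?M. u x * partial_deriv b \<phi> x) + (LINT x|?M. \<phi> x * partial_deriv b u x)"
        using i1[OF b] i2[OF b] by simp
      finally have eq: "(LINT x|?M. u x * partial_deriv b \<phi> x) = - (LINT x|?M. \<phi> x * partial_deriv b u x)"
        by simp
      have int: "integrable ?M (\<lambda>x. u x *\<^sub>R grad \<phi> x)" "integrable ?M (\<lambda>x. \<phi> x *\<^sub>R grad u x)"
        unfolding grad_def scaleR_sum_right scaleR_scaleR
        using i1 i2 by (auto intro!: Bochner_Integration.integrable_sum integrable_scaleR_left)
      have "(LINT x|?M. u x *\<^sub>R grad \<phi> x) \<bullet> b = (LINT x|?M. (u x *\<^sub>R grad \<phi> x) \<bullet> b)"
        "(LINT x|?M. \<phi> x *\<^sub>R grad u x) \<bullet> b = (LINT x|?M. (\<phi> x *\<^sub>R grad u x) \<bullet> b)"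
        by (rule integral_inner_left[symmetric], rule int)+
      then show "(LINT x|?M. u x *\<^sub>R grad \<phi> x) \<bullet> b = (- (LINT x|?M. \<phi> x *\<^sub>R grad u x)) \<bullet> b"
        using eq by (simp add: grad_inner[OF b] inner_minus_left)
    qed
  qed
  \<comment> \<open>the approximating test functions; outside the ball nothing is known about \<open>u\<close>\<close>
  define \<phi> where "\<phi> = (\<lambda>i x. if x \<in> ?B then u x * cutoff i x else 0)"
  have test: "test_function ?B (\<phi> i)" for i
  proof -
    obtain K where K: "compact K" "K \<subseteq> ?B" "\<forall>x. x \<notin> K \<longrightarrow> cutoff i x = 0"
      using cutoff_support by blast
    have "Ck_on k ?B (\<phi> i)" for k
      by (rule Ck_on_cong[OF _ _ Ck_on_mult[OF open_ball Ck Ck_on_subset[OF smooth_cutoff[of k i]]]])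
        (auto simp: \<phi>_def)
    moreover have "\<phi> i x = 0" if "x \<notin> K" for x using K that by (auto simp: \<phi>_def)
    ultimately show ?thesis
      using K by (intro test_functionI[of _ K] Ck_on_extend_zero[of ?B _ _ K]) (auto intro: compact_imp_closed)
  qed
  define k where "k = (\<lambda>i (x::'a). real i * flat 2 (real i * (1 - x \<bullet> x) - 1))"
  have pd: "partial_deriv b (\<phi> i) x = u x * (- 2 * k i x * (x \<bullet> b)) + partial_deriv b u x * cutoff i x"
    if x: "x \<in> ?B" for x i b
  proof -
    have "partial_deriv b (\<phi> i) x = partial_deriv b (\<lambda>x. u x * cutoff i x) x"
      using x by (intro partial_deriv_cong[of ?B]) (auto simp: \<phi>_def)
    moreover have "cutoff i differentiable (at x)"
      using smooth_cutoff[of 1 i, where 'a = 'a] by simp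
    ultimately show ?thesis
      using partial_deriv_mult[of u x "cutoff i" b] du[OF x]
      by (simp add: partial_deriv_cutoff k_def mult.assoc)
  qed
  have \<phi>_x: "\<phi> i x = u x * cutoff i x" if "x \<in> ?B" for x i
    using that by (simp add: \<phi>_def)
  define s where "s = (\<lambda>i x. (\<phi> i x - u x)\<^sup>2 + (\<Sum>b\<in>Basis. (partial_deriv b (\<phi> i) x - partial_deriv b u x)\<^sup>2))"
  have s_eq: "s i x = (\<phi> i x - u x)\<^sup>2 + (norm (grad (\<phi> i) x - grad u x))\<^sup>2" for i x
    by (simp add: s_def norm_sq_eq_sum_Basis grad_inner inner_diff_left)
  have lim: "(\<lambda>i. LINT x|?M. s i x) \<longlonglongrightarrow> (LINT x|?M. 0)"
  proof (rule dominated_convergence_unit_ball)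
    show "s i \<in> borel_measurable ?M" for i
    proof (rule continuous_imp_measurable_on_sets_lebesgue)
      have "Ck_on k UNIV (\<phi> i)" for k
        using test[of i] by (simp add: test_function_def smooth_on_def)
      from this[of 0] this[of 1] have "continuous_on ?B (\<phi> i)"
        "\<And>b. b \<in> Basis \<Longrightarrow> continuous_on ?B (partial_deriv b (\<phi> i))"
        by (auto intro: continuous_on_subset)
      then show "continuous_on ?B (s i)"
        unfolding s_def using cu cd by (intro continuous_intros) auto
    qed simp
    show "integrable ?M (\<lambda>x. C\<^sup>2 + (\<Sum>b\<in>(Basis::'a set). (7 * C)\<^sup>2))"
      by (intro integrable_unit_ball_UNIV continuous_intros)
    fix x :: 'a assume x: "x \<in> ?B"
    then have nx: "norm x < 1" by simp
    have "(\<lambda>i. (u x * cutoff i x - u x)\<^sup>2 + (\<Sum>b\<in>Basis. (u x * (- 2 * k i x * (x \<bullet> b)) +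
        partial_deriv b u x * cutoff i x - partial_deriv b u x)\<^sup>2))
      \<longlonglongrightarrow> (u x * 1 - u x)\<^sup>2 + (\<Sum>b\<in>(Basis::'a set). (u x * (- 2 * 0 * (x \<bullet> b)) +
        partial_deriv b u x * 1 - partial_deriv b u x)\<^sup>2)"
      unfolding k_def by (intro tendsto_intros cutoff_tendsto nx)
    then show "(\<lambda>i. s i x) \<longlonglongrightarrow> 0"
      using x \<phi>_x[OF x] by (simp add: s_def pd)
    fix i
    have z: "0 \<le> 1 - cutoff i x" "1 - cutoff i x \<le> 1"
      using cutoff_bounds[of i x] by auto
    have "\<phi> i x - u x = - (u x * (1 - cutoff i x))"
      using \<phi>_x[OF x] by (simp add: algebra_simps)
    then have "\<bar>\<phi> i x - u x\<bar> = \<bar>u x\<bar> * (1 - cutoff i x)"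
      using z(1) by (simp add: abs_mult)
    also have "\<dots> \<le> C * 1"
      using uC[OF x] C z by (intro mult_mono) auto
    finally have e1: "\<bar>\<phi> i x - u x\<bar> \<le> C" by simp
    have e2: "\<bar>partial_deriv b (\<phi> i) x - partial_deriv b u x\<bar> \<le> 7 * C" if b: "b \<in> Basis" for b
    proof -
      have xb: "\<bar>x \<bullet> b\<bar> \<le> 1" using Basis_le_norm[OF b, of x] nx by linarith
      have k0: "k i x \<ge> 0" by (simp add: k_def flat_nonneg)
      have "(1 - x \<bullet> x) * k i x \<le> 3"
        using flat_2_bound[of "real i * (1 - x \<bullet> x) - 1"] by (simp add: k_def algebra_simps)
      then have "\<bar>u x\<bar> * k i x \<le> 3 * C"
        using mult_right_mono[OF u[OF x] k0] mult_left_mono[of "(1 - x \<bullet> x) * k i x" 3 C] C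
        by (simp add: algebra_simps)
      moreover have "\<bar>u x\<bar> * k i x * \<bar>x \<bullet> b\<bar> \<le> \<bar>u x\<bar> * k i x * 1"
        using xb k0 by (intro mult_left_mono) auto
      ultimately have "\<bar>u x * (- 2 * k i x * (x \<bullet> b))\<bar> \<le> 6 * C"
        using k0 by (simp add: abs_mult algebra_simps)
      moreover have "\<bar>partial_deriv b u x * (1 - cutoff i x)\<bar> \<le> C * 1"
        unfolding abs_mult using gu[OF x b] C z by (intro mult_mono) auto
      ultimately show ?thesis
        unfolding pd[OF x] by (simp add: algebra_simps)
    qed
    have "\<bar>s i x\<bar> = s i x" by (simp add: s_eq)
    also have "\<dots> \<le> C\<^sup>2 + (\<Sum>b\<in>(Basis::'a set). (7 * C)\<^sup>2)"
      unfolding s_def by (intro add_mono sum_mono sq_le e1 e2)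
    finally show "\<bar>s i x\<bar> \<le> C\<^sup>2 + (\<Sum>b\<in>(Basis::'a set). (7 * C)\<^sup>2)" .
  qed simp
  have "H1_with_grad ?B u (grad u)"
    unfolding H1_with_grad_def using L2u L2g weak by blast
  moreover have "(\<lambda>i. LINT x|?M. (\<phi> i x - u x)\<^sup>2 + (norm (grad (\<phi> i) x - grad u x))\<^sup>2) \<longlonglongrightarrow> 0"
    using lim by (simp add: s_eq[symmetric])
  ultimately show ?thesis
    unfolding H10_def using test by blast
qed

text \<open>On a finite measure space, \<open>L\<^sup>2\<close> convergence implies convergence of the integrals: the variance
  is nonnegative.\<close>

lemma (in finite_measure) integral_tendsto_0_if_L2:
  fixes f :: "nat \<Rightarrow> 'a \<Rightarrow> real"
  assumes f: "\<And>i. integrable M (f i)" "\<And>i. integrable M (\<lambda>x. (f i x)\<^sup>2)"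
    and lim: "(\<lambda>i. LINT x|M. (f i x)\<^sup>2) \<longlonglongrightarrow> 0"
  shows "(\<lambda>i. LINT x|M. f i x) \<longlonglongrightarrow> 0"
proof (cases "measure M (space M) = 0")
  case True
  then have "AE x in M. False"
    by (rule_tac AE_I[where N = "space M"]) (auto simp: emeasure_eq_measure)
  then have "(LINT x|M. f i x) = (LINT x|M. 0)" for i
    using f(1) by (intro integral_cong_AE) (auto elim: eventually_mono)
  then show ?thesis by simp
next
  case False
  define V where "V = measure M (space M)"
  have V: "V > 0" using False by (simp add: V_def zero_less_measure_iff)
  have "(LINT x|M. f i x)\<^sup>2 \<le> V * (LINT x|M. (f i x)\<^sup>2)" for i
  proof -
    define c where "c = (LINT x|M. f i x) / V"
    have "0 \<le> (LINT x|M. (f i x - c)\<^sup>2)" by (rule integral_nonneg_AE) simp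
    also have "\<dots> = (LINT x|M. ((f i x)\<^sup>2 - 2 * c * f i x) + c\<^sup>2)"
      by (intro Bochner_Integration.integral_cong refl) (simp add: power2_eq_square algebra_simps)
    also have "\<dots> = (LINT x|M. (f i x)\<^sup>2) - 2 * c * (LINT x|M. f i x) + c\<^sup>2 * V"
      using f by (simp add: V_def)
    finally show ?thesis
      using V by (simp add: c_def power2_eq_square field_simps)
  qed
  moreover have "(\<lambda>i. V * (LINT x|M. (f i x)\<^sup>2)) \<longlonglongrightarrow> V * 0"
    by (intro tendsto_intros lim)
  ultimately have "(\<lambda>i. (LINT x|M. f i x)\<^sup>2) \<longlonglongrightarrow> 0"
    by (rule_tac real_tendsto_sandwich[where f = "\<lambda>_. 0" and h = "\<lambda>i. V * (LINT x|M. (f i x)\<^sup>2)"]) auto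
  then have "(\<lambda>i. sqrt ((LINT x|M. f i x)\<^sup>2)) \<longlonglongrightarrow> sqrt 0"
    by (rule tendsto_real_sqrt)
  then show ?thesis by (simp add: tendsto_rabs_zero_iff)
qed

text \<open>Let \<open>u\<close> have the weak gradient \<open>g\<close>. Approximation of \<open>u\<close> by test functions gives \<open>\<integral> u = - \<integral> (x \<bullet> b) (g \<bullet> b)\<close>
  without a boundary term. The definition of the weak gradient, tested with \<open>(x \<bullet> b) cutoff j\<close>, gives
  the same formula up to the term \<open>\<integral> u k\<^sub>j\<close>, where \<open>k\<^sub>j = - (x \<bullet> b) \<partial>\<^sub>b cutoff j\<close> is nonnegative. So \<open>\<integral> u k\<^sub>j \<rightarrow> 0\<close>,
  although \<open>\<integral> k\<^sub>j = \<integral> cutoff j\<close> tends to the volume of the ball.\<close>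

lemma not_H10_if_bounded_below:
  fixes u :: "'a::euclidean_space \<Rightarrow> real"
  assumes m: "m > 0" "\<And>x. x \<in> ball 0 1 \<Longrightarrow> m \<le> u x"
  shows "\<not> H10 (ball 0 1) u"
proof
  let ?B = "ball 0 1 :: 'a set"
  let ?M = "unit_ball_measure :: 'a measure"
  interpret M: finite_measure ?M by (rule finite_measure_unit_ball)
  assume "H10 ?B u"
  then obtain g \<phi> where H1: "H1_with_grad ?B u g" and test: "\<And>i. test_function ?B (\<phi> i)"
    and lim: "(\<lambda>i. LINT x|?M. (\<phi> i x - u x)\<^sup>2 + (norm (grad (\<phi> i) x - g x))\<^sup>2) \<longlonglongrightarrow> 0"
    unfolding H10_def by blast
  obtain b :: 'a where b: "b \<in> Basis" using nonempty_Basis by blast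
  have xb: "\<bar>x \<bullet> b\<bar> \<le> 1" if "x \<in> ?B" for x
    using Basis_le_norm[OF b, of x] that by simp
  have [measurable]: "u \<in> borel_measurable ?M" "g \<in> borel_measurable ?M"
    and u2: "integrable ?M (\<lambda>x. (u x)\<^sup>2)" and g2: "integrable ?M (\<lambda>x. (norm (g x))\<^sup>2)"
    using H1 by (auto simp: H1_with_grad_def L2_on_def)
  have [measurable]: "f \<in> borel_measurable ?M" if "continuous_on UNIV f" for f :: "'a \<Rightarrow> real"
    using that by (intro continuous_imp_measurable_on_sets_lebesgue) (auto intro: continuous_on_subset)
  have meas': "f \<in> borel_measurable ?M" if "continuous_on UNIV f" for f :: "'a \<Rightarrow> 'a"
    using that by (intro continuous_imp_measurable_on_sets_lebesgue) (auto intro: continuous_on_subset)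
  have le_sq: "\<bar>t\<bar> \<le> 1 + t\<^sup>2" for t :: real
    using zero_le_power2[of "\<bar>t\<bar> - 1"] by (simp add: power2_eq_square algebra_simps abs_mult_self_eq)
  have iu: "integrable ?M u"
    by (rule Bochner_Integration.integrable_bound[where f = "\<lambda>x. 1 + (u x)\<^sup>2"])
      (use u2 le_sq in \<open>auto intro!: AE_I2\<close>)
  have ig: "integrable ?M (\<lambda>x. norm (g x))"
    by (rule Bochner_Integration.integrable_bound[where f = "\<lambda>x. 1 + (norm (g x))\<^sup>2"])
      (use g2 le_sq[of "norm _"] in \<open>auto intro!: AE_I2\<close>)
  have gb: "\<bar>g x \<bullet> b\<bar> \<le> norm (g x)" for x
    using Basis_le_norm[OF b] .
  have igb: "integrable ?M (\<lambda>x. g x \<bullet> b)"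
    by (rule Bochner_Integration.integrable_bound[OF ig]) (auto intro!: AE_I2 gb)
  have Ck: "Ck_on k UNIV (\<phi> i)" for k i using test_functionD(1)[OF test] .
  have contx: "continuous_on UNIV (\<lambda>x. x \<bullet> b)" by (intro continuous_intros)
  have c\<phi>: "continuous_on UNIV (\<phi> i)" "continuous_on UNIV (partial_deriv b (\<phi> i))"
    "continuous_on UNIV (grad (\<phi> i))" for i
    using Ck[of 0 i] Ck[of 1 i] b by (auto intro!: continuous_on_grad)
  note [measurable] = meas'[OF c\<phi>(3)]
  have pdx: "partial_deriv b (\<lambda>x. x \<bullet> b) x = 1" for x :: 'a
  proof -
    have "((\<lambda>x. x \<bullet> b) has_derivative (\<lambda>h. h \<bullet> b)) (at x)"
      by (auto intro!: derivative_eq_intros)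
    then show ?thesis using partial_deriv_eq b by fastforce
  qed
  have dx: "(\<lambda>x. x \<bullet> b) differentiable (at x)" for x :: 'a
    using Ck_on_inner[of 1 UNIV b] by simp
  \<comment> \<open>integration by parts for the test functions, then for their limit \<open>u\<close>\<close>
  have parts: "(LINT x|?M. \<phi> i x) = - (LINT x|?M. (x \<bullet> b) * partial_deriv b (\<phi> i) x)" for i
  proof -
    obtain K where K: "compact K" "K \<subseteq> ?B" "\<forall>x. x \<notin> K \<longrightarrow> \<phi> i x = 0"
      using test_functionD(2)[OF test] by blast
    have "0 = (LINT x|?M. partial_deriv b (\<lambda>x. (x \<bullet> b) * \<phi> i x) x)"
      using K b by (intro integral_partial_deriv_unit_ball[of _ K, symmetric] Ck_on_mult Ck Ck_on_inner) auto
    also have "\<dots> = (LINT x|?M. (x \<bullet> b) * partial_deriv b (\<phi> i) x + \<phi> i x)"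
      using partial_deriv_mult[OF dx, of "\<phi> i"] Ck[of 1 i] by (simp add: pdx)
    also have "\<dots> = (LINT x|?M. (x \<bullet> b) * partial_deriv b (\<phi> i) x) + (LINT x|?M. \<phi> i x)"
      by (intro Bochner_Integration.integral_add integrable_unit_ball_UNIV continuous_intros c\<phi>)
    finally show ?thesis by simp
  qed
  let ?d = "\<lambda>i x. (\<phi> i x - u x)\<^sup>2 + (norm (grad (\<phi> i) x - g x))\<^sup>2"
  have sq2: "(s - t)\<^sup>2 \<le> 2 * s\<^sup>2 + 2 * t\<^sup>2" for s t :: real
    using zero_le_power2[of "s + t"] by (simp add: power2_eq_square algebra_simps)
  have id1: "integrable ?M (\<lambda>x. (\<phi> i x - u x)\<^sup>2)" for i
  proof (rule Bochner_Integration.integrable_bound[where f = "\<lambda>x. 2 * (\<phi> i x)\<^sup>2 + 2 * (u x)\<^sup>2"])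
    show "integrable ?M (\<lambda>x. 2 * (\<phi> i x)\<^sup>2 + 2 * (u x)\<^sup>2)"
      by (intro Bochner_Integration.integrable_add[OF integrable_unit_ball_UNIV integrable_mult_right[OF u2]]
          continuous_intros c\<phi>)
    show "(\<lambda>x. (\<phi> i x - u x)\<^sup>2) \<in> borel_measurable ?M" using c\<phi>(1)[of i] by measurable
  qed (use sq2 in \<open>auto intro!: AE_I2\<close>)
  have id2: "integrable ?M (\<lambda>x. (norm (grad (\<phi> i) x - g x))\<^sup>2)" for i
  proof (rule Bochner_Integration.integrable_bound[where f = "\<lambda>x. 2 * (norm (grad (\<phi> i) x))\<^sup>2 + 2 * (norm (g x))\<^sup>2"])
    show "integrable ?M (\<lambda>x. 2 * (norm (grad (\<phi> i) x))\<^sup>2 + 2 * (norm (g x))\<^sup>2)"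
      by (intro Bochner_Integration.integrable_add[OF integrable_unit_ball_UNIV integrable_mult_right[OF g2]]
          continuous_intros c\<phi>)
    have "(norm (v - w))\<^sup>2 \<le> 2 * (norm v)\<^sup>2 + 2 * (norm w)\<^sup>2" for v w :: 'a
    proof -
      have "(norm (v - w))\<^sup>2 \<le> (norm v + norm w)\<^sup>2"
        by (intro power_mono norm_triangle_ineq4) simp
      also have "\<dots> \<le> 2 * (norm v)\<^sup>2 + 2 * (norm w)\<^sup>2"
        using sq2[of "norm v" "- norm w"] by simp
      finally show ?thesis .
    qed
    then show "AE x in ?M. norm ((norm (grad (\<phi> i) x - g x))\<^sup>2) \<le> norm (2 * (norm (grad (\<phi> i) x))\<^sup>2 + 2 * (norm (g x))\<^sup>2)"
      by (auto intro!: AE_I2)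
  qed measurable
  have id: "integrable ?M (?d i)" for i using id1 id2 by (rule Bochner_Integration.integrable_add)
  have sandwich: "(\<lambda>i. LINT x|?M. (f i x)\<^sup>2) \<longlonglongrightarrow> 0" "integrable ?M (\<lambda>x. (f i x)\<^sup>2)"
    if f: "\<And>i. f i \<in> borel_measurable ?M" "\<And>i x. x \<in> ?B \<Longrightarrow> (f i x)\<^sup>2 \<le> ?d i x" for f i
  proof -
    have int: "integrable ?M (\<lambda>x. (f i x)\<^sup>2)" for i
      using f by (intro Bochner_Integration.integrable_bound[OF id[of i]]) (auto intro!: AE_I2)
    then show "integrable ?M (\<lambda>x. (f i x)\<^sup>2)" .
    have "(LINT x|?M. (f i x)\<^sup>2) \<le> (LINT x|?M. ?d i x)" for i
      using f(2) by (intro integral_mono int id) auto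
    then show "(\<lambda>i. LINT x|?M. (f i x)\<^sup>2) \<longlonglongrightarrow> 0"
      by (intro tendsto_sandwich[OF _ _ tendsto_const lim]) (auto intro!: always_eventually integral_nonneg_AE)
  qed
  have l1: "(\<lambda>i. LINT x|?M. \<phi> i x) \<longlonglongrightarrow> (LINT x|?M. u x)"
  proof -
    have "(\<lambda>i. LINT x|?M. \<phi> i x - u x) \<longlonglongrightarrow> 0"
      by (rule M.integral_tendsto_0_if_L2[OF Bochner_Integration.integrable_diff[OF
            integrable_unit_ball_UNIV[OF c\<phi>(1)] iu] sandwich(2) sandwich(1)])
        (use c\<phi>(1) in auto)
    then show ?thesis
      using iu integrable_unit_ball_UNIV[OF c\<phi>(1)] by (simp add: LIM_zero_iff)
  qed
  have l2: "(\<lambda>i. LINT x|?M. (x \<bullet> b) * partial_deriv b (\<phi> i) x) \<longlonglongrightarrow> (LINT x|?M. (x \<bullet> b) * (g x \<bullet> b))"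
  proof -
    have le: "((x \<bullet> b) * (partial_deriv b (\<phi> i) x - g x \<bullet> b))\<^sup>2 \<le> ?d i x" if x: "x \<in> ?B" for i x
    proof -
      have "\<bar>(x \<bullet> b) * (partial_deriv b (\<phi> i) x - g x \<bullet> b)\<bar> \<le> 1 * norm (grad (\<phi> i) x - g x)"
        unfolding abs_mult using xb[OF x] Basis_le_norm[OF b, of "grad (\<phi> i) x - g x"]
        by (intro mult_mono) (auto simp: grad_inner[OF b] inner_diff_left)
      then have "((x \<bullet> b) * (partial_deriv b (\<phi> i) x - g x \<bullet> b))\<^sup>2 \<le> (norm (grad (\<phi> i) x - g x))\<^sup>2"
        by (metis abs_le_square_iff abs_norm_cancel mult_1)
      then show ?thesis by (simp add: add_increasing)
    qed
    have ixg: "integrable ?M (\<lambda>x. (x \<bullet> b) * (g x \<bullet> b))"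
    proof (rule Bochner_Integration.integrable_bound[OF ig])
      show "(\<lambda>x. (x \<bullet> b) * (g x \<bullet> b)) \<in> borel_measurable ?M" using contx by measurable
      show "AE x in ?M. norm ((x \<bullet> b) * (g x \<bullet> b)) \<le> norm (norm (g x))"
        using mult_mono[OF xb gb] by (auto intro!: AE_I2 simp: abs_mult)
    qed
    have ixp: "integrable ?M (\<lambda>x. (x \<bullet> b) * partial_deriv b (\<phi> i) x)" for i
      by (intro integrable_unit_ball_UNIV continuous_intros c\<phi>)
    have eq: "(x \<bullet> b) * (partial_deriv b (\<phi> i) x - g x \<bullet> b) = (x \<bullet> b) * partial_deriv b (\<phi> i) x - (x \<bullet> b) * (g x \<bullet> b)" for x i
      by (simp add: algebra_simps)
    have i: "integrable ?M (\<lambda>x. (x \<bullet> b) * (partial_deriv b (\<phi> i) x - g x \<bullet> b))" for i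
      unfolding eq using ixp ixg by (rule Bochner_Integration.integrable_diff)
    have "(\<lambda>i. LINT x|?M. (x \<bullet> b) * (partial_deriv b (\<phi> i) x - g x \<bullet> b)) \<longlonglongrightarrow> 0"
      by (rule M.integral_tendsto_0_if_L2[OF i sandwich(2) sandwich(1)])
        (use i le in \<open>auto dest: borel_measurable_integrable\<close>)
    then show ?thesis
      unfolding eq using ixp ixg by (simp add: LIM_zero_iff)
  qed
  have u_eq: "(LINT x|?M. u x) = - (LINT x|?M. (x \<bullet> b) * (g x \<bullet> b))"
    using LIMSEQ_unique[OF l1] tendsto_minus[OF l2] parts by simp
  \<comment> \<open>the part of \<open>\<partial>\<^sub>b ((x \<bullet> b) cutoff j)\<close> that concentrates on the sphere\<close>
  define k where "k = (\<lambda>j (x::'a). 2 * real j * flat 2 (real j * (1 - x \<bullet> x) - 1) * (x \<bullet> b)\<^sup>2)"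
  define \<psi> where "\<psi> = (\<lambda>j (x::'a). (x \<bullet> b) * cutoff j x)"
  have pd\<psi>: "partial_deriv b (\<psi> j) x = cutoff j x - k j x" for j x
    unfolding \<psi>_def
    using partial_deriv_mult[OF dx, of "cutoff j"] smooth_cutoff[of 1 j, where 'a = 'a]
    by (simp add: pdx partial_deriv_cutoff k_def power2_eq_square algebra_simps)
  have ccut: "continuous_on UNIV (cutoff j :: 'a \<Rightarrow> real)" for j
    using smooth_cutoff[of 0 j] by simp
  have Ck\<psi>: "Ck_on n UNIV (\<psi> j)" for n j
    unfolding \<psi>_def by (intro Ck_on_mult Ck_on_inner smooth_cutoff) simp
  have ck: "continuous_on UNIV (k j)" for j
  proof -
    have "k j = (\<lambda>x. cutoff j x - partial_deriv b (\<psi> j) x)" by (simp add: pd\<psi>)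
    then show ?thesis using Ck\<psi>[of 1 j] b ccut by (auto intro!: continuous_intros)
  qed
  have test\<psi>: "test_function ?B (\<psi> j)"
    and int\<psi>: "(LINT x|?M. cutoff j x) = (LINT x|?M. k j x)" for j
  proof -
    obtain K where K: "compact K" "K \<subseteq> ?B" "\<forall>x. x \<notin> K \<longrightarrow> cutoff j x = 0"
      using cutoff_support by blast
    then show "test_function ?B (\<psi> j)"
      by (intro test_functionI[of _ K] Ck\<psi>) (auto simp: \<psi>_def)
    have "0 = (LINT x|?M. partial_deriv b (\<psi> j) x)"
      using K b by (intro integral_partial_deriv_unit_ball[of _ K, symmetric] Ck\<psi>) (auto simp: \<psi>_def)
    also have "\<dots> = (LINT x|?M. cutoff j x) - (LINT x|?M. k j x)"
      unfolding pd\<psi> by (intro Bochner_Integration.integral_diff integrable_unit_ball_UNIV ccut ck)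
    finally show "(LINT x|?M. cutoff j x) = (LINT x|?M. k j x)" by simp
  qed
  have prod_int: "integrable ?M (\<lambda>x. u x * f x)" if f: "continuous_on UNIV f" for f
  proof -
    have "bounded (f ` cball 0 1)"
      using f by (meson compact_cball compact_continuous_image compact_imp_bounded continuous_on_subset subset_UNIV)
    then obtain P where P: "\<forall>x\<in>cball 0 1. \<bar>f x\<bar> \<le> P"
      unfolding bounded_iff by (auto simp del: mem_cball_0 mem_cball)
    show ?thesis
    proof (rule Bochner_Integration.integrable_bound[where f = "\<lambda>x. P * u x"])
      show "(\<lambda>x. u x * f x) \<in> borel_measurable ?M" using f by measurable
      have "\<bar>u x * f x\<bar> \<le> \<bar>P * u x\<bar>" if "x \<in> ?B" for x
      proof -
        have "\<bar>f x\<bar> \<le> P" using P that by auto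
        then have "\<bar>f x\<bar> \<le> \<bar>P\<bar>" by simp
        then show ?thesis by (simp add: abs_mult mult.commute[of "u x"] mult_right_mono)
      qed
      then show "AE x in ?M. norm (u x * f x) \<le> norm (P * u x)" by (auto intro!: AE_I2)
    qed (use iu in simp)
  qed
  have weak: "(LINT x|?M. u x * partial_deriv b (\<psi> j) x) = - (LINT x|?M. \<psi> j x * (g x \<bullet> b))" for j
  proof -
    have C1: "Ck_on 1 UNIV (\<psi> j)" by (rule Ck\<psi>)
    have "integrable ?M (\<lambda>x. u x *\<^sub>R grad (\<psi> j) x)"
      unfolding grad_def scaleR_sum_right scaleR_scaleR
      using C1 by (auto intro!: Bochner_Integration.integrable_sum integrable_scaleR_left prod_int)
    moreover have "integrable ?M (\<lambda>x. \<psi> j x *\<^sub>R g x)"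
    proof (rule Bochner_Integration.integrable_bound[OF ig])
      have "continuous_on UNIV (\<psi> j)" using Ck\<psi>[of 0 j] by simp
      then show "(\<lambda>x. \<psi> j x *\<^sub>R g x) \<in> borel_measurable ?M" by measurable
      have "\<bar>\<psi> j x\<bar> \<le> 1" if "x \<in> ?B" for x
        using mult_mono[OF xb[OF that], of "\<bar>cutoff j x\<bar>" 1] cutoff_bounds[of j x] by (simp add: \<psi>_def abs_mult)
      then show "AE x in ?M. norm (\<psi> j x *\<^sub>R g x) \<le> norm (norm (g x))"
        by (auto intro!: AE_I2 mult_left_le_one_le)
    qed
    moreover have "(LINT x|?M. u x *\<^sub>R grad (\<psi> j) x) \<bullet> b = (- (LINT x|?M. \<psi> j x *\<^sub>R g x)) \<bullet> b"
      using H1 test\<psi> by (simp add: H1_with_grad_def)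
    ultimately show ?thesis
      using b by (simp add: integral_inner_left[symmetric] inner_minus_left grad_inner)
  qed
  have l3: "(\<lambda>j. LINT x|?M. \<psi> j x * (g x \<bullet> b)) \<longlonglongrightarrow> (LINT x|?M. (x \<bullet> b) * (g x \<bullet> b))"
  proof (rule dominated_convergence_unit_ball[OF _ _ ig])
    show "(\<lambda>x. \<psi> j x * (g x \<bullet> b)) \<in> borel_measurable ?M" for j
      using Ck\<psi>[of 0 j] by (simp, measurable)
    show "(\<lambda>x. (x \<bullet> b) * (g x \<bullet> b)) \<in> borel_measurable ?M" using contx by measurable
    fix x assume x: "x \<in> ?B"
    then have nx: "norm x < 1" by simp
    have "(\<lambda>j. \<psi> j x * (g x \<bullet> b)) \<longlonglongrightarrow> (x \<bullet> b) * 1 * (g x \<bullet> b)"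
      unfolding \<psi>_def by (intro tendsto_intros cutoff_tendsto nx)
    then show "(\<lambda>j. \<psi> j x * (g x \<bullet> b)) \<longlonglongrightarrow> (x \<bullet> b) * (g x \<bullet> b)" by simp
    fix j
    have "\<bar>\<psi> j x\<bar> \<le> 1"
      using mult_mono[OF xb[OF x], of "\<bar>cutoff j x\<bar>" 1] cutoff_bounds[of j x] by (simp add: \<psi>_def abs_mult)
    then show "\<bar>\<psi> j x * (g x \<bullet> b)\<bar> \<le> norm (g x)"
      using mult_mono[of "\<bar>\<psi> j x\<bar>" 1, OF _ gb[of x]] by (simp add: abs_mult)
  qed
  have l4: "(\<lambda>j. LINT x|?M. u x * cutoff j x) \<longlonglongrightarrow> (LINT x|?M. u x)"
  proof (rule dominated_convergence_unit_ball[OF _ _ integrable_abs[OF iu]])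
    show "(\<lambda>x. u x * cutoff j x) \<in> borel_measurable ?M" for j
      using prod_int[OF ccut] by (rule borel_measurable_integrable)
    fix x assume x: "x \<in> ?B"
    then have "(\<lambda>j. u x * cutoff j x) \<longlonglongrightarrow> u x * 1"
      by (intro tendsto_intros cutoff_tendsto) simp
    then show "(\<lambda>j. u x * cutoff j x) \<longlonglongrightarrow> u x" by simp
    show "\<bar>u x * cutoff j x\<bar> \<le> \<bar>u x\<bar>" for j
      using cutoff_bounds[of j x] by (simp add: abs_mult mult_left_le)
  qed simp
  have "(\<lambda>j. LINT x|?M. u x * k j x) \<longlonglongrightarrow> 0"
  proof -
    have "(LINT x|?M. u x * k j x) = (LINT x|?M. u x * cutoff j x) + (LINT x|?M. \<psi> j x * (g x \<bullet> b))" for j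
    proof -
      have "(LINT x|?M. u x * partial_deriv b (\<psi> j) x) = (LINT x|?M. u x * cutoff j x) - (LINT x|?M. u x * k j x)"
        unfolding pd\<psi> right_diff_distrib
        by (intro Bochner_Integration.integral_diff prod_int ccut ck)
      then show ?thesis using weak[of j] by simp
    qed
    then show ?thesis using tendsto_add[OF l4 l3] u_eq by simp
  qed
  moreover have "m * (LINT x|?M. cutoff j x) \<le> (LINT x|?M. u x * k j x)" for j
  proof -
    have "m * (LINT x|?M. cutoff j x) = (LINT x|?M. m * k j x)" by (simp add: int\<psi>)
    also have "\<dots> \<le> (LINT x|?M. u x * k j x)"
    proof (rule integral_mono)
      show "integrable ?M (\<lambda>x. m * k j x)" "integrable ?M (\<lambda>x. u x * k j x)"
        by (intro integrable_unit_ball_UNIV continuous_intros ck prod_int)+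
      show "m * k j x \<le> u x * k j x" if "x \<in> space ?M" for x
        using m that by (intro mult_right_mono) (auto simp: k_def flat_nonneg)
    qed
    finally show ?thesis .
  qed
  moreover have "(\<lambda>j. LINT x|?M. cutoff j x) \<longlonglongrightarrow> (LINT x|?M. 1)"
  proof (rule dominated_convergence_unit_ball[where w = "\<lambda>_. 1"])
    show "cutoff j \<in> borel_measurable ?M" for j using ccut by measurable
  qed (use cutoff_tendsto in \<open>auto intro: integrable_unit_ball_UNIV simp: abs_of_nonneg cutoff_bounds\<close>)
  then have "(\<lambda>j. m * (LINT x|?M. cutoff j x)) \<longlonglongrightarrow> m * measure lebesgue ?B"
    by (intro tendsto_intros) (simp add: measure_restrict_space)
  ultimately have "m * measure lebesgue ?B \<le> 0"
    by (intro LIMSEQ_le) auto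
  moreover have "m * measure lebesgue ?B > 0"
    using content_ball_pos[of 1 "0::'a"] m(1) by (intro mult_pos_pos) auto
  ultimately show False by linarith
qed

section \<open>Radial functions\<close>

lemma radial_partial_deriv:
  fixes u :: "'a::euclidean_space \<Rightarrow> real"
  assumes W: "open W" "x \<in> W" "\<And>z. z \<in> W \<Longrightarrow> u z = G (z \<bullet> z)"
    and G: "(G has_real_derivative D) (at (x \<bullet> x))"
  shows "u differentiable (at x)" and "partial_deriv b u x = 2 * (x \<bullet> b) * D"
proof -
  have d: "((\<lambda>z. z \<bullet> z) has_derivative (\<lambda>h. 2 * (x \<bullet> h))) (at x)"
    by (auto intro!: derivative_eq_intros simp: inner_commute)
  have "((\<lambda>z. G (z \<bullet> z)) has_derivative (\<lambda>h. D * (2 * (x \<bullet> h)))) (at x)"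
    using has_derivative_compose[OF d G[unfolded has_field_derivative_def]] by simp
  then have "(u has_derivative (\<lambda>h. D * (2 * (x \<bullet> h)))) (at x)"
    using W by (intro has_derivative_eq_on_open[of W x "\<lambda>z. G (z \<bullet> z)" u]) auto
  then show "u differentiable (at x)" "partial_deriv b u x = 2 * (x \<bullet> b) * D"
    using partial_deriv_eq[of u _ x b] by (auto simp: differentiable_def)
qed

lemma radial_laplacian:
  fixes u :: "'a::euclidean_space \<Rightarrow> real" and G G1 :: "real \<Rightarrow> real"
  assumes W: "open W" "x \<in> W" "\<And>z. z \<in> W \<Longrightarrow> u z = G (z \<bullet> z)"
    and G: "\<And>z. z \<in> W \<Longrightarrow> (G has_real_derivative G1 (z \<bullet> z)) (at (z \<bullet> z))"
    and G1: "(G1 has_real_derivative D) (at (x \<bullet> x))"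
  shows "laplacian u x = 4 * (x \<bullet> x) * D + 2 * DIM('a) * G1 (x \<bullet> x)"
    and "x \<bullet> grad u x = 2 * (x \<bullet> x) * G1 (x \<bullet> x)"
proof -
  have pd: "partial_deriv b u z = 2 * (z \<bullet> b) * G1 (z \<bullet> z)" if "z \<in> W" for z b
    using radial_partial_deriv(2)[OF W(1) that W(3) G[OF that]] by simp
  have "partial_deriv b (partial_deriv b u) x = 2 * G1 (x \<bullet> x) + 4 * D * (x \<bullet> b)\<^sup>2"
    if b: "b \<in> Basis" for b
  proof -
    have "partial_deriv b (partial_deriv b u) x = partial_deriv b (\<lambda>z. 2 * (z \<bullet> b) * G1 (z \<bullet> z)) x"
      using W pd by (intro partial_deriv_cong[of W]) auto
    also have "\<dots> = 2 * (b \<bullet> b) * G1 (x \<bullet> x) + 2 * (x \<bullet> b) * (D * (2 * (x \<bullet> b)))"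
    proof (subst partial_deriv_eq)
      have d: "((\<lambda>z. z \<bullet> z) has_derivative (\<lambda>h. 2 * (x \<bullet> h))) (at x)"
        by (auto intro!: derivative_eq_intros simp: inner_commute)
      have "((\<lambda>z. G1 (z \<bullet> z)) has_derivative (\<lambda>h. D * (2 * (x \<bullet> h)))) (at x)"
        using has_derivative_compose[OF d G1[unfolded has_field_derivative_def]] by simp
      then show "((\<lambda>z. 2 * (z \<bullet> b) * G1 (z \<bullet> z)) has_derivative
         (\<lambda>h. 2 * (h \<bullet> b) * G1 (x \<bullet> x) + 2 * (x \<bullet> b) * (D * (2 * (x \<bullet> h))))) (at x)"
        by (auto intro!: derivative_eq_intros)
    qed simp
    finally show ?thesis using b by (simp add: power2_eq_square)
  qed
  then have "laplacian u x = (\<Sum>b\<in>(Basis::'a set). 2 * G1 (x \<bullet> x) + 4 * D * (x \<bullet> b)\<^sup>2)"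
    unfolding laplacian_def by (intro sum.cong) auto
  also have "\<dots> = 2 * DIM('a) * G1 (x \<bullet> x) + 4 * D * (\<Sum>b\<in>(Basis::'a set). (x \<bullet> b)\<^sup>2)"
    by (simp add: sum.distrib sum_distrib_left)
  also have "(\<Sum>b\<in>(Basis::'a set). (x \<bullet> b)\<^sup>2) = x \<bullet> x"
    by (simp add: norm_sq_eq_sum_Basis[symmetric] dot_square_norm)
  finally show "laplacian u x = 4 * (x \<bullet> x) * D + 2 * DIM('a) * G1 (x \<bullet> x)"
    by simp
  have "x \<bullet> grad u x = (\<Sum>b\<in>(Basis::'a set). 2 * G1 (x \<bullet> x) * (x \<bullet> b)\<^sup>2)"
    unfolding grad_def inner_sum_right
    by (intro sum.cong) (auto simp: pd[OF W(2)] power2_eq_square)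
  also have "\<dots> = 2 * G1 (x \<bullet> x) * (\<Sum>b\<in>(Basis::'a set). (x \<bullet> b)\<^sup>2)"
    by (simp add: sum_distrib_left)
  finally show "x \<bullet> grad u x = 2 * (x \<bullet> x) * G1 (x \<bullet> x)"
    by (simp add: norm_sq_eq_sum_Basis[symmetric] dot_square_norm)
qed

text \<open>The radial equation in the variable \<open>y = r\<^sup>2\<close>, in which \<open>u'' + (2 \<nu> + 1) u' / r\<close> becomes
  \<open>4 y G'' + 4 (\<nu> + 1) G'\<close>. The limits at \<open>0\<close> exclude solutions with a singularity like \<open>y\<^sup>-\<^sup>\<nu>\<close>; in the
  variable \<open>t = - ln r\<close> they become the asymptotics at infinity.\<close>

definition radial_ode :: "real \<Rightarrow> real \<Rightarrow> (real \<Rightarrow> real) \<Rightarrow> (real \<Rightarrow> real) \<Rightarrow> (real \<Rightarrow> real) \<Rightarrow> bool" where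
  "radial_ode \<nu> lam G G1 G2 \<longleftrightarrow>
     (\<forall>y\<in>{0<..<1}. (G has_real_derivative G1 y) (at y) \<and> (G1 has_real_derivative G2 y) (at y) \<and>
        G y > 0 \<and> 4 * y * G2 y + 4 * (\<nu> + 1) * G1 y + lam * G y + G y powr (1 + 2 / \<nu>) = 0) \<and>
     G 0 > 0 \<and> (G \<longlongrightarrow> G 0) (at_right 0) \<and> ((\<lambda>y. y * G1 y) \<longlongrightarrow> 0) (at_right 0)"

definition vanishing_at_1 :: "(real \<Rightarrow> real) \<Rightarrow> (real \<Rightarrow> real) \<Rightarrow> bool" where
  "vanishing_at_1 G G1 \<longleftrightarrow> (G \<longlongrightarrow> 0) (at_left 1) \<and> (\<exists>B. \<forall>y\<in>{1/2<..<1}. \<bar>G1 y\<bar> \<le> B)"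

lemma tendsto_at_left_of_bounded_mono:
  fixes f :: "real \<Rightarrow> real"
  assumes ab: "a < b" and mono: "\<And>x y. a < x \<Longrightarrow> x \<le> y \<Longrightarrow> y < b \<Longrightarrow> f x \<le> f y"
    and bd: "\<And>x. a < x \<Longrightarrow> x < b \<Longrightarrow> f x \<le> C"
  shows "\<exists>L. (f \<longlongrightarrow> L) (at_left b)"
proof
  let ?L = "SUP x\<in>{a<..<b}. f x"
  have ne: "{a<..<b} \<noteq> {}" using ab by simp
  have bdd: "bdd_above (f ` {a<..<b})" using bd by (auto intro!: bdd_aboveI[where M = C])
  show "(f \<longlongrightarrow> ?L) (at_left b)"
  proof (rule order_tendstoI)
    fix l assume "l < ?L"
    then obtain x where x: "a < x" "x < b" "l < f x"
      using less_cSUP_iff[OF ne bdd] by auto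
    have "eventually (\<lambda>y. x < y \<and> y < b) (at_left b)"
      using x by (auto simp: eventually_at_left_field)
    then show "eventually (\<lambda>y. l < f y) (at_left b)"
      by (rule eventually_mono) (use x mono in \<open>smt (verit)\<close>)
  next
    fix l assume l: "?L < l"
    have "eventually (\<lambda>y. a < y \<and> y < b) (at_left b)"
      using ab by (auto simp: eventually_at_left_field)
    then show "eventually (\<lambda>y. f y < l) (at_left b)"
      by (rule eventually_mono) (use l cSUP_upper[OF _ bdd] in force)
  qed
qed

text \<open>The energy of the radial equation decreases in \<open>y\<close>. Since its potential part is bounded below,
  the derivative stays bounded as \<open>y \<rightarrow> 1\<close>, whatever the sign of \<open>lam\<close>.\<close>

lemma radial_ode_bounded_deriv:
  assumes ode: "radial_ode \<nu> lam G G1 G2" and \<nu>: "\<nu> > 0"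
  shows "\<exists>B. \<forall>y\<in>{1/2<..<1}. \<bar>G1 y\<bar> \<le> B"
proof -
  define q where "q = 1 + 2 / \<nu>"
  have q: "q > 1" using \<nu> by (simp add: q_def)
  define V where "V = (\<lambda>g::real. lam * g\<^sup>2 / 2 + g powr (q + 1) / (q + 1))"
  define H where "H = (\<lambda>y. 2 * y * (G1 y)\<^sup>2 + V (G y))"
  have ode': "(G has_real_derivative G1 y) (at y)" "(G1 has_real_derivative G2 y) (at y)" "G y > 0"
    "4 * y * G2 y + 4 * (\<nu> + 1) * G1 y + lam * G y + G y powr q = 0" if "y \<in> {0<..<1}" for y
    using ode that by (auto simp: radial_ode_def q_def)
  have H': "(H has_real_derivative - (4 * \<nu> + 2) * (G1 y)\<^sup>2) (at y)" if y: "y \<in> {0<..<1}" for y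
  proof -
    have "(H has_real_derivative (2 * (G1 y)\<^sup>2 + 4 * y * G1 y * G2 y + lam * G y * G1 y + G y powr q * G1 y)) (at y)"
    proof -
      have "((\<lambda>g. g powr (q + 1)) has_real_derivative (q + 1) * G y powr q) (at (G y))"
        using ode'(3)[OF y] by (auto intro!: derivative_eq_intros)
      from DERIV_cdivide[OF this, of "q + 1"] q
      have "((\<lambda>g. g powr (q + 1) / (q + 1)) has_real_derivative G y powr q) (at (G y))"
        by simp
      moreover have "((\<lambda>g. lam * g\<^sup>2 / 2) has_real_derivative lam * G y) (at (G y))"
        by (auto intro!: derivative_eq_intros)
      ultimately have "(V has_real_derivative lam * G y + G y powr q) (at (G y))"
        unfolding V_def by (rule DERIV_add[rotated])
      from DERIV_chain2[OF this ode'(1)[OF y]]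
      have "((\<lambda>y. V (G y)) has_real_derivative (lam * G y + G y powr q) * G1 y) (at y)" .
      moreover have "((\<lambda>y. 2 * y * (G1 y)\<^sup>2) has_real_derivative 2 * (G1 y)\<^sup>2 + 4 * y * G1 y * G2 y) (at y)"
        using ode'(2)[OF y] by (auto intro!: derivative_eq_intros simp: power2_eq_square)
      ultimately have "(H has_real_derivative (2 * (G1 y)\<^sup>2 + 4 * y * G1 y * G2 y) + (lam * G y + G y powr q) * G1 y) (at y)"
        unfolding H_def by (rule DERIV_add[rotated])
      then show ?thesis by (simp add: algebra_simps)
    qed
    moreover have "2 * (G1 y)\<^sup>2 + 4 * y * G1 y * G2 y + lam * G y * G1 y + G y powr q * G1 y
      = 2 * (G1 y)\<^sup>2 + G1 y * (4 * y * G2 y + 4 * (\<nu> + 1) * G1 y + lam * G y + G y powr q) - 4 * (\<nu> + 1) * (G1 y)\<^sup>2"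
      by (simp add: algebra_simps power2_eq_square)
    then have "2 * (G1 y)\<^sup>2 + 4 * y * G1 y * G2 y + lam * G y * G1 y + G y powr q * G1 y
      = - (4 * \<nu> + 2) * (G1 y)\<^sup>2"
      unfolding ode'(4)[OF y] by (simp add: algebra_simps)
    ultimately show ?thesis by simp
  qed
  have Hmono: "H y \<le> H (1/2)" if "1/2 \<le> y" "y < 1" for y
  proof (rule DERIV_nonpos_imp_nonincreasing[OF that(1)])
    fix x assume "1/2 \<le> x" "x \<le> y"
    then show "\<exists>D. (H has_real_derivative D) (at x) \<and> D \<le> 0"
      using H'[of x] \<nu> that by (intro exI[of _ "- (4 * \<nu> + 2) * (G1 x)\<^sup>2"]) (auto simp: mult_nonpos_nonneg)
  qed
  define A where "A = ((q + 1) * \<bar>lam\<bar> / 2) powr (1 / (q - 1))"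
  have Vlow: "V g \<ge> - (\<bar>lam\<bar> * A\<^sup>2 / 2)" if g: "g > 0" for g
  proof (cases "g \<ge> A")
    case True
    have "((q + 1) * \<bar>lam\<bar> / 2) powr 1 \<le> g powr (q - 1)"
      using powr_mono2[of "q - 1" A g] True q by (simp add: A_def powr_powr)
    then have "\<bar>lam\<bar> / 2 \<le> g powr (q - 1) / (q + 1)"
      using q by (simp add: field_simps)
    then have "0 \<le> lam / 2 + g powr (q - 1) / (q + 1)"
      using abs_ge_minus_self[of lam] by linarith
    then have "0 \<le> g\<^sup>2 * (lam / 2 + g powr (q - 1) / (q + 1))"
      by (intro mult_nonneg_nonneg) auto
    also have "\<dots> = V g"
    proof -
      have "g powr (q + 1) = g powr (q - 1) * g\<^sup>2"
        using g powr_add[of g "q - 1" 2] by (simp add: add.commute)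
      then show ?thesis by (simp add: V_def algebra_simps)
    qed
    finally show ?thesis by (smt (verit) abs_ge_zero divide_nonneg_nonneg mult_nonneg_nonneg zero_le_power2)
  next
    case False
    then have "g\<^sup>2 \<le> A\<^sup>2" using g by (intro power_mono) auto
    then have "\<bar>lam\<bar> * g\<^sup>2 \<le> \<bar>lam\<bar> * A\<^sup>2" by (intro mult_left_mono) auto
    moreover have "lam * g\<^sup>2 \<ge> - (\<bar>lam\<bar> * g\<^sup>2)"
      using mult_right_mono[of "- \<bar>lam\<bar>" lam "g\<^sup>2"] by simp
    moreover have "g powr (q + 1) / (q + 1) \<ge> 0" using q by simp
    ultimately show ?thesis by (simp add: V_def)
  qed
  define B where "B = H (1/2) + \<bar>lam\<bar> * A\<^sup>2 / 2"
  have "\<bar>G1 y\<bar> \<le> sqrt B" if y: "y \<in> {1/2<..<1}" for y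
  proof -
    have "(G1 y)\<^sup>2 * 1 \<le> (G1 y)\<^sup>2 * (2 * y)"
      using y by (intro mult_left_mono) auto
    also have "\<dots> = H y - V (G y)" by (simp add: H_def)
    also have "\<dots> \<le> B"
      using Hmono[of y] Vlow[of "G y"] ode'(3)[of y] y by (auto simp: B_def)
    finally have "sqrt ((G1 y)\<^sup>2) \<le> sqrt B" by (intro real_sqrt_le_mono) simp
    then show ?thesis by simp
  qed
  then show ?thesis by blast
qed

lemma radial_ode_limit_at_1:
  assumes ode: "radial_ode \<nu> lam G G1 G2" and \<nu>: "\<nu> > 0"
  shows "\<exists>L\<ge>0. (G \<longlongrightarrow> L) (at_left 1)"
proof -
  obtain B where B: "\<And>y. y \<in> {1/2<..<1} \<Longrightarrow> \<bar>G1 y\<bar> \<le> B"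
    using radial_ode_bounded_deriv[OF assms] by blast
  have G: "(G has_real_derivative G1 y) (at y)" "G y > 0" if "y \<in> {1/2<..<1}" for y
    using ode that by (auto simp: radial_ode_def)
  have step: "G x + B * x \<le> G y + B * y" "G y - B * y \<le> G x - B * x" if "1/2 < x" "x \<le> y" "y < 1" for x y
  proof -
    have "\<exists>D. ((\<lambda>y. G y + B * y) has_real_derivative D) (at z) \<and> D \<ge> 0"
      "\<exists>D. ((\<lambda>y. G y - B * y) has_real_derivative D) (at z) \<and> D \<le> 0" if "x \<le> z" "z \<le> y" for z
    proof -
      have z: "z \<in> {1/2<..<1}" using that \<open>1/2 < x\<close> \<open>y < 1\<close> by auto
      have "((\<lambda>y. G y + B * y) has_real_derivative (G1 z + B)) (at z)"
        "((\<lambda>y. G y - B * y) has_real_derivative (G1 z - B)) (at z)"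
        using G[OF z] by (auto intro!: derivative_eq_intros)
      then show "\<exists>D. ((\<lambda>y. G y + B * y) has_real_derivative D) (at z) \<and> D \<ge> 0"
        "\<exists>D. ((\<lambda>y. G y - B * y) has_real_derivative D) (at z) \<and> D \<le> 0"
        using B[OF z] by (intro exI[of _ "G1 z + B"] exI[of _ "G1 z - B"]; simp)+
    qed
    then show "G x + B * x \<le> G y + B * y" "G y - B * y \<le> G x - B * x"
      using DERIV_nonneg_imp_nondecreasing[of x y "\<lambda>y. G y + B * y"]
        DERIV_nonpos_imp_nonincreasing[of x y "\<lambda>y. G y - B * y"] that by blast+
  qed
  have B0: "B \<ge> 0" using B[of "3/4"] by simp
  obtain L where L: "((\<lambda>y. G y + B * y) \<longlongrightarrow> L) (at_left 1)"
  proof -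
    have "G y + B * y \<le> G (3/4) + 2 * B" if "3/4 < y" "y < 1" for y
      using step(2)[of "3/4" y] that B0 mult_left_mono[of y 1 B] by simp
    then show ?thesis
      using tendsto_at_left_of_bounded_mono[of "3/4" 1 "\<lambda>y. G y + B * y"] step(1) that by force
  qed
  have "((\<lambda>y. G y + B * y - B * y) \<longlongrightarrow> L - B * 1) (at_left 1)"
    by (intro tendsto_intros L)
  then have lim: "(G \<longlongrightarrow> L - B) (at_left 1)" by simp
  moreover have "eventually (\<lambda>y. 0 \<le> G y) (at_left 1)"
    using G(2) by (auto simp: eventually_at_left_field intro!: exI[of _ "1/2"] less_imp_le)
  ultimately have "0 \<le> L - B"
    by (intro tendsto_lowerbound[OF lim]) auto
  then show ?thesis using lim by blast
qed

text \<open>The smooth function \<open>G\<close> is recovered from the restriction of the solution to a coordinate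
  axis. The boundary value is forced by membership in \<open>H\<^sub>0\<^sup>1\<close>: a positive limit at the sphere would
  bound the solution below by a positive constant.\<close>

lemma radial_ode_of_solution:
  fixes v :: "'a::euclidean_space \<Rightarrow> real"
  assumes sol: "positive_radial_solution \<delta> lam v"
    and \<nu>: "\<nu> = (real DIM('a) - 2 - \<delta>) / 2" "\<nu> > 0"
  shows "\<exists>G G1 G2. radial_ode \<nu> lam G G1 G2 \<and> vanishing_at_1 G G1 \<and> (\<forall>x\<in>ball 0 1. v x = G (x \<bullet> x))"
proof -
  obtain V where V: "\<And>x. x \<in> ball 0 1 \<Longrightarrow> v x = V (norm x)"
    using sol by (auto simp: positive_radial_solution_def)
  have pos: "v x > 0" if "x \<in> ball 0 1" for x
    using sol that by (auto simp: positive_radial_solution_def)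
  have Ck: "Ck_on k (ball 0 1) v" for k
    using sol by (auto simp: positive_radial_solution_def solution_def smooth_on_def)
  have H: "H10 (ball 0 1) v"
    using sol by (auto simp: positive_radial_solution_def solution_def)
  obtain e :: 'a where e: "e \<in> Basis" using nonempty_Basis by blast
  then have ne: "norm e = 1" by simp
  define v1 where "v1 = partial_deriv e v"
  define v2 where "v2 = partial_deriv e v1"
  have C1: "Ck_on 1 (ball 0 1) v1"
    using Ck[of 2] e by (simp add: numeral_2_eq_2 v1_def)
  have dv: "v differentiable (at x)" "v1 differentiable (at x)" if "x \<in> ball 0 1" for x
    using Ck[of 1] C1 that by auto
  define U where "U = (\<lambda>r. v (r *\<^sub>R e))"
  define U1 where "U1 = (\<lambda>r. v1 (r *\<^sub>R e))"
  define U2 where "U2 = (\<lambda>r. v2 (r *\<^sub>R e))"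
  have rb: "r *\<^sub>R e \<in> ball 0 1" if "\<bar>r\<bar> < 1" for r
    using that ne by simp
  have dU: "(U has_real_derivative U1 r) (at r)" "(U1 has_real_derivative U2 r) (at r)" if "\<bar>r\<bar> < 1" for r
    using has_real_derivative_along[of v 0 r e] has_real_derivative_along[of v1 0 r e] dv[OF rb[OF that]]
    by (auto simp: U_def U1_def U2_def v1_def v2_def)
  have U1_cont: "isCont U1 0" using dU(2)[of 0] DERIV_isCont by force
  define G where "G = (\<lambda>y. U (sqrt y))"
  define G1 where "G1 = (\<lambda>y. U1 (sqrt y) / (2 * sqrt y))"
  define G2 where "G2 = (\<lambda>y. (U2 (sqrt y) - U1 (sqrt y) / sqrt y) / (4 * y))"
  have vG: "v x = G (x \<bullet> x)" if "x \<in> ball 0 1" for x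
  proof -
    have "v x = V (norm x)" using V that by blast
    also have "\<dots> = v (norm x *\<^sub>R e)" using V[of "norm x *\<^sub>R e"] that ne by simp
    finally show ?thesis by (simp add: G_def U_def norm_eq_sqrt_inner)
  qed
  have dG: "(G has_real_derivative G1 y) (at y)" "(G1 has_real_derivative G2 y) (at y)" if y: "y \<in> {0<..<1}" for y
  proof -
    have s: "\<bar>sqrt y\<bar> < 1" "sqrt y > 0" "sqrt y * sqrt y = y" using y by auto
    have ds: "(sqrt has_real_derivative 1 / (2 * sqrt y)) (at y)"
      using y by (auto intro!: derivative_eq_intros simp: field_simps)
    have c1: "((\<lambda>y. U (sqrt y)) has_real_derivative U1 (sqrt y) * (1 / (2 * sqrt y))) (at y)"
      by (rule DERIV_chain2[OF dU(1)[OF s(1)] ds])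
    then show "(G has_real_derivative G1 y) (at y)" by (simp add: G_def G1_def)
    have c2: "((\<lambda>y. U1 (sqrt y)) has_real_derivative U2 (sqrt y) * (1 / (2 * sqrt y))) (at y)"
      by (rule DERIV_chain2[OF dU(2)[OF s(1)] ds])
    have "((\<lambda>y. U1 (sqrt y) / (2 * sqrt y)) has_real_derivative
       (U2 (sqrt y) * (1 / (2 * sqrt y)) * (2 * sqrt y) - U1 (sqrt y) * (2 * (1 / (2 * sqrt y)))) / (2 * sqrt y * (2 * sqrt y))) (at y)"
      using s by (intro DERIV_divide c2 DERIV_cmult ds) auto
    moreover have "(U2 (sqrt y) * (1 / (2 * sqrt y)) * (2 * sqrt y) - U1 (sqrt y) * (2 * (1 / (2 * sqrt y)))) / (2 * sqrt y * (2 * sqrt y)) = G2 y"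
      using s by (simp add: G2_def)
    ultimately show "(G1 has_real_derivative G2 y) (at y)" by (simp add: G1_def)
  qed
  have Gpos: "G y > 0" if "0 \<le> y" "y < 1" for y
    unfolding G_def U_def using that by (intro pos rb) auto
  have eqn: "4 * y * G2 y + 4 * (\<nu> + 1) * G1 y + lam * G y + G y powr (1 + 2 / \<nu>) = 0" if y: "y \<in> {0<..<1}" for y
  proof -
    define x where "x = sqrt y *\<^sub>R e"
    have xx: "x \<bullet> x = y" using y ne by (simp add: x_def dot_square_norm power2_eq_square)
    then have nx: "(norm x)\<^sup>2 = y" by (simp add: dot_square_norm)
    define W where "W = ball (0::'a) 1 - {0}"
    have W: "open W" "x \<in> W"
      using y xx rb[of "sqrt y"] by (auto simp: W_def x_def)
    have inW: "z \<bullet> z \<in> {0<..<1}" if "z \<in> W" for z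
      using that by (auto simp: W_def dot_square_norm power_less_one_iff)
    have lap: "laplacian v x = 4 * y * G2 y + 2 * DIM('a) * G1 y" "x \<bullet> grad v x = 2 * y * G1 y"
      using radial_laplacian[OF W, of v G G1 "G2 y"] vG dG inW xx y by (auto simp: W_def)
    have "- laplacian v x + \<delta> * (((1 / (norm x)\<^sup>2) *\<^sub>R x) \<bullet> grad v x)
        = lam * v x + \<bar>v x\<bar> powr (4 / (real DIM('a) - 2 - \<delta>)) * v x"
      using sol W(2) unfolding positive_radial_solution_def solution_def W_def by blast
    moreover have "v x = G y" using vG[of x] W(2) xx by (simp add: W_def)
    moreover have "4 / (real DIM('a) - 2 - \<delta>) = 2 / \<nu>" using \<nu> by (simp add: field_simps)
    moreover have "\<bar>G y\<bar> powr (2 / \<nu>) * G y = G y powr (1 + 2 / \<nu>)"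
      using Gpos[of y] y by (simp add: powr_add)
    ultimately have "- (4 * y * G2 y + 2 * DIM('a) * G1 y) + \<delta> * (2 * G1 y) = lam * G y + G y powr (1 + 2 / \<nu>)"
      using lap nx y by simp
    moreover have "4 * (\<nu> + 1) = 2 * DIM('a) - 2 * \<delta>"
      by (simp add: \<nu> field_simps)
    then have "4 * (\<nu> + 1) * G1 y = (2 * DIM('a) - 2 * \<delta>) * G1 y" by simp
    then have "4 * (\<nu> + 1) * G1 y = 2 * DIM('a) * G1 y - \<delta> * (2 * G1 y)"
      by (simp add: left_diff_distrib)
    ultimately show ?thesis by linarith
  qed
  have s0: "(sqrt \<longlongrightarrow> 0) (at_right 0)"
    using tendsto_real_sqrt[of "\<lambda>y. y" 0 "at_right 0"] by simp
  have G0: "(G \<longlongrightarrow> G 0) (at_right 0)"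
    unfolding G_def
    using isCont_tendsto_compose[OF _ s0, of U] DERIV_isCont[OF dU(1)[of 0]] by simp
  have yG1: "((\<lambda>y. y * G1 y) \<longlongrightarrow> 0) (at_right 0)"
  proof (rule Lim_transform_eventually)
    show "((\<lambda>y. sqrt y * U1 (sqrt y) / 2) \<longlongrightarrow> 0) (at_right 0)"
      using tendsto_divide[OF tendsto_mult[OF s0 isCont_tendsto_compose[OF U1_cont s0]] tendsto_const[of 2]] by simp
    show "eventually (\<lambda>y. sqrt y * U1 (sqrt y) / 2 = y * G1 y) (at_right 0)"
    proof -
      have "sqrt y * U1 (sqrt y) / 2 = y * G1 y" if "y > 0" for y
      proof -
        have "s * s * (c / (2 * s)) = s * c / 2" if "s > 0" for s c :: real
          using that by simp
        then have "sqrt y * sqrt y * (U1 (sqrt y) / (2 * sqrt y)) = sqrt y * U1 (sqrt y) / 2"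
          using that by (metis real_sqrt_gt_zero)
        moreover have "sqrt y * sqrt y = y" using that by simp
        ultimately show ?thesis unfolding G1_def by metis
      qed
      then show ?thesis by (auto simp: eventually_at_filter)
    qed
  qed
  have ode: "radial_ode \<nu> lam G G1 G2"
    unfolding radial_ode_def using dG Gpos eqn G0 yG1 by auto
  obtain L where L: "L \<ge> 0" "(G \<longlongrightarrow> L) (at_left 1)"
    using radial_ode_limit_at_1[OF ode \<nu>(2)] by blast
  have "L = 0"
  proof (rule ccontr)
    assume "L \<noteq> 0"
    with L have "L / 2 < L" "L > 0" by auto
    with L(2) have "eventually (\<lambda>y. L / 2 < G y) (at_left 1)" by (intro order_tendstoD)
    then obtain b where b: "b < 1" "\<And>y. b < y \<Longrightarrow> y < 1 \<Longrightarrow> L / 2 < G y"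
      by (auto simp: eventually_at_left_field)
    define c where "c = max b (1/2)"
    have c: "0 \<le> c" "c < 1" using b by (auto simp: c_def)
    have "continuous_on {0..c} G"
      unfolding G_def
    proof (rule continuous_on_compose2[of "{0..sqrt c}" U _ sqrt])
      show "continuous_on {0..sqrt c} U"
      proof (rule continuous_at_imp_continuous_on, rule ballI)
        fix r assume "r \<in> {0..sqrt c}"
        then have "\<bar>r\<bar> < 1" using c by (auto intro: le_less_trans)
        then show "isCont U r" using dU(1) DERIV_isCont by blast
      qed
    qed (auto intro!: continuous_intros)
    then obtain y0 where y0: "y0 \<in> {0..c}" "\<And>y. y \<in> {0..c} \<Longrightarrow> G y0 \<le> G y"
      using continuous_attains_inf[of "{0..c}" G] c by auto
    define m where "m = min (G y0) (L / 2)"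
    have m: "m > 0" using Gpos[of y0] y0(1) c \<open>L > 0\<close> by (auto simp: m_def)
    have "m \<le> v x" if x: "x \<in> ball 0 1" for x
    proof -
      have xx: "0 \<le> x \<bullet> x" "x \<bullet> x < 1" using x by (auto simp: dot_square_norm power_less_one_iff)
      show ?thesis
      proof (cases "x \<bullet> x \<le> c")
        case True
        then show ?thesis using y0(2)[of "x \<bullet> x"] xx vG[OF x] by (auto simp: m_def)
      next
        case False
        then have "b < x \<bullet> x" by (simp add: c_def)
        then have "L / 2 < v x" using b(2)[of "x \<bullet> x"] xx vG[OF x] by simp
        then show ?thesis by (simp add: m_def)
      qed
    qed
    with m have "\<not> H10 (ball 0 1) v" by (rule not_H10_if_bounded_below)
    with H show False by simp
  qed
  then have "vanishing_at_1 G G1"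
    using L(2) radial_ode_bounded_deriv[OF ode \<nu>(2)] by (simp add: vanishing_at_1_def)
  then show ?thesis using ode vG by blast
qed

section \<open>Monotonicity up to a limit\<close>

lemma antimono_ge_limit:
  fixes f :: "real \<Rightarrow> real"
  assumes d: "\<And>s. s \<ge> t \<Longrightarrow> (f has_real_derivative f' s) (at s)" "\<And>s. s \<ge> t \<Longrightarrow> f' s \<le> 0"
    and lim: "(f \<longlongrightarrow> L) at_top"
  shows "L \<le> f t"
proof (rule tendsto_upperbound[OF lim])
  have "f s \<le> f t" if "s \<ge> t" for s
    using that d by (intro DERIV_nonpos_imp_nonincreasing[of t s f]) fastforce+
  then show "eventually (\<lambda>s. f s \<le> f t) at_top"
    by (auto simp: eventually_at_top_linorder)
qed simp

lemma antimono_gt_limit: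
  fixes f :: "real \<Rightarrow> real"
  assumes d: "\<And>s. s \<ge> t \<Longrightarrow> (f has_real_derivative f' s) (at s)" "\<And>s. s \<ge> t \<Longrightarrow> f' s < 0"
    and lim: "(f \<longlongrightarrow> L) at_top"
  shows "L < f t"
proof -
  have "L \<le> f (t + 1)"
    by (rule antimono_ge_limit[OF _ _ lim, where f' = f']) (use d in \<open>auto intro: less_imp_le\<close>)
  also have "f (t + 1) < f t"
    using d by (intro DERIV_neg_imp_decreasing[of t "t + 1" f]) fastforce+
  finally show ?thesis .
qed

lemma mono_le_limit:
  fixes f :: "real \<Rightarrow> real"
  assumes d: "\<And>s. s \<ge> t \<Longrightarrow> (f has_real_derivative f' s) (at s)" "\<And>s. s \<ge> t \<Longrightarrow> 0 \<le> f' s"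
    and lim: "(f \<longlongrightarrow> L) at_top"
  shows "f t \<le> L"
  using antimono_ge_limit[of t "\<lambda>s. - f s" "\<lambda>s. - f' s" "- L"] d
  by (auto intro!: DERIV_minus tendsto_minus lim)

lemma mono_ge_limit_at_right:
  fixes f :: "real \<Rightarrow> real"
  assumes d: "\<And>s. a < s \<Longrightarrow> s \<le> t \<Longrightarrow> (f has_real_derivative f' s) (at s)"
      "\<And>s. a < s \<Longrightarrow> s \<le> t \<Longrightarrow> 0 \<le> f' s"
    and lim: "(f \<longlongrightarrow> L) (at_right a)" and t: "a < t"
  shows "L \<le> f t"
proof (rule tendsto_upperbound[OF lim])
  have "f s \<le> f t" if "a < s" "s < t" for s
    using that d by (intro DERIV_nonneg_imp_nondecreasing[of s t f]) fastforce+
  then show "eventually (\<lambda>s. f s \<le> f t) (at_right a)"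
    using t by (auto simp: eventually_at_right_field)
qed simp

lemma mono_gt_limit_at_right:
  fixes f :: "real \<Rightarrow> real"
  assumes d: "\<And>s. a < s \<Longrightarrow> s \<le> t \<Longrightarrow> (f has_real_derivative f' s) (at s)"
      "\<And>s. a < s \<Longrightarrow> s \<le> t \<Longrightarrow> 0 < f' s"
    and lim: "(f \<longlongrightarrow> L) (at_right a)" and t: "a < t"
  shows "L < f t"
proof -
  have "L \<le> f ((a + t) / 2)"
    by (rule mono_ge_limit_at_right[OF _ _ lim, where f' = f']) (use d t in \<open>auto intro: less_imp_le\<close>)
  also have "\<dots> < f t"
  proof (rule DERIV_pos_imp_increasing[of _ _ f])
    fix x assume "(a + t) / 2 \<le> x" "x \<le> t"
    then show "\<exists>y. (f has_real_derivative y) (at x) \<and> 0 < y"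
      using d[of x] t by (intro exI[of _ "f' x"]) auto
  qed (use t in auto)
  finally show ?thesis .
qed

section \<open>The entire functions behind the Bessel functions\<close>

text \<open>\<open>J\<^sub>k(t)\<close> equals \<open>(t/2)\<^sup>k / \<Gamma>(k+1)\<close> times the value at \<open>t\<^sup>2\<close> of the following entire function.\<close>

definition bes_coeff :: "real \<Rightarrow> nat \<Rightarrow> real" where
  "bes_coeff k m = (- 1 / 4) ^ m / (fact m * pochhammer (k + 1) m)"

definition bes :: "real \<Rightarrow> real \<Rightarrow> real" where
  "bes k x = (\<Sum>m. bes_coeff k m * x ^ m)"

definition bes1 :: "real \<Rightarrow> real \<Rightarrow> real" where
  "bes1 k x = (\<Sum>m. diffs (bes_coeff k) m * x ^ m)"

definition bes2 :: "real \<Rightarrow> real \<Rightarrow> real" where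
  "bes2 k x = (\<Sum>m. diffs (diffs (bes_coeff k)) m * x ^ m)"

lemma bes_coeff_Suc:
  assumes "k > -1"
  shows "4 * (real m + 1) * (real m + k + 1) * bes_coeff k (Suc m) = - bes_coeff k m"
proof -
  have "pochhammer (k + 1) m > 0" "real m + k + 1 > 0"
    using assms by (auto intro!: pochhammer_pos)
  moreover have *: "4 * a * b * ((- 1 / 4 * x) / (a * f * (P * b))) = - (x / (f * P))"
    if "a > 0" "b > 0" "f > 0" "P > 0" for a b f P x :: real
    using that by simp
  moreover have c: "bes_coeff k (Suc m) = (- 1 / 4 * (- 1 / 4) ^ m) /
      ((real m + 1) * fact m * (pochhammer (k + 1) m * (real m + k + 1)))"
    by (simp add: bes_coeff_def pochhammer_Suc ac_simps)
  ultimately show ?thesis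
    unfolding c bes_coeff_def[of k m] by (intro *) auto
qed

lemma summable_bes:
  assumes "k > -1"
  shows "summable (\<lambda>m. bes_coeff k m * x ^ m)"
proof (rule summable_ratio_test[of "1/2" "nat \<lceil>\<bar>x\<bar>\<rceil> + 1"])
  fix m assume m: "m \<ge> nat \<lceil>\<bar>x\<bar>\<rceil> + 1"
  have mx: "real m \<ge> \<bar>x\<bar>" "real m \<ge> 1" using m by linarith+
  define D where "D = 4 * (real m + 1) * (real m + k + 1)"
  have "2 * \<bar>x\<bar> \<le> 4 * real m * 1" using mx by simp
  also have "\<dots> \<le> 4 * (real m + 1) * (real m + k + 1)"
  proof -
    have "real m * 1 \<le> (real m + k + 1) * (real m + 1)"
      using assms mx by (intro mult_mono) auto
    then show ?thesis by (simp add: algebra_simps)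
  qed
  finally have D: "2 * \<bar>x\<bar> \<le> D" "D > 0" using assms mx by (auto simp: D_def)
  have "D * (bes_coeff k (Suc m) * x ^ Suc m) = - (bes_coeff k m * x ^ m) * x"
  proof -
    have "D * bes_coeff k (Suc m) = - bes_coeff k m"
      unfolding D_def by (rule bes_coeff_Suc[OF assms])
    then have "(D * bes_coeff k (Suc m)) * (x ^ m * x) = - bes_coeff k m * (x ^ m * x)" by simp
    then show ?thesis by (simp add: ac_simps)
  qed
  then have "D * \<bar>bes_coeff k (Suc m) * x ^ Suc m\<bar> = \<bar>bes_coeff k m * x ^ m\<bar> * \<bar>x\<bar>"
    using D(2) by (metis abs_minus_cancel abs_mult abs_of_pos minus_mult_left)
  also have "\<dots> \<le> \<bar>bes_coeff k m * x ^ m\<bar> * (D / 2)"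
    using D by (intro mult_left_mono) auto
  finally show "norm (bes_coeff k (Suc m) * x ^ Suc m) \<le> 1/2 * norm (bes_coeff k m * x ^ m)"
    using D(2) by (simp add: field_simps)
qed simp

lemma
  assumes "k > -1"
  shows DERIV_bes: "(bes k has_real_derivative bes1 k x) (at x)"
    and DERIV_bes1: "(bes1 k has_real_derivative bes2 k x) (at x)"
  unfolding bes_def bes1_def bes2_def
  by (rule termdiffs_strong_converges_everywhere summable_bes[OF assms] termdiff_converges_all)+

lemma bes_0: "bes k 0 = 1"
  unfolding bes_def powser_zero by (simp add: bes_coeff_def)

lemma bes1_0:
  assumes "k > -1"
  shows "bes1 k 0 = - 1 / (4 * (k + 1))"
  using assms unfolding bes1_def powser_zero by (simp add: diffs_def bes_coeff_def pochhammer_Suc)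

lemma bes_ode:
  assumes "k > -1"
  shows "x * bes2 k x + (k + 1) * bes1 k x + bes k x / 4 = 0"
proof -
  let ?c = "bes_coeff k"
  have s0: "summable (\<lambda>m. ?c m * y ^ m)" for y using summable_bes[OF assms] .
  have s1: "summable (\<lambda>m. diffs ?c m * y ^ m)" for y using termdiff_converges_all[OF s0] .
  have s2: "summable (\<lambda>m. diffs (diffs ?c) m * y ^ m)" for y using termdiff_converges_all[OF s1] .
  have "(\<lambda>m. x * (of_nat m * diffs ?c m * x ^ (m - Suc 0))) sums (x * bes2 k x)"
    unfolding bes2_def by (intro sums_mult diffs_equiv s2)
  moreover have "x * (of_nat m * diffs ?c m * x ^ (m - Suc 0)) = of_nat m * diffs ?c m * x ^ m" for m
    by (cases m) auto
  ultimately have "(\<lambda>m. of_nat m * diffs ?c m * x ^ m) sums (x * bes2 k x)" by simp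
  moreover have "(\<lambda>m. (k + 1) * (diffs ?c m * x ^ m)) sums ((k + 1) * bes1 k x)"
    unfolding bes1_def by (intro sums_mult summable_sums s1)
  moreover have "(\<lambda>m. ?c m * x ^ m / 4) sums (bes k x / 4)"
    unfolding bes_def by (intro sums_divide summable_sums s0)
  ultimately have "(\<lambda>m. of_nat m * diffs ?c m * x ^ m + (k + 1) * (diffs ?c m * x ^ m) + ?c m * x ^ m / 4)
      sums (x * bes2 k x + (k + 1) * bes1 k x + bes k x / 4)"
    by (intro sums_add)
  moreover have "of_nat m * diffs ?c m * x ^ m + (k + 1) * (diffs ?c m * x ^ m) + ?c m * x ^ m / 4 = 0" for m
  proof -
    have "of_nat m * diffs ?c m + (k + 1) * diffs ?c m + ?c m / 4
      = (4 * (real m + 1) * (real m + k + 1) * ?c (Suc m) + ?c m) / 4"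
      by (simp add: diffs_def algebra_simps)
    also have "\<dots> = 0" by (simp only: bes_coeff_Suc[OF assms]) simp
    finally have "(of_nat m * diffs ?c m + (k + 1) * diffs ?c m + ?c m / 4) * x ^ m = 0" by simp
    then show ?thesis by (simp add: algebra_simps)
  qed
  ultimately show ?thesis
    using sums_unique2[of "\<lambda>_. 0::real" _ 0] by simp
qed

lemma bes_cont: "k > -1 \<Longrightarrow> isCont (bes k) x" "k > -1 \<Longrightarrow> isCont (bes1 k) x"
  using DERIV_bes DERIV_bes1 DERIV_isCont by blast+

lemma bessel_J_eq:
  assumes "k > -1" "t > 0"
  shows "bessel_J k t = rGamma (k + 1) * (t / 2) powr k * bes k (t\<^sup>2)"
proof -
  have "(-1) ^ m / fact m * rGamma (real m + k + 1) * (t / 2) powr (2 * real m + k)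
      = rGamma (k + 1) * (t / 2) powr k * (bes_coeff k m * (t\<^sup>2) ^ m)" for m
  proof -
    have p: "pochhammer (k + 1) m > 0" using assms by (intro pochhammer_pos) auto
    have "rGamma (k + 1) = pochhammer (k + 1) m * rGamma (real m + k + 1)"
      using pochhammer_rGamma[of "k + 1" m] by (simp add: algebra_simps)
    moreover have "(t / 2) powr (2 * real m + k) = (t / 2) powr k * (t\<^sup>2) ^ m / 4 ^ m"
    proof -
      have "(t / 2) powr (2 * real m + k) = (t / 2) powr (real (2 * m)) * (t / 2) powr k"
        by (simp add: powr_add)
      also have "(t / 2) powr (real (2 * m)) = (t / 2) ^ (2 * m)"
        using assms by (intro powr_realpow) simp
      also have "\<dots> = (t\<^sup>2) ^ m / 4 ^ m"
        by (simp add: power_mult power_divide)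
      finally show ?thesis by simp
    qed
    moreover have "(- 1 / 4 :: real) ^ m = (- 1) ^ m / 4 ^ m" by (rule power_divide)
    ultimately show ?thesis
      using p unfolding bes_coeff_def by (simp only:) (simp add: field_simps)
  qed
  then show ?thesis
    unfolding bessel_J_def bes_def
    using suminf_mult[OF summable_bes[OF assms(1)], of "rGamma (k + 1) * (t / 2) powr k" "t\<^sup>2"] by simp
qed

text \<open>In the variable \<open>t = - ln r\<close> the function \<open>J\<^sub>k(sqrt lam * r)\<close> becomes, up to a factor, a
  solution of \<open>\<phi>'' = (k\<^sup>2 - lam e\<^sup>-\<^sup>2\<^sup>t) \<phi>\<close> that behaves like \<open>e\<^sup>-\<^sup>k\<^sup>t\<close> at infinity.\<close>

definition phi :: "real \<Rightarrow> real \<Rightarrow> real \<Rightarrow> real" where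
  "phi k lam t = exp (- (k * t)) * bes k (lam * exp (- (2 * t)))"

definition dphi :: "real \<Rightarrow> real \<Rightarrow> real \<Rightarrow> real" where
  "dphi k lam t = exp (- (k * t)) * (- k * bes k (lam * exp (- (2 * t)))
     - 2 * (lam * exp (- (2 * t))) * bes1 k (lam * exp (- (2 * t))))"

lemma DERIV_phi:
  assumes "k > -1"
  shows "(phi k lam has_real_derivative dphi k lam t) (at t)"
proof -
  have x: "((\<lambda>t. lam * exp (- (2 * t))) has_real_derivative - 2 * (lam * exp (- (2 * t)))) (at t)"
    by (auto intro!: derivative_eq_intros)
  show ?thesis
    unfolding phi_def dphi_def
    by (rule derivative_eq_intros DERIV_chain2[OF DERIV_bes[OF assms] x] refl)+ (simp add: algebra_simps)
qed

lemma DERIV_dphi: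
  assumes "k > -1"
  shows "(dphi k lam has_real_derivative (k\<^sup>2 - lam * exp (- (2 * t))) * phi k lam t) (at t)"
proof -
  let ?x = "lam * exp (- (2 * t))"
  have x: "((\<lambda>t. lam * exp (- (2 * t))) has_real_derivative - 2 * ?x) (at t)"
    by (auto intro!: derivative_eq_intros)
  have e: "((\<lambda>t. exp (- (k * t))) has_real_derivative - k * exp (- (k * t))) (at t)"
    by (auto intro!: derivative_eq_intros)
  have g: "((\<lambda>t. - k * bes k (lam * exp (- (2 * t))) - 2 * (lam * exp (- (2 * t))) * bes1 k (lam * exp (- (2 * t))))
     has_real_derivative (- k * (bes1 k ?x * (- 2 * ?x)) - (2 * (- 2 * ?x) * bes1 k ?x + bes2 k ?x * (- 2 * ?x) * (2 * ?x)))) (at t)"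
    by (intro DERIV_diff DERIV_cmult DERIV_mult DERIV_chain2[OF DERIV_bes[OF assms] x]
        DERIV_chain2[OF DERIV_bes1[OF assms] x] x)
  have "(dphi k lam has_real_derivative
      (- k * exp (- (k * t))) * (- k * bes k ?x - 2 * ?x * bes1 k ?x)
      + (- k * (bes1 k ?x * (- 2 * ?x)) - (2 * (- 2 * ?x) * bes1 k ?x + bes2 k ?x * (- 2 * ?x) * (2 * ?x))) * exp (- (k * t))) (at t)"
    unfolding dphi_def by (rule DERIV_mult[OF e g])
  moreover have "(- k * exp (- (k * t))) * (- k * bes k ?x - 2 * ?x * bes1 k ?x)
      + (- k * (bes1 k ?x * (- 2 * ?x)) - (2 * (- 2 * ?x) * bes1 k ?x + bes2 k ?x * (- 2 * ?x) * (2 * ?x))) * exp (- (k * t))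
    = exp (- (k * t)) * ((k\<^sup>2 - ?x) * bes k ?x + 4 * ?x * (?x * bes2 k ?x + (k + 1) * bes1 k ?x + bes k ?x / 4))"
    by (simp add: algebra_simps power2_eq_square)
  ultimately have "(dphi k lam has_real_derivative
      exp (- (k * t)) * ((k\<^sup>2 - ?x) * bes k ?x + 4 * ?x * 0)) (at t)"
    by (simp only: bes_ode[OF assms])
  then show ?thesis by (simp add: phi_def ac_simps)
qed

lemma phi_asymptotics:
  assumes "k > -1"
  shows "((\<lambda>t. exp (k * t) * phi k lam t) \<longlongrightarrow> 1) at_top"
    and "((\<lambda>t. exp (k * t) * dphi k lam t) \<longlongrightarrow> - k) at_top"
proof -
  have x: "((\<lambda>t. lam * exp (- (2 * t))) \<longlongrightarrow> 0) at_top" by real_asymp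
  have b: "((\<lambda>t. bes k (lam * exp (- (2 * t)))) \<longlongrightarrow> 1) at_top"
    "((\<lambda>t. bes1 k (lam * exp (- (2 * t)))) \<longlongrightarrow> bes1 k 0) at_top"
    using isCont_tendsto_compose[OF bes_cont(1)[OF assms] x]
      isCont_tendsto_compose[OF bes_cont(2)[OF assms] x] by (auto simp: bes_0)
  have e: "exp (k * t) * (exp (- (k * t)) * y) = y" for t y :: real
    by (simp add: mult.assoc[symmetric] exp_add[symmetric])
  show "((\<lambda>t. exp (k * t) * phi k lam t) \<longlongrightarrow> 1) at_top"
    unfolding phi_def e by (rule b)
  have "((\<lambda>t. exp (k * t) * dphi k lam t) \<longlongrightarrow> - k * 1 - 2 * 0 * bes1 k 0) at_top"
    unfolding dphi_def e by (intro tendsto_intros b x)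
  then show "((\<lambda>t. exp (k * t) * dphi k lam t) \<longlongrightarrow> - k) at_top" by simp
qed

lemma phi_sign: "phi k lam t > 0 \<longleftrightarrow> bes k (lam * exp (- (2 * t))) > 0"
  "phi k lam t < 0 \<longleftrightarrow> bes k (lam * exp (- (2 * t))) < 0"
  by (auto simp: phi_def zero_less_mult_iff mult_less_0_iff)

section \<open>The first positive zero\<close>

text \<open>Comparison with a sine: on an interval of length \<open>\<pi>\<close> on which \<open>k\<^sup>2 - e\<^sup>-\<^sup>2\<^sup>t \<le> -1\<close>, the sum of the
  boundary values of a positive solution would be at most \<open>0\<close>.\<close>

lemma bes_has_zero:
  assumes k: "-1 < k" "k < 1"
  shows "\<exists>x>0. bes k x \<le> 0"
proof (rule ccontr)
  assume neg: "\<not> ?thesis"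
  have pos: "phi k 1 t > 0" for t
    using neg by (auto simp: phi_sign not_le)
  define W where "W = (\<lambda>t. dphi k 1 t * sin (t + 1 + pi) - phi k 1 t * cos (t + 1 + pi))"
  have "W (- 1) \<le> W (- 1 - pi)"
  proof (rule DERIV_nonpos_imp_nonincreasing[of _ _ W])
    fix t assume t: "- 1 - pi \<le> t" "t \<le> - 1"
    have "(W has_real_derivative (((k\<^sup>2 - 1 * exp (- (2 * t))) * phi k 1 t) * sin (t + 1 + pi)
        + phi k 1 t * sin (t + 1 + pi))) (at t)"
      unfolding W_def
      by (rule derivative_eq_intros DERIV_phi DERIV_dphi refl | use k in \<open>simp add: algebra_simps\<close>)+
    moreover have "((k\<^sup>2 - 1 * exp (- (2 * t))) * phi k 1 t) * sin (t + 1 + pi) + phi k 1 t * sin (t + 1 + pi)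
       = - ((exp (- (2 * t)) - 1 - k\<^sup>2) * (phi k 1 t * sin (t + 1 + pi)))"
      by (simp add: algebra_simps)
    moreover have "(exp (- (2 * t)) - 1 - k\<^sup>2) * (phi k 1 t * sin (t + 1 + pi)) \<ge> 0"
    proof (intro mult_nonneg_nonneg)
      have "1 + 2 \<le> exp (2::real)" using exp_ge_add_one_self[of 2] by simp
      also have "exp 2 \<le> exp (- (2 * t))" using t by simp
      finally have "exp (- (2 * t)) \<ge> 3" by simp
      moreover have "k\<^sup>2 \<le> 1" using k by (simp add: abs_square_le_1)
      ultimately show "0 \<le> exp (- (2 * t)) - 1 - k\<^sup>2" by simp
      show "0 \<le> sin (t + 1 + pi)" using t by (intro sin_ge_zero) auto
    qed (use pos in \<open>auto intro: less_imp_le\<close>)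
    ultimately show "\<exists>y. (W has_real_derivative y) (at t) \<and> y \<le> 0" by (metis neg_le_0_iff_le)
  qed simp
  moreover have "W (- 1) = phi k 1 (- 1)" "W (- 1 - pi) = - phi k 1 (- 1 - pi)"
    by (auto simp: W_def)
  ultimately show False using pos[of "- 1"] pos[of "- 1 - pi"] by linarith
qed

lemma bessel_zero_1_sq:
  assumes k: "-1 < k" "k < 1"
  defines "z \<equiv> (bessel_zero k 1)\<^sup>2"
  shows "z > 0" "bes k z = 0" "\<And>x. 0 \<le> x \<Longrightarrow> x < z \<Longrightarrow> bes k x > 0"
proof -
  have cont: "continuous_on S (bes k)" for S
    using bes_cont(1)[OF k(1)] by (auto intro: continuous_at_imp_continuous_on)
  obtain x1 where x1: "x1 > 0" "bes k x1 \<le> 0" using bes_has_zero[OF k] by blast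
  define Z where "Z = {x \<in> {0..x1}. bes k x \<le> 0}"
  have "closed Z" unfolding Z_def
    by (intro continuous_on_closed_Collect_le cont continuous_on_const closed_atLeastAtMost)
  moreover have "Z \<noteq> {}" "bdd_below Z" using x1 by (auto simp: Z_def intro!: bdd_belowI[of _ 0])
  ultimately have "Inf Z \<in> Z" by (intro closed_contains_Inf)
  define x0 where "x0 = Inf Z"
  have x0: "bes k x0 \<le> 0" "0 \<le> x0" "x0 \<le> x1" using \<open>Inf Z \<in> Z\<close> by (auto simp: x0_def Z_def)
  have before: "bes k x > 0" if "0 \<le> x" "x < x0" for x
  proof (rule ccontr)
    assume "\<not> bes k x > 0"
    then have "x \<in> Z" using that x0 by (auto simp: Z_def)
    then have "x0 \<le> x" unfolding x0_def by (intro cInf_lower \<open>bdd_below Z\<close>)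
    then show False using that by simp
  qed
  have "x0 \<noteq> 0" using x0(1) bes_0[of k] by auto
  then have "x0 > 0" using x0 by simp
  have "bes k x0 = 0"
  proof (rule antisym[OF x0(1)])
    have "(bes k \<longlongrightarrow> bes k x0) (at_left x0)"
      using bes_cont(1)[OF k(1), of x0] by (simp add: isCont_def filterlim_at_split)
    moreover have "eventually (\<lambda>x. 0 \<le> bes k x) (at_left x0)"
      using before \<open>x0 > 0\<close> by (auto simp: eventually_at_left_field intro!: exI[of _ 0] less_imp_le)
    ultimately show "0 \<le> bes k x0" by (intro tendsto_lowerbound[of "bes k" _ "at_left x0"]) auto
  qed
  have J0: "bessel_J k t = 0 \<longleftrightarrow> bes k (t\<^sup>2) = 0" if "t > 0" for t
  proof -
    have "rGamma (k + 1) \<noteq> 0"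
      using k Gamma_real_pos[of "k + 1"] by (simp add: rGamma_eq_zero_iff) (auto elim!: nonpos_Ints_cases)
    then show ?thesis using bessel_J_eq[OF k(1) that] that by simp
  qed
  have J0': "sqrt x0 \<le> t" if "t > 0" "bessel_J k t = 0" for t
  proof -
    have "x0 \<le> t\<^sup>2" using J0 that before[of "t\<^sup>2"] by fastforce
    then show ?thesis using that by (simp add: real_le_lsqrt)
  qed
  have Js: "bessel_J k (sqrt x0) = 0" using J0[of "sqrt x0"] \<open>x0 > 0\<close> \<open>bes k x0 = 0\<close> by simp
  have "bessel_zero k 1 = sqrt x0"
    unfolding bessel_zero_def
  proof (rule the_equality)
    have "{s. 0 < s \<and> s \<le> sqrt x0 \<and> bessel_J k s = 0} = {sqrt x0}"
      using J0' Js \<open>x0 > 0\<close> by (auto intro: antisym)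
    then show "0 < sqrt x0 \<and> bessel_J k (sqrt x0) = 0 \<and> card {s. 0 < s \<and> s \<le> sqrt x0 \<and> bessel_J k s = 0} = 1"
      using Js \<open>x0 > 0\<close> by simp
  next
    fix t assume t: "0 < t \<and> bessel_J k t = 0 \<and> card {s. 0 < s \<and> s \<le> t \<and> bessel_J k s = 0} = 1"
    then have "t \<in> {s. 0 < s \<and> s \<le> t \<and> bessel_J k s = 0}" "sqrt x0 \<in> {s. 0 < s \<and> s \<le> t \<and> bessel_J k s = 0}"
      using J0' Js \<open>x0 > 0\<close> by auto
    moreover obtain a where "{s. 0 < s \<and> s \<le> t \<and> bessel_J k s = 0} = {a}"
      using t card_1_singletonE by blast
    ultimately have "t \<in> {a}" "sqrt x0 \<in> {a}" by blast+
    then show "t = sqrt x0" by simp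
  qed
  then have "z = x0" using \<open>x0 > 0\<close> by (simp add: z_def)
  then show "z > 0" "bes k z = 0" "\<And>x. 0 \<le> x \<Longrightarrow> x < z \<Longrightarrow> bes k x > 0"
    using \<open>x0 > 0\<close> \<open>bes k x0 = 0\<close> before by auto
qed

text \<open>For negative arguments the power series has positive terms.\<close>

lemma bes_pos_nonpos_arg:
  assumes "k > -1" "x \<le> 0"
  shows "bes k x > 0"
proof -
  have t: "bes_coeff k m * x ^ m = (- x / 4) ^ m / (fact m * pochhammer (k + 1) m)" for m
  proof -
    have "(- 1 / 4 :: real) ^ m * x ^ m = (- x / 4) ^ m" by (simp add: power_mult_distrib[symmetric])
    then show ?thesis by (simp add: bes_coeff_def)
  qed
  have nn: "bes_coeff k m * x ^ m \<ge> 0" for m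
    unfolding t using assms by (intro divide_nonneg_nonneg zero_le_power mult_nonneg_nonneg pochhammer_nonneg) auto
  have "0 < bes_coeff k 0 * x ^ 0" by (simp add: bes_coeff_def)
  then show ?thesis
    unfolding bes_def by (rule suminf_pos2[OF summable_bes[OF assms(1)] nn])
qed

text \<open>The Wronskian of the two solutions is constant; its value is read off at infinity.\<close>

lemma phi_wronskian:
  assumes "-1 < k" "k < 1"
  shows "phi k lam t * dphi (- k) lam t - dphi k lam t * phi (- k) lam t = 2 * k"
proof -
  define W where "W = (\<lambda>t. phi k lam t * dphi (- k) lam t - dphi k lam t * phi (- k) lam t)"
  have d: "(W has_real_derivative 0) (at s)" for s
    unfolding W_def
    by (rule derivative_eq_intros DERIV_phi DERIV_dphi refl | use assms in \<open>simp add: algebra_simps\<close>)+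
  have "((\<lambda>t. (exp (k * t) * phi k lam t) * (exp (- k * t) * dphi (- k) lam t)
      - (exp (k * t) * dphi k lam t) * (exp (- k * t) * phi (- k) lam t)) \<longlongrightarrow> 1 * - (- k) - (- k) * 1) at_top"
    using assms by (intro tendsto_intros phi_asymptotics) auto
  moreover have "(exp (k * t) * phi k lam t) * (exp (- k * t) * dphi (- k) lam t)
      - (exp (k * t) * dphi k lam t) * (exp (- k * t) * phi (- k) lam t) = W t" for t
  proof -
    have "(a * p) * (b * q) - (a * r) * (b * s) = (a * b) * (p * q - r * s)" for a b p q r s :: real
      by (simp add: algebra_simps)
    moreover have "exp (k * t) * exp (- k * t) = 1" by (simp add: exp_add[symmetric])
    ultimately show ?thesis by (simp add: W_def)
  qed
  ultimately have lim: "(W \<longlongrightarrow> 2 * k) at_top" by simp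
  have "W t \<le> 2 * k" by (rule mono_le_limit[OF d _ lim]) simp
  moreover have "2 * k \<le> W t" by (rule antimono_ge_limit[OF d _ lim]) simp
  ultimately show ?thesis by (simp add: W_def)
qed

section \<open>The Emden-Fowler equation\<close>

lemma tendsto_null_mult_bounded:
  fixes f g :: "'b \<Rightarrow> real"
  assumes "(f \<longlongrightarrow> 0) F" "eventually (\<lambda>x. \<bar>g x\<bar> \<le> B) F"
  shows "((\<lambda>x. f x * g x) \<longlongrightarrow> 0) F"
proof (rule Lim_null_comparison)
  show "eventually (\<lambda>x. norm (f x * g x) \<le> \<bar>f x\<bar> * \<bar>B\<bar>) F"
    using assms(2) by (rule eventually_mono) (auto simp: abs_mult intro!: mult_left_mono)
  show "((\<lambda>x. \<bar>f x\<bar> * \<bar>B\<bar>) \<longlongrightarrow> 0) F"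
    using tendsto_mult[OF tendsto_rabs_zero[OF assms(1)] tendsto_const[of "\<bar>B\<bar>"]] by simp
qed

lemma first_zero:
  fixes f :: "real \<Rightarrow> real"
  assumes "x \<le> y" "f x > 0" "f y \<le> 0" and cont: "\<And>t. x \<le> t \<Longrightarrow> t \<le> y \<Longrightarrow> isCont f t"
  shows "\<exists>z. x < z \<and> z \<le> y \<and> f z = 0 \<and> (\<forall>s. x \<le> s \<and> s < z \<longrightarrow> f s > 0)"
proof -
  define Z where "Z = {t \<in> {x..y}. f t \<le> 0}"
  have c: "continuous_on {x..y} f" using cont by (auto intro!: continuous_at_imp_continuous_on)
  have "closed Z"
    unfolding Z_def using c by (intro continuous_on_closed_Collect_le continuous_on_const) auto
  moreover have "Z \<noteq> {}" "bdd_below Z" using assms by (auto simp: Z_def intro!: bdd_belowI[of _ x])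
  ultimately have "Inf Z \<in> Z" by (intro closed_contains_Inf)
  then have z: "x \<le> Inf Z" "Inf Z \<le> y" "f (Inf Z) \<le> 0" by (auto simp: Z_def)
  have before: "f s > 0" if "x \<le> s" "s < Inf Z" for s
  proof (rule ccontr)
    assume "\<not> f s > 0"
    then have "s \<in> Z" using that z by (auto simp: Z_def)
    then have "Inf Z \<le> s" by (intro cInf_lower \<open>bdd_below Z\<close>)
    then show False using that by simp
  qed
  have xz: "x < Inf Z" using z assms(2) by (cases "x = Inf Z") auto
  have "f (Inf Z) = 0"
  proof (rule antisym[OF z(3)])
    have "(f \<longlongrightarrow> f (Inf Z)) (at_left (Inf Z))"
      using cont[OF z(1,2)] by (simp add: isCont_def filterlim_at_split)
    moreover have "eventually (\<lambda>s. 0 \<le> f s) (at_left (Inf Z))"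
      using before xz by (auto simp: eventually_at_left_field intro!: exI[of _ x] less_imp_le)
    ultimately show "0 \<le> f (Inf Z)" by (intro tendsto_lowerbound[of f _ "at_left (Inf Z)"]) auto
  qed
  then show ?thesis using xz z before by blast
qed

lemma last_zero:
  fixes f :: "real \<Rightarrow> real"
  assumes "x \<le> y" "f x \<le> 0" "f y > 0" and cont: "\<And>t. x \<le> t \<Longrightarrow> t \<le> y \<Longrightarrow> isCont f t"
  shows "\<exists>z. x \<le> z \<and> z < y \<and> f z = 0 \<and> (\<forall>s. z < s \<and> s \<le> y \<longrightarrow> f s > 0)"
proof -
  have "isCont (\<lambda>t. f (- t)) t" if "- y \<le> t" "t \<le> - x" for t
    using cont[of "- t"] that by (intro isCont_o2[of t uminus f]) (auto intro!: continuous_intros)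
  then obtain z where z: "- y < z" "z \<le> - x" "f (- z) = 0" "\<forall>s. - y \<le> s \<and> s < z \<longrightarrow> f (- s) > 0"
    using first_zero[of "- y" "- x" "\<lambda>t. f (- t)"] assms by auto
  have "f s > 0" if "- z < s" "s \<le> y" for s using z(4)[rule_format, of "- s"] that by simp
  then show ?thesis using z by (intro exI[of _ "- z"]) auto
qed

text \<open>Up to a factor, these are all solutions of the linear equation that grow like \<open>e\<^sup>\<nu>\<^sup>t\<close>; the constant \<open>c\<close>
  is free to prescribe a boundary value at \<open>t = 0\<close>.\<close>

definition lin :: "real \<Rightarrow> real \<Rightarrow> real \<Rightarrow> real \<Rightarrow> real" where
  "lin \<nu> lam c t = phi (- \<nu>) lam t + c * phi \<nu> lam t"

definition dlin :: "real \<Rightarrow> real \<Rightarrow> real \<Rightarrow> real \<Rightarrow> real" where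
  "dlin \<nu> lam c t = dphi (- \<nu>) lam t + c * dphi \<nu> lam t"

definition dmult :: "real \<Rightarrow> real \<Rightarrow> real \<Rightarrow> real \<Rightarrow> real" where
  "dmult \<nu> lam c t = dphi \<nu> lam t * lin \<nu> lam c t + phi \<nu> lam t * dlin \<nu> lam c t"

locale bessel_pair =
  fixes \<nu> lam :: real
  assumes nu: "0 < \<nu>" "\<nu> < 1"
begin

abbreviation "\<phi> \<equiv> phi \<nu> lam"
abbreviation "d\<phi> \<equiv> dphi \<nu> lam"
definition q :: real where "q = 1 + 2 / \<nu>"

lemma q: "q > 1" using nu by (simp add: q_def)

abbreviation "Q t \<equiv> \<nu>\<^sup>2 - lam * exp (- (2 * t))"

lemma D\<phi>: "(\<phi> has_real_derivative d\<phi> t) (at t)"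
  and Dd\<phi>: "(d\<phi> has_real_derivative Q t * \<phi> t) (at t)"
  using DERIV_phi[of \<nu>] DERIV_dphi[of \<nu>] nu by auto

lemma Dlin: "(lin \<nu> lam c has_real_derivative dlin \<nu> lam c t) (at t)"
  unfolding lin_def dlin_def using nu by (intro DERIV_add DERIV_cmult DERIV_phi) auto

lemma Ddlin: "(dlin \<nu> lam c has_real_derivative Q t * lin \<nu> lam c t) (at t)"
proof -
  have "(dlin \<nu> lam c has_real_derivative ((- \<nu>)\<^sup>2 - lam * exp (- (2 * t))) * phi (- \<nu>) lam t
      + c * ((\<nu>\<^sup>2 - lam * exp (- (2 * t))) * phi \<nu> lam t)) (at t)"
    unfolding dlin_def using nu by (intro DERIV_add DERIV_cmult DERIV_dphi) auto
  then show ?thesis by (simp add: lin_def algebra_simps)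
qed

lemma conts: "isCont \<phi> t" "isCont d\<phi> t" "isCont (lin \<nu> lam c) t" "isCont (dlin \<nu> lam c) t"
  using D\<phi> Dd\<phi> Dlin Ddlin DERIV_isCont by blast+

lemma conts_at_right:
  "(\<phi> \<longlongrightarrow> \<phi> t) (at_right t)" "(d\<phi> \<longlongrightarrow> d\<phi> t) (at_right t)"
  "(lin \<nu> lam c \<longlongrightarrow> lin \<nu> lam c t) (at_right t)" "(dlin \<nu> lam c \<longlongrightarrow> dlin \<nu> lam c t) (at_right t)"
  using conts[of t] conts(3,4)[of c t] by (auto simp: isCont_def filterlim_at_split)

lemma wronskian: "\<phi> t * dlin \<nu> lam c t - d\<phi> t * lin \<nu> lam c t = 2 * \<nu>"
  using phi_wronskian[of \<nu> lam t] nu by (simp add: lin_def dlin_def algebra_simps)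

lemma decay:
  "((\<lambda>t. exp (\<nu> * t) * \<phi> t) \<longlongrightarrow> 1) at_top"
  "((\<lambda>t. exp (\<nu> * t) * d\<phi> t) \<longlongrightarrow> - \<nu>) at_top"
  "((\<lambda>t. exp (- (\<nu> * t)) * lin \<nu> lam c t) \<longlongrightarrow> 1) at_top"
  "((\<lambda>t. exp (- (\<nu> * t)) * dlin \<nu> lam c t) \<longlongrightarrow> \<nu>) at_top"
proof -
  show a: "((\<lambda>t. exp (\<nu> * t) * \<phi> t) \<longlongrightarrow> 1) at_top" "((\<lambda>t. exp (\<nu> * t) * d\<phi> t) \<longlongrightarrow> - \<nu>) at_top"
    using phi_asymptotics[of \<nu> lam] nu by auto
  have b: "((\<lambda>t. exp (- (\<nu> * t)) * phi (- \<nu>) lam t) \<longlongrightarrow> 1) at_top"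
    "((\<lambda>t. exp (- (\<nu> * t)) * dphi (- \<nu>) lam t) \<longlongrightarrow> \<nu>) at_top"
    using phi_asymptotics[of "- \<nu>" lam] nu by auto
  have e: "((\<lambda>t. exp (- (2 * \<nu> * t))) \<longlongrightarrow> 0) at_top" using nu by real_asymp
  have ee: "exp (- (2 * \<nu> * t)) * (exp (\<nu> * t) * y) = exp (- (\<nu> * t)) * y" for t y :: real
    by (simp add: mult.assoc[symmetric] exp_add[symmetric])
  have "((\<lambda>t. exp (- (\<nu> * t)) * phi (- \<nu>) lam t + c * (exp (- (2 * \<nu> * t)) * (exp (\<nu> * t) * \<phi> t))) \<longlongrightarrow> 1 + c * (0 * 1)) at_top"
    by (intro tendsto_intros a b e)
  then show "((\<lambda>t. exp (- (\<nu> * t)) * lin \<nu> lam c t) \<longlongrightarrow> 1) at_top"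
    unfolding ee lin_def by (simp add: algebra_simps)
  have "((\<lambda>t. exp (- (\<nu> * t)) * dphi (- \<nu>) lam t + c * (exp (- (2 * \<nu> * t)) * (exp (\<nu> * t) * d\<phi> t))) \<longlongrightarrow> \<nu> + c * (0 * (- \<nu>))) at_top"
    by (intro tendsto_intros a b e)
  then show "((\<lambda>t. exp (- (\<nu> * t)) * dlin \<nu> lam c t) \<longlongrightarrow> \<nu>) at_top"
    unfolding ee dlin_def by (simp add: algebra_simps)
qed

lemma mult_limit: "((\<lambda>t. \<phi> t * lin \<nu> lam c t) \<longlongrightarrow> 1) at_top"
proof -
  have "((\<lambda>t. (exp (\<nu> * t) * \<phi> t) * (exp (- (\<nu> * t)) * lin \<nu> lam c t)) \<longlongrightarrow> 1 * 1) at_top"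
    by (intro tendsto_mult decay)
  moreover have "(exp (\<nu> * t) * x) * (exp (- (\<nu> * t)) * y) = x * y" for t x y :: real
  proof -
    have "(exp (\<nu> * t) * x) * (exp (- (\<nu> * t)) * y) = (exp (\<nu> * t) * exp (- (\<nu> * t))) * (x * y)"
      by (simp only: ac_simps)
    then show ?thesis by (simp add: exp_add[symmetric])
  qed
  ultimately show ?thesis by simp
qed

lemma Dmult: "((\<lambda>t. \<phi> t * lin \<nu> lam c t) has_real_derivative dmult \<nu> lam c t) (at t)"
  unfolding dmult_def by (rule derivative_eq_intros D\<phi> Dlin refl)+ simp

lemma Ddmult:
  "(dmult \<nu> lam c has_real_derivative (2 * Q t * (\<phi> t * lin \<nu> lam c t) + 2 * (d\<phi> t * dlin \<nu> lam c t))) (at t)"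
proof -
  have "(dmult \<nu> lam c has_real_derivative ((Q t * \<phi> t) * lin \<nu> lam c t + dlin \<nu> lam c t * d\<phi> t)
      + (d\<phi> t * dlin \<nu> lam c t + (Q t * lin \<nu> lam c t) * \<phi> t)) (at t)"
    unfolding dmult_def by (intro DERIV_add DERIV_mult D\<phi> Dd\<phi> Dlin Ddlin)
  then show ?thesis by (simp add: algebra_simps)
qed

lemma dmult_0:
  "dmult \<nu> lam 0 t = 2 * (lam * exp (- (2 * t))) * - (bes1 \<nu> (lam * exp (- (2 * t))) * bes (- \<nu>) (lam * exp (- (2 * t)))
     + bes \<nu> (lam * exp (- (2 * t))) * bes1 (- \<nu>) (lam * exp (- (2 * t))))"
  (is "_ = ?r")
proof -
  have "exp (- (\<nu> * t)) * exp (\<nu> * t) = 1" by (simp add: exp_add[symmetric])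
  moreover have "dmult \<nu> lam 0 t = (exp (- (\<nu> * t)) * exp (\<nu> * t)) * ?r"
    by (simp add: dmult_def lin_def dlin_def phi_def dphi_def algebra_simps)
  ultimately show ?thesis by simp
qed

lemma dmult_cont: "isCont (dmult \<nu> lam c) t"
  using Ddmult DERIV_isCont by blast

text \<open>The square of the Wronskian, \<open>4 \<nu>\<^sup>2 = a'\<^sup>2 - 4 (\<phi> lin) (\<phi>' lin')\<close> for the product \<open>a = \<phi> lin\<close>, eliminates
  \<open>\<phi>' lin'\<close> from the second derivative of \<open>a\<close>.\<close>

lemma mult_first_integral:
  "2 * (\<phi> t * lin \<nu> lam c t) * (2 * Q t * (\<phi> t * lin \<nu> lam c t) + 2 * (d\<phi> t * dlin \<nu> lam c t))
    = (dmult \<nu> lam c t)\<^sup>2 + 4 * Q t * (\<phi> t * lin \<nu> lam c t)\<^sup>2 - 4 * \<nu>\<^sup>2"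
proof -
  have "4 * \<nu>\<^sup>2 = (\<phi> t * dlin \<nu> lam c t - d\<phi> t * lin \<nu> lam c t)\<^sup>2"
    by (simp add: wronskian power_mult_distrib)
  then show ?thesis
    by (simp only:) (simp add: dmult_def power2_eq_square algebra_simps)
qed

text \<open>Once decreasing, a positive multiplier stays decreasing. Where it turns to increase, its first
  integral gives \<open>Q a\<^sup>2 \<ge> \<nu>\<^sup>2\<close>. Both factors then grow, so that \<open>a\<close> can never stop increasing; but \<open>Q\<close>
  stays below \<open>\<nu>\<^sup>2\<close>, which forces \<open>a\<close> above its limit \<open>1\<close>.\<close>

lemma dmult_nonpos_after:
  assumes lam: "lam > 0" and pos: "\<And>t. t > 0 \<Longrightarrow> \<phi> t * lin \<nu> lam c t > 0"
    and t: "0 < t2" "t2 < t3" "dmult \<nu> lam c t2 \<le> 0"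
  shows "dmult \<nu> lam c t3 \<le> 0"
proof (rule ccontr)
  assume "\<not> ?thesis"
  then have t3: "dmult \<nu> lam c t3 > 0" by simp
  define A where "A = (\<lambda>t. \<phi> t * lin \<nu> lam c t)"
  define A' where "A' = dmult \<nu> lam c"
  define A'' where "A'' = (\<lambda>t. 2 * Q t * (\<phi> t * lin \<nu> lam c t) + 2 * (d\<phi> t * dlin \<nu> lam c t))"
  have dA: "(A has_real_derivative A' s) (at s)" "(A' has_real_derivative A'' s) (at s)" for s
    unfolding A_def A'_def A''_def by (rule Dmult, rule Ddmult)
  define K where "K = (\<lambda>s. Q s)"
  have FI: "2 * A s * A'' s = (A' s)\<^sup>2 + 4 * (K s * (A s)\<^sup>2) - 4 * \<nu>\<^sup>2" for s
    using mult_first_integral[of s c] by (simp add: A_def A'_def A''_def K_def)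
  have Apos: "A s > 0" if "s > 0" for s using pos that by (simp add: A_def)
  have Qmono: "K s < K s'" if "s < s'" for s s' using lam that by (simp add: K_def)
  have Amono: "A s \<le> A s'" if "s \<le> s'" "\<And>r. s \<le> r \<Longrightarrow> r \<le> s' \<Longrightarrow> A' r \<ge> 0" for s s'
    using that dA(1) by (intro DERIV_nonneg_imp_nondecreasing[of s s' A]) blast+
  \<comment> \<open>growth of \<open>K A\<^sup>2\<close> as long as \<open>A\<close> grows\<close>
  have h_mono: "K s' * (A s')\<^sup>2 > \<nu>\<^sup>2"
    if s: "0 < s" "s < s'" "\<And>r. s \<le> r \<Longrightarrow> r \<le> s' \<Longrightarrow> A' r \<ge> 0" and h: "K s * (A s)\<^sup>2 \<ge> \<nu>\<^sup>2" for s s'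
  proof -
    have Qs: "K s > 0"
      using h nu by (smt (verit) mult_nonpos_nonneg zero_le_power2 zero_less_power)
    have AA: "(A s)\<^sup>2 \<le> (A s')\<^sup>2" "(A s')\<^sup>2 > 0"
      using Amono[of s s'] s Apos[of s] Apos[of s'] by (auto intro!: power_mono)
    have "K s * (A s)\<^sup>2 \<le> K s * (A s')\<^sup>2" using AA Qs by (intro mult_left_mono) auto
    also have "\<dots> < K s' * (A s')\<^sup>2" using AA Qmono[OF s(2)] by (intro mult_strict_right_mono) auto
    finally show ?thesis using h by simp
  qed
  have cont: "isCont A' s" for s using dA(2) DERIV_isCont by blast
  obtain z where z: "t2 \<le> z" "z < t3" "A' z = 0" "\<forall>s. z < s \<and> s \<le> t3 \<longrightarrow> A' s > 0"
    using last_zero[of t2 t3 A'] t t3 cont by (auto simp: A'_def)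
  have "A'' z \<ge> 0"
  proof (rule ccontr)
    assume "\<not> A'' z \<ge> 0"
    then obtain d where d: "d > 0" "\<And>h. 0 < h \<Longrightarrow> h < d \<Longrightarrow> A' (z + h) < A' z"
      using DERIV_neg_dec_right[OF dA(2), of z] by auto
    define h where "h = min (d / 2) (t3 - z)"
    have "0 < h" "h < d" "z + h \<le> t3" using d z by (auto simp: h_def)
    then show False using d(2)[of h] z by (smt (verit))
  qed
  then have "2 * A z * A'' z \<ge> 0" using Apos[of z] z t by simp
  then have hz: "K z * (A z)\<^sup>2 \<ge> \<nu>\<^sup>2" using FI[of z] z(3) by simp
  have h3: "K t3 * (A t3)\<^sup>2 > \<nu>\<^sup>2"
    by (rule h_mono[OF _ z(2) _ hz]) (use z t in \<open>auto simp: order.order_iff_strict\<close>)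
  have up: "A' s > 0" if s3: "s \<ge> t3" for s
  proof (rule ccontr)
    assume "\<not> A' s > 0"
    then obtain y where y: "t3 < y" "A' y = 0" "\<forall>s. t3 \<le> s \<and> s < y \<longrightarrow> A' s > 0"
      using first_zero[OF s3, of A'] t3 cont by (auto simp: A'_def)
    have "K y * (A y)\<^sup>2 > \<nu>\<^sup>2"
      by (rule h_mono[of t3]) (use y t h3 in \<open>auto simp: order.order_iff_strict\<close>)
    then have "2 * A y * A'' y > 0" using FI[of y] y(2) by simp
    then have "A'' y > 0" using Apos[of y] y t by (simp add: zero_less_mult_iff)
    then obtain d where d: "d > 0" "\<And>h. 0 < h \<Longrightarrow> h < d \<Longrightarrow> A' (y - h) < A' y"
      using DERIV_pos_inc_left[OF dA(2), of y] by auto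
    define h where "h = min (d / 2) (y - t3)"
    have "0 < h" "h < d" "t3 \<le> y - h" using d y by (auto simp: h_def)
    then show False using d(2)[of h] y by (smt (verit))
  qed
  have "A t3 \<le> 1"
    by (rule mono_le_limit[OF dA(1)]) (use up mult_limit in \<open>auto simp: A_def less_imp_le\<close>)
  then have "(A t3)\<^sup>2 \<le> 1" using Apos[of t3] t by (simp add: power_le_one)
  moreover have "K t3 < \<nu>\<^sup>2" using lam by (simp add: K_def)
  moreover have "K t3 > 0"
    using h3 nu by (smt (verit) mult_nonpos_nonneg zero_le_power2 zero_less_power)
  ultimately have "K t3 * (A t3)\<^sup>2 \<le> K t3" by (simp add: mult_left_le)
  then show False using h3 \<open>K t3 < \<nu>\<^sup>2\<close> by linarith
qed

end

text \<open>The radial equation for \<open>w = r\<^sup>\<nu> u\<close>, with \<open>t = - ln r\<close>, on the punctured ball \<open>0 < r < e\<^sup>-\<^sup>a\<close>. In this form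
  the critical power has a constant coefficient. The two limits say that \<open>u\<close> has the value \<open>\<gamma>\<close> at
  the centre and that \<open>r u'\<close> vanishes there.\<close>

locale emden_fowler = bessel_pair \<nu> lam for \<nu> lam +
  fixes \<gamma> a :: real and w w1 :: "real \<Rightarrow> real"
  assumes Dw: "\<And>t. t > a \<Longrightarrow> (w has_real_derivative w1 t) (at t)"
    and Dw1: "\<And>t. t > a \<Longrightarrow> (w1 has_real_derivative
        ((\<nu>\<^sup>2 - lam * exp (- (2 * t))) * w t - w t powr (1 + 2 / \<nu>))) (at t)"
    and w_pos: "\<And>t. t > a \<Longrightarrow> w t > 0"
    and \<gamma>: "\<gamma> > 0"
    and w_lim: "((\<lambda>t. exp (\<nu> * t) * w t) \<longlongrightarrow> \<gamma>) at_top"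
    and w1_lim: "((\<lambda>t. exp (\<nu> * t) * w1 t) \<longlongrightarrow> - (\<nu> * \<gamma>)) at_top"
begin

text \<open>The Wronskians of \<open>w\<close> with the two linear solutions: their derivatives contain the nonlinear term
  alone.\<close>

definition N1 :: "real \<Rightarrow> real" where
  "N1 t = \<phi> t * w1 t - d\<phi> t * w t"

definition N2 :: "real \<Rightarrow> real \<Rightarrow> real" where
  "N2 c t = lin \<nu> lam c t * w1 t - dlin \<nu> lam c t * w t"

text \<open>The Pohozaev function whose multiplier is the product of the two linear solutions.\<close>

definition P :: "real \<Rightarrow> real \<Rightarrow> real" where
  "P c t = N1 t * N2 c t / 2 + \<phi> t * lin \<nu> lam c t * (w t powr (q + 1) / (q + 1))"

lemmas Dw1_q = Dw1[folded q_def]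

lemma DN1: "t > a \<Longrightarrow> (N1 has_real_derivative - (w t powr q * \<phi> t)) (at t)"
  unfolding N1_def
  by (rule derivative_eq_intros D\<phi> Dd\<phi> Dw Dw1_q refl | assumption)+ (simp add: algebra_simps)

lemma DN2: "t > a \<Longrightarrow> (N2 c has_real_derivative - (w t powr q * lin \<nu> lam c t)) (at t)"
  unfolding N2_def
  by (rule derivative_eq_intros Dlin Ddlin Dw Dw1_q refl | assumption)+ (simp add: algebra_simps)

lemma Dwpow: "t > a \<Longrightarrow> ((\<lambda>t. w t powr (q + 1) / (q + 1)) has_real_derivative w t powr q * w1 t) (at t)"
proof -
  assume t: "t > a"
  have "((\<lambda>x. x powr (q + 1)) has_real_derivative (q + 1) * w t powr q) (at (w t))"
    using w_pos[OF t] by (auto intro!: derivative_eq_intros)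
  from DERIV_cdivide[OF DERIV_chain2[OF this Dw[OF t]], of "q + 1"] show ?thesis
    using q by simp
qed

lemma w_powr: "t > a \<Longrightarrow> w t powr (q + 1) = w t powr q * w t"
  using w_pos[of t] by (simp add: powr_add)

text \<open>In \<open>P' = (N1' N2 + N1 N2') / 2 + (a w\<^sup>q\<^sup>+\<^sup>1 / (q + 1))'\<close> the terms with \<open>a w\<^sup>q w'\<close> cancel, because \<open>N1'\<close> and
  \<open>N2'\<close> are \<open>- w\<^sup>q\<close> times the linear solutions. Only the derivative of the multiplier \<open>a\<close> remains.\<close>

lemma DP: "t > a \<Longrightarrow> (P c has_real_derivative
    (1 / 2 + 1 / (q + 1)) * dmult \<nu> lam c t * w t powr (q + 1)) (at t)"
proof -
  assume t: "t > a"
  let ?l = "lin \<nu> lam c t" and ?dl = "dlin \<nu> lam c t" and ?p = "w t powr q"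
  have "(P c has_real_derivative ((- (?p * \<phi> t)) * N2 c t + (- (?p * ?l)) * N1 t) / 2
     + (dmult \<nu> lam c t * (w t powr (q + 1) / (q + 1)) + (?p * w1 t) * (\<phi> t * ?l))) (at t)"
    unfolding P_def
    by (intro DERIV_add DERIV_cdivide DERIV_mult DN1 DN2 Dmult Dwpow t)
  moreover have "\<phi> t * N2 c t + ?l * N1 t = 2 * (\<phi> t * ?l * w1 t) - dmult \<nu> lam c t * w t"
    by (simp add: N1_def N2_def dmult_def algebra_simps)
  then have "((- (?p * \<phi> t)) * N2 c t + (- (?p * ?l)) * N1 t) / 2
      = - (?p * (2 * (\<phi> t * ?l * w1 t) - dmult \<nu> lam c t * w t)) / 2"
    by (simp only: minus_mult_left[symmetric] mult.assoc distrib_left[symmetric] minus_add_distrib[symmetric])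
  moreover have "- (p * (2 * X - d * W)) / 2 + (d * (p * W / (q + 1)) + p * X) = (1 / 2 + 1 / (q + 1)) * d * (p * W)"
    for p X d W :: real
    using q by (simp add: field_simps)
  from this[of ?p "\<phi> t * ?l * w1 t" "dmult \<nu> lam c t" "w t"]
  have "- (?p * (2 * (\<phi> t * ?l * w1 t) - dmult \<nu> lam c t * w t)) / 2
      + (dmult \<nu> lam c t * (w t powr (q + 1) / (q + 1)) + (?p * w1 t) * (\<phi> t * ?l))
    = (1 / 2 + 1 / (q + 1)) * dmult \<nu> lam c t * w t powr (q + 1)"
    unfolding w_powr[OF t] by (simp add: ac_simps)
  ultimately show ?thesis by (simp only:)
qed

lemma w_lims: "(w \<longlongrightarrow> 0) at_top" "((\<lambda>t. w t powr (q + 1)) \<longlongrightarrow> 0) at_top"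
proof -
  have e: "((\<lambda>t. exp (- (\<nu> * t))) \<longlongrightarrow> 0) at_top" using nu by real_asymp
  have "exp (- (\<nu> * t)) * (exp (\<nu> * t) * w t) = w t" for t
    by (simp add: mult.assoc[symmetric] exp_add[symmetric])
  then show lim: "(w \<longlongrightarrow> 0) at_top"
    using tendsto_mult[OF e w_lim] by (simp only: mult_zero_left)
  have "eventually (\<lambda>t. 0 \<le> w t) at_top"
    using eventually_gt_at_top[of a] by (rule eventually_mono) (use w_pos in \<open>auto intro: less_imp_le\<close>)
  from tendsto_zero_powrI[OF lim tendsto_const this, of "q + 1"] q
  show "((\<lambda>t. w t powr (q + 1)) \<longlongrightarrow> 0) at_top" by simp
qed

lemma N_lims: "(N1 \<longlongrightarrow> 0) at_top" "(N2 c \<longlongrightarrow> - (2 * \<nu> * \<gamma>)) at_top"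
proof -
  have e: "((\<lambda>t. exp (- (2 * \<nu> * t))) \<longlongrightarrow> 0) at_top" using nu by real_asymp
  have "((\<lambda>t. exp (- (2 * \<nu> * t)) * ((exp (\<nu> * t) * \<phi> t) * (exp (\<nu> * t) * w1 t)
     - (exp (\<nu> * t) * d\<phi> t) * (exp (\<nu> * t) * w t))) \<longlongrightarrow> 0 * (1 * (- (\<nu> * \<gamma>)) - (- \<nu>) * \<gamma>)) at_top"
    by (intro tendsto_intros e decay w_lim w1_lim)
  moreover have "exp (- (2 * \<nu> * t)) * ((exp (\<nu> * t) * \<phi> t) * (exp (\<nu> * t) * w1 t)
     - (exp (\<nu> * t) * d\<phi> t) * (exp (\<nu> * t) * w t)) = N1 t" for t
  proof -
    have *: "e0 * ((e1 * p) * (e1 * r) - (e1 * s) * (e1 * u)) = (e0 * (e1 * e1)) * (p * r - s * u)" for e0 e1 p r s u :: real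
      by (simp add: algebra_simps)
    have **: "exp (- (2 * \<nu> * t)) * (exp (\<nu> * t) * exp (\<nu> * t)) = 1" by (simp add: exp_add[symmetric])
    show ?thesis unfolding * ** N1_def by simp
  qed
  ultimately show "(N1 \<longlongrightarrow> 0) at_top" by simp
  have "((\<lambda>t. (exp (- (\<nu> * t)) * lin \<nu> lam c t) * (exp (\<nu> * t) * w1 t)
     - (exp (- (\<nu> * t)) * dlin \<nu> lam c t) * (exp (\<nu> * t) * w t)) \<longlongrightarrow> 1 * (- (\<nu> * \<gamma>)) - \<nu> * \<gamma>) at_top"
    by (intro tendsto_intros decay w_lim w1_lim)
  moreover have "(exp (- (\<nu> * t)) * lin \<nu> lam c t) * (exp (\<nu> * t) * w1 t)
     - (exp (- (\<nu> * t)) * dlin \<nu> lam c t) * (exp (\<nu> * t) * w t) = N2 c t" for t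
  proof -
    have *: "(e0 * p) * (e1 * r) - (e0 * s) * (e1 * u) = (e0 * e1) * (p * r - s * u)" for e0 e1 p r s u :: real
      by (simp add: algebra_simps)
    have **: "exp (- (\<nu> * t)) * exp (\<nu> * t) = 1" by (simp add: exp_add[symmetric])
    show ?thesis unfolding * ** N2_def by simp
  qed
  ultimately show "(N2 c \<longlongrightarrow> - (2 * \<nu> * \<gamma>)) at_top" by (simp add: ac_simps)
qed

lemma P_lim: "(P c \<longlongrightarrow> 0) at_top"
proof -
  have "((\<lambda>t. N1 t * N2 c t / 2 + \<phi> t * lin \<nu> lam c t * (w t powr (q + 1) / (q + 1)))
    \<longlongrightarrow> 0 * (- (2 * \<nu> * \<gamma>)) / 2 + 1 * (0 / (q + 1))) at_top"
    using q by (intro tendsto_intros N_lims mult_limit w_lims) auto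
  then show ?thesis unfolding P_def by simp
qed

lemma N1_antimono:
  assumes "a < s" "s \<le> t" "\<And>r. s \<le> r \<Longrightarrow> r \<le> t \<Longrightarrow> \<phi> r \<ge> 0"
  shows "N1 t \<le> N1 s"
proof (rule DERIV_nonpos_imp_nonincreasing[OF assms(2)])
  fix x assume "s \<le> x" "x \<le> t"
  then show "\<exists>y. (N1 has_real_derivative y) (at x) \<and> y \<le> 0"
    using DN1[of x] assms by (intro exI[of _ "- (w x powr q * \<phi> x)"]) auto
qed

lemma N1_pos:
  assumes "t > a" "\<And>s. s \<ge> t \<Longrightarrow> \<phi> s > 0"
  shows "N1 t > 0"
proof (rule antimono_gt_limit[OF _ _ N_lims(1)])
  show "(N1 has_real_derivative - (w s powr q * \<phi> s)) (at s)" if "s \<ge> t" for s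
    using DN1 assms that by simp
  show "- (w s powr q * \<phi> s) < 0" if "s \<ge> t" for s
    using w_pos[of s] assms that by simp
qed

definition energy :: "real \<Rightarrow> real" where
  "energy t = (w1 t)\<^sup>2 / 2 - Q t * (w t)\<^sup>2 / 2 + w t powr (q + 1) / (q + 1)"

lemma D_energy:
  assumes t: "t > a"
  shows "(energy has_real_derivative - (lam * exp (- (2 * t)) * (w t)\<^sup>2)) (at t)"
proof -
  have "((\<lambda>t. (w1 t)\<^sup>2 / 2) has_real_derivative (Q t * w t - w t powr q) * w1 t) (at t)"
    using DERIV_power[OF Dw1_q[OF t], of 2] by (auto dest: DERIV_cdivide[where c = 2])
  moreover have "((\<lambda>t. Q t * (w t)\<^sup>2 / 2) has_real_derivative lam * exp (- (2 * t)) * (w t)\<^sup>2 + Q t * w t * w1 t) (at t)"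
    by (auto intro!: derivative_eq_intros Dw t simp: field_simps power2_eq_square)
  ultimately have "(energy has_real_derivative (Q t * w t - w t powr q) * w1 t
     - (lam * exp (- (2 * t)) * (w t)\<^sup>2 + Q t * w t * w1 t) + w t powr q * w1 t) (at t)"
    unfolding energy_def by (intro DERIV_add DERIV_diff Dwpow t)
  then show ?thesis by (simp add: algebra_simps)
qed

lemma w1_to_0: "(w1 \<longlongrightarrow> 0) at_top"
proof -
  have e: "((\<lambda>t. exp (- (\<nu> * t))) \<longlongrightarrow> 0) at_top" using nu by real_asymp
  have "exp (- (\<nu> * t)) * (exp (\<nu> * t) * w1 t) = w1 t" for t
    by (simp add: mult.assoc[symmetric] exp_add[symmetric])
  then show ?thesis using tendsto_mult[OF e w1_lim] by (simp only: mult_zero_left)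
qed

lemma energy_lim: "(energy \<longlongrightarrow> 0) at_top"
proof -
  have Qlim: "((\<lambda>t. Q t) \<longlongrightarrow> \<nu>\<^sup>2) at_top" by real_asymp
  have "((\<lambda>t. (w1 t)\<^sup>2 / 2 - Q t * (w t)\<^sup>2 / 2 + w t powr (q + 1) / (q + 1))
      \<longlongrightarrow> 0\<^sup>2 / 2 - \<nu>\<^sup>2 * 0\<^sup>2 / 2 + 0 / (q + 1)) at_top"
    using q by (intro tendsto_intros w1_to_0 w_lims Qlim) auto
  then show ?thesis unfolding energy_def by simp
qed

end

text \<open>The Dirichlet condition on the unit sphere \<open>t = 0\<close>. The bound for \<open>w'\<close> is what lets the boundary terms
  of \<open>P\<close> vanish.\<close>

locale emden_fowler_dirichlet = emden_fowler \<nu> lam \<gamma> 0 w w1 for \<nu> lam \<gamma> w w1 +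
  assumes w_0: "(w \<longlongrightarrow> 0) (at_right 0)"
    and w1_bounded: "\<exists>B b. b > 0 \<and> (\<forall>t. 0 < t \<and> t < b \<longrightarrow> \<bar>w1 t\<bar> \<le> B)"
begin

lemma w1_ev_bounded: "\<exists>B. eventually (\<lambda>t. \<bar>w1 t\<bar> \<le> B) (at_right 0)"
  using w1_bounded by (auto simp: eventually_at_right_field)

lemma ww1_0: "((\<lambda>t. w t * w1 t) \<longlongrightarrow> 0) (at_right 0)"
  using w1_ev_bounded tendsto_null_mult_bounded[OF w_0] by blast

lemma wpow_0: "((\<lambda>t. w t powr (q + 1)) \<longlongrightarrow> 0) (at_right 0)"
proof -
  have "eventually (\<lambda>t. 0 \<le> w t) (at_right 0)"
    using eventually_at_right_less[of 0] by (rule eventually_mono) (use w_pos in \<open>auto intro: less_imp_le\<close>)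
  from tendsto_zero_powrI[OF w_0 tendsto_const this, of "q + 1"] q show ?thesis by simp
qed

lemma N2_0:
  assumes "lin \<nu> lam c 0 = 0"
  shows "(N2 c \<longlongrightarrow> 0) (at_right 0)"
proof -
  have "((\<lambda>t. lin \<nu> lam c t * w1 t) \<longlongrightarrow> 0) (at_right 0)"
    using w1_ev_bounded tendsto_null_mult_bounded[of "lin \<nu> lam c"] conts_at_right(3)[of c 0] assms by auto
  from tendsto_diff[OF this tendsto_mult[OF conts_at_right(4)[of c 0] w_0]]
  show ?thesis unfolding N2_def by simp
qed

lemma P_0:
  assumes "lin \<nu> lam c 0 = 0"
  shows "(P c \<longlongrightarrow> 0) (at_right 0)"
proof -
  have "((\<lambda>t. N2 c t * w1 t) \<longlongrightarrow> 0) (at_right 0)"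
    using w1_ev_bounded tendsto_null_mult_bounded[OF N2_0[OF assms]] by blast
  then have "((\<lambda>t. (\<phi> t * (N2 c t * w1 t) - d\<phi> t * w t * N2 c t) / 2
     + \<phi> t * lin \<nu> lam c t * (w t powr (q + 1) / (q + 1)))
     \<longlongrightarrow> (\<phi> 0 * 0 - d\<phi> 0 * 0 * 0) / 2 + \<phi> 0 * lin \<nu> lam c 0 * (0 / (q + 1))) (at_right 0)"
    using q by (intro tendsto_intros conts_at_right w_0 N2_0 assms wpow_0) auto
  then show ?thesis unfolding P_def N1_def by (simp add: algebra_simps)
qed

text \<open>\<open>N1\<close> is positive and nonincreasing where \<open>\<phi>\<close> is positive, so it stays positive up to the zero \<open>t1\<close>
  of \<open>\<phi>\<close>. There it reduces to \<open>- \<phi>' w\<close> with \<open>\<phi>' t1 \<ge> 0\<close>, or tends to \<open>0\<close> if \<open>t1 = 0\<close>.\<close>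

lemma no_zero_of_phi:
  assumes t1: "t1 \<ge> 0" "\<phi> t1 = 0" "\<And>t. t > t1 \<Longrightarrow> \<phi> t > 0"
  shows False
proof -
  have p: "N1 (t1 + 1) > 0" using t1 by (intro N1_pos) auto
  have ge: "N1 (t1 + 1) \<le> N1 t" if "t > 0" "t \<ge> t1" "t \<le> t1 + 1" for t
  proof (rule N1_antimono)
    show "\<phi> r \<ge> 0" if "t \<le> r" for r
      using t1(2) t1(3)[of r] \<open>t \<ge> t1\<close> that by (cases "r = t1") auto
  qed (use that in auto)
  show False
  proof (cases "t1 = 0")
    case True
    have "((\<lambda>t. \<phi> t * w1 t) \<longlongrightarrow> 0) (at_right 0)"
      using w1_ev_bounded tendsto_null_mult_bounded[of \<phi>] conts_at_right(1)[of 0] t1 True by auto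
    from tendsto_diff[OF this tendsto_mult[OF conts_at_right(2)[of 0] w_0]]
    have "(N1 \<longlongrightarrow> 0) (at_right 0)" unfolding N1_def by simp
    moreover have "eventually (\<lambda>t. N1 (t1 + 1) \<le> N1 t) (at_right 0)"
      using ge True by (auto simp: eventually_at_right_field intro!: exI[of _ 1])
    ultimately have "N1 (t1 + 1) \<le> 0" by (rule tendsto_lowerbound) simp
    then show False using p by simp
  next
    case False
    then have "t1 > 0" using t1 by simp
    have "d\<phi> t1 \<ge> 0"
    proof (rule ccontr)
      assume "\<not> d\<phi> t1 \<ge> 0"
      then obtain d where "d > 0" "\<And>h. 0 < h \<Longrightarrow> h < d \<Longrightarrow> \<phi> (t1 + h) < \<phi> t1"
        using DERIV_neg_dec_right[OF D\<phi>, of t1] by auto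
      from this(2)[of "d / 2"] this(1) show False using t1 by (smt (verit) field_sum_of_halves)
    qed
    then have "N1 t1 \<le> 0"
      using t1 w_pos[OF \<open>t1 > 0\<close>] by (simp add: N1_def)
    then show False using ge[of t1] p \<open>t1 > 0\<close> by simp
  qed
qed

text \<open>For \<open>lam \<le> 0\<close> the energy, which belongs to a constant multiplier, increases to \<open>0\<close> and hence is nonpositive.
  At \<open>t = 0\<close> this forces \<open>w'\<close>, and with it \<open>N1\<close>, to tend to \<open>0\<close>; but \<open>N1\<close> is positive and nonincreasing.\<close>

lemma lam_pos: "lam > 0"
proof (rule ccontr)
  assume "\<not> lam > 0"
  then have lam: "lam \<le> 0" by simp
  have phi: "\<phi> t > 0" for t
    unfolding phi_sign using nu lam by (intro bes_pos_nonpos_arg mult_nonpos_nonneg) auto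
  note DE = D_energy and Elim = energy_lim
  have E: "energy t \<le> 0" if "t > 0" for t
  proof (rule mono_le_limit[OF _ _ Elim])
    show "(energy has_real_derivative - (lam * exp (- (2 * s)) * (w s)\<^sup>2)) (at s)" if "s \<ge> t" for s
      using DE that \<open>t > 0\<close> by simp
    show "0 \<le> - (lam * exp (- (2 * s)) * (w s)\<^sup>2)" for s
      using lam by (simp add: mult_nonpos_nonneg)
  qed
  define R where "R = (\<lambda>t. Q t * (w t)\<^sup>2 / 2 - w t powr (q + 1) / (q + 1))"
  have Qr: "((\<lambda>t. Q t) \<longlongrightarrow> \<nu>\<^sup>2 - lam * exp (- (2 * 0))) (at_right 0)"
    by (intro tendsto_intros)
  have "((\<lambda>t. Q t * (w t)\<^sup>2 / 2 - w t powr (q + 1) / (q + 1)) \<longlongrightarrow> (\<nu>\<^sup>2 - lam * exp (- (2 * 0))) * 0\<^sup>2 / 2 - 0 / (q + 1)) (at_right 0)"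
    using q by (intro tendsto_intros w_0 wpow_0 Qr) auto
  then have R0: "((\<lambda>t. 2 * R t) \<longlongrightarrow> 0) (at_right 0)"
    unfolding R_def by (intro tendsto_mult_right_zero) simp_all
  have le: "(w1 t)\<^sup>2 \<le> 2 * R t" if "t > 0" for t
    using E[OF that] by (simp add: energy_def R_def)
  have "((\<lambda>t. (w1 t)\<^sup>2) \<longlongrightarrow> 0) (at_right 0)"
    by (rule tendsto_sandwich[OF _ _ tendsto_const R0]) (use le eventually_at_right_less[of "0::real"] in \<open>auto elim: eventually_mono\<close>)
  then have "((\<lambda>t. sqrt ((w1 t)\<^sup>2)) \<longlongrightarrow> sqrt 0) (at_right 0)" by (rule tendsto_real_sqrt)
  then have w10: "(w1 \<longlongrightarrow> 0) (at_right 0)" by (simp add: tendsto_rabs_zero_iff)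
  have "((\<lambda>t. \<phi> t * w1 t - d\<phi> t * w t) \<longlongrightarrow> \<phi> 0 * 0 - d\<phi> 0 * 0) (at_right 0)"
    by (intro tendsto_intros w_0 w10 conts_at_right)
  then have "(N1 \<longlongrightarrow> 0) (at_right 0)" unfolding N1_def by simp
  moreover have "eventually (\<lambda>t. N1 1 \<le> N1 t) (at_right 0)"
    using N1_antimono phi by (auto simp: eventually_at_right_field less_imp_le intro!: exI[of _ 1])
  ultimately have "N1 1 \<le> 0" by (rule tendsto_lowerbound) simp
  moreover have "N1 1 > 0" using phi by (intro N1_pos) auto
  ultimately show False by simp
qed

text \<open>The product of the two positive linear solutions increases for large \<open>t\<close>, hence for all \<open>t > 0\<close>. So \<open>P\<close>
  increases to \<open>0\<close> and is negative; near \<open>t = 0\<close> it is bounded below by terms that tend to \<open>0\<close>.\<close>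

lemma not_both_positive:
  assumes pos: "\<And>t. t > 0 \<Longrightarrow> \<phi> t > 0" "\<And>t. t > 0 \<Longrightarrow> phi (- \<nu>) lam t > 0"
  shows False
proof -
  have lin0: "lin \<nu> lam 0 = phi (- \<nu>) lam" "dlin \<nu> lam 0 = dphi (- \<nu>) lam"
    by (auto simp: lin_def dlin_def)
  define x where "x = (\<lambda>t::real. lam * exp (- (2 * t)))"
  define h where "h = (\<lambda>y. bes1 \<nu> y * bes (- \<nu>) y + bes \<nu> y * bes1 (- \<nu>) y)"
  have eq: "dmult \<nu> lam 0 t = 2 * x t * - h (x t)" for t
    by (simp add: dmult_0 x_def h_def)
  have ev: "eventually (\<lambda>t. dmult \<nu> lam 0 t > 0) at_top"
  proof -
    have xlim: "(x \<longlongrightarrow> 0) at_top" unfolding x_def by real_asymp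
    have "isCont h 0" unfolding h_def using nu by (intro continuous_intros bes_cont) auto
    from isCont_tendsto_compose[OF this xlim]
    have "((\<lambda>t. - h (x t)) \<longlongrightarrow> - h 0) at_top" by (rule tendsto_minus)
    moreover have "- h 0 > 0"
    proof -
      have "bes1 \<nu> 0 < 0" "bes1 (- \<nu>) 0 < 0"
        using nu by (simp_all add: bes1_0 divide_neg_pos)
      then show ?thesis by (simp add: h_def bes_0)
    qed
    ultimately have "eventually (\<lambda>t. 0 < - h (x t)) at_top" by (rule order_tendstoD)
    then show ?thesis
    proof (rule eventually_mono)
      fix t assume "0 < - h (x t)"
      moreover have "x t > 0" using lam_pos by (simp add: x_def)
      ultimately show "dmult \<nu> lam 0 t > 0" unfolding eq by (intro mult_pos_pos) auto
    qed
  qed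
  have dm: "dmult \<nu> lam 0 t > 0" if t: "t > 0" for t
  proof (rule ccontr)
    assume "\<not> dmult \<nu> lam 0 t > 0"
    then have "dmult \<nu> lam 0 s \<le> 0" if "s > t" for s
      using dmult_nonpos_after[OF lam_pos _ t that] pos lin0 by auto
    then have "eventually (\<lambda>s. dmult \<nu> lam 0 s \<le> 0) at_top"
      using eventually_gt_at_top[of t] by (rule eventually_mono[rotated]) auto
    with ev have "eventually (\<lambda>s::real. False) at_top" by eventually_elim simp
    then show False by simp
  qed
  have DPpos: "(1 / 2 + 1 / (q + 1)) * dmult \<nu> lam 0 t * w t powr (q + 1) > 0" if "t > 0" for t
    using dm[OF that] w_pos[OF that] q by (intro mult_pos_pos add_pos_pos) auto
  have "- 0 < - P 0 1"
    by (rule antimono_gt_limit[OF DERIV_minus[OF DP] _ tendsto_minus[OF P_lim]]) (use DPpos in auto)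
  then have P1: "P 0 1 < 0" by simp
  define R where "R = (\<lambda>t. (d\<phi> t * dlin \<nu> lam 0 t * w t * w t - dmult \<nu> lam 0 t * (w t * w1 t)) / 2
     + \<phi> t * lin \<nu> lam 0 t * (w t powr (q + 1) / (q + 1)))"
  have PR: "P 0 t = \<phi> t * lin \<nu> lam 0 t * (w1 t)\<^sup>2 / 2 + R t" for t
    by (simp add: P_def R_def N1_def N2_def dmult_def field_simps power2_eq_square)
  have dml: "(dmult \<nu> lam 0 \<longlongrightarrow> dmult \<nu> lam 0 0) (at_right 0)"
    using dmult_cont[of 0 0] by (simp add: isCont_def filterlim_at_split)
  have "(R \<longlongrightarrow> (d\<phi> 0 * dlin \<nu> lam 0 0 * 0 * 0 - dmult \<nu> lam 0 0 * 0) / 2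
     + \<phi> 0 * lin \<nu> lam 0 0 * (0 / (q + 1))) (at_right 0)"
    unfolding R_def using q by (intro tendsto_intros conts_at_right w_0 ww1_0 wpow_0 dml) auto
  then have R0: "(R \<longlongrightarrow> 0) (at_right 0)" by simp
  have "R t \<le> P 0 1" if t: "0 < t" "t < 1" for t
  proof -
    have "P 0 t \<le> P 0 1"
    proof (rule DERIV_nonneg_imp_nondecreasing[of _ _ "P 0"])
      fix s assume "t \<le> s" "s \<le> 1"
      then show "\<exists>y. (P 0 has_real_derivative y) (at s) \<and> 0 \<le> y"
        using DP[of s 0] DPpos[of s] t by (meson less_imp_le less_le_trans)
    qed (use t in simp)
    moreover have "\<phi> t * lin \<nu> lam 0 t * (w1 t)\<^sup>2 / 2 \<ge> 0"
      using pos[OF t(1)] by (simp add: lin0)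
    ultimately show ?thesis using PR[of t] by linarith
  qed
  then have "eventually (\<lambda>t. R t \<le> P 0 1) (at_right 0)"
    by (auto simp: eventually_at_right_field intro!: exI[of _ 1])
  with R0 have "0 \<le> P 0 1" by (rule tendsto_upperbound) simp
  with P1 show False by simp
qed

end

section \<open>Range of the parameter\<close>

context bessel_pair
begin

abbreviation "z_plus \<equiv> (bessel_zero \<nu> 1)\<^sup>2"
abbreviation "z_minus \<equiv> (bessel_zero (- \<nu>) 1)\<^sup>2"

lemmas z_plus = bessel_zero_1_sq[of \<nu>]
lemmas z_minus = bessel_zero_1_sq[of "- \<nu>"]

lemma phi_pos:
  assumes "lam > 0" "lam < z_plus" "t \<ge> 0"
  shows "\<phi> t > 0"
proof -
  have "lam * exp (- (2 * t)) \<le> lam * 1" using assms by (intro mult_left_mono) auto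
  then have "lam * exp (- (2 * t)) < z_plus" using assms by linarith
  then show ?thesis
    unfolding phi_sign using assms nu by (intro z_plus(3)) auto
qed

text \<open>The quotient \<open>phi (-\<nu>) / phi \<nu>\<close> is increasing by the Wronskian, so its first zero \<open>s\<close>, counted
  from infinity, is followed by negative values.\<close>

lemma phi_minus_neg:
  assumes lam: "lam > 0" "lam < z_plus" and t: "t \<ge> 0" "lam * exp (- (2 * t)) > z_minus"
  shows "phi (- \<nu>) lam t < 0"
proof -
  have zm: "z_minus > 0" "bes (- \<nu>) z_minus = 0" using z_minus nu by auto
  define s where "s = ln (lam / z_minus) / 2"
  have s_eq: "lam * exp (- (2 * s)) = z_minus"
    using zm lam by (simp add: s_def exp_minus)
  then have "exp (- (2 * s)) < exp (- (2 * t))" using t lam by (metis mult_less_cancel_left_pos)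
  then have st: "t < s" by simp
  define r where "r = (\<lambda>t. phi (- \<nu>) lam t / \<phi> t)"
  have "r t < r s"
  proof (rule DERIV_pos_imp_increasing[OF st])
    fix x assume x: "t \<le> x" "x \<le> s"
    then have p: "\<phi> x > 0" using phi_pos[OF lam] t by simp
    have "(r has_real_derivative (dphi (- \<nu>) lam x * \<phi> x - phi (- \<nu>) lam x * d\<phi> x) / (\<phi> x * \<phi> x)) (at x)"
      unfolding r_def using p nu by (intro DERIV_divide DERIV_phi) auto
    moreover have "dphi (- \<nu>) lam x * \<phi> x - phi (- \<nu>) lam x * d\<phi> x = 2 * \<nu>"
      using phi_wronskian[of \<nu> lam x] nu by (simp add: algebra_simps)
    ultimately show "\<exists>y. (r has_real_derivative y) (at x) \<and> 0 < y"
      using p nu by (intro exI[of _ "2 * \<nu> / (\<phi> x * \<phi> x)"]) auto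
  qed
  moreover have "phi (- \<nu>) lam s = 0" by (simp only: phi_def s_eq zm mult_zero_right)
  ultimately have "phi (- \<nu>) lam t / \<phi> t < 0" by (simp add: r_def)
  then show ?thesis using phi_pos[OF lam t(1)] by (simp add: divide_less_0_iff)
qed

end

text \<open>With the square \<open>z\<close> of the first zero of \<open>J\<^sub>\<plusminus>\<^sub>\<nu>\<close>, the function \<open>J\<^sub>\<plusminus>\<^sub>\<nu>(sqrt lam r)\<close> has its first zero at
  \<open>t = ln (lam / z) / 2\<close>; the sign of this number decides on which side of the unit sphere it lies.\<close>

lemma (in emden_fowler_dirichlet) lam_range: "z_minus < lam" "lam < z_plus"
proof -
  show up: "lam < z_plus"
  proof (rule ccontr)
    assume "\<not> lam < z_plus"
    then have ge: "lam \<ge> z_plus" by simp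
    have zp: "z_plus > 0" "bes \<nu> z_plus = 0" using z_plus nu by auto
    define t1 where "t1 = ln (lam / z_plus) / 2"
    have t1: "lam * exp (- (2 * t1)) = z_plus"
      using zp lam_pos by (simp add: t1_def exp_minus)
    show False
    proof (rule no_zero_of_phi)
      show "t1 \<ge> 0" using ge zp by (simp add: t1_def)
      show "\<phi> t1 = 0" by (simp only: phi_def t1 zp mult_zero_right)
      fix t assume "t > t1"
      then have "lam * exp (- (2 * t)) < lam * exp (- (2 * t1))"
        using lam_pos by (intro mult_strict_left_mono) auto
      then show "\<phi> t > 0"
        unfolding phi_sign t1 using lam_pos nu by (intro z_plus(3)) auto
    qed
  qed
  show "z_minus < lam"
  proof (rule ccontr)
    assume "\<not> z_minus < lam"
    then have le: "lam \<le> z_minus" by simp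
    have "phi (- \<nu>) lam t > 0" if "t > 0" for t
    proof -
      have "lam * exp (- (2 * t)) < lam * 1" using that lam_pos by (intro mult_strict_left_mono) auto
      then have "lam * exp (- (2 * t)) < z_minus" using le by linarith
      then show ?thesis
        unfolding phi_sign using lam_pos nu by (intro z_minus(3)) auto
    qed
    then show False
      using not_both_positive phi_pos[OF lam_pos up] by auto
  qed
qed

section \<open>Uniqueness\<close>

text \<open>The multiplier is built from the linear solution that vanishes at \<open>t = 0\<close>, so that \<open>P\<close> vanishes at
  both ends and, since the multiplier increases before it decreases, is nonnegative. The
  quotient \<open>\<rho> = v / w\<close> has the limit \<open>\<gamma>' / \<gamma> > 1\<close> at infinity. Let \<open>(\<tau>, \<infinity>)\<close> be the largest interval on which
  it increases. There \<open>\<rho>\<^sup>q\<^sup>+\<^sup>1 P\<^sub>w - P\<^sub>v\<close> is nondecreasing with limit \<open>0\<close> at infinity. For \<open>\<tau> = 0\<close> its limit at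
  \<open>0\<close> is \<open>0\<close> too, although it is not constant. For \<open>\<tau> > 0\<close> one has \<open>\<rho> \<tau> < 1\<close>, and the value at \<open>\<tau>\<close> is
  \<open>(\<rho>\<^sup>q\<^sup>+\<^sup>1 - \<rho>\<^sup>2) N1 N2 / 2\<close> with the Wronskians of \<open>w\<close>. It is positive because \<open>N1 > 0 > N2\<close>. Both cases
  are absurd.\<close>

lemma central_value_unique:
  assumes W: "emden_fowler_dirichlet \<nu> lam \<gamma> w w1"
    and V: "emden_fowler_dirichlet \<nu> lam \<gamma>' v v1"
    and less: "\<gamma> < \<gamma>'"
  shows False
proof -
  interpret W: emden_fowler_dirichlet \<nu> lam \<gamma> w w1 by (rule W)
  interpret V: emden_fowler_dirichlet \<nu> lam \<gamma>' v v1 by (rule V)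
  let ?q = "W.q" and ?\<phi> = "phi \<nu> lam"
  have lam: "lam > 0" by (rule W.lam_pos)
  have phi: "?\<phi> t > 0" if "t \<ge> 0" for t using W.phi_pos[OF lam W.lam_range(2) that] .
  define c where "c = - phi (- \<nu>) lam 0 / ?\<phi> 0"
  have l0: "lin \<nu> lam c 0 = 0" using phi[of 0] by (simp add: lin_def c_def)
  let ?l = "lin \<nu> lam c" and ?A' = "dmult \<nu> lam c"
  have l_pos: "?l t > 0" if t: "t > 0" for t
  proof -
    define r where "r = (\<lambda>t. ?l t / ?\<phi> t)"
    have "r 0 < r t"
    proof (rule DERIV_pos_imp_increasing[OF t])
      fix x assume x: "0 \<le> x" "x \<le> t"
      then have p: "?\<phi> x > 0" using phi by simp
      have "(r has_real_derivative (dlin \<nu> lam c x * ?\<phi> x - ?l x * dphi \<nu> lam x) / (?\<phi> x * ?\<phi> x)) (at x)"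
        unfolding r_def using p by (intro DERIV_divide W.Dlin W.D\<phi>) auto
      moreover have "dlin \<nu> lam c x * ?\<phi> x - ?l x * dphi \<nu> lam x = 2 * \<nu>"
        using W.wronskian[of x c] by (simp add: algebra_simps)
      ultimately show "\<exists>y. (r has_real_derivative y) (at x) \<and> 0 < y"
        using p W.nu by (intro exI[of _ "2 * \<nu> / (?\<phi> x * ?\<phi> x)"]) auto
    qed
    then show ?thesis using phi[of t] t by (simp add: r_def l0 zero_less_divide_iff)
  qed
  have mpos: "?\<phi> t * ?l t > 0" if "t > 0" for t using phi l_pos that by simp
  have A'0: "?A' 0 > 0"
    using W.wronskian[of 0 c] W.nu by (simp add: dmult_def l0)
  define \<kappa> where "\<kappa> = 1 / 2 + 1 / (?q + 1)"
  have \<kappa>: "\<kappa> > 0" using W.q by (simp add: \<kappa>_def add_pos_pos)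
  have DP: "(W.P c has_real_derivative \<kappa> * ?A' t * w t powr (?q + 1)) (at t)"
    "(V.P c has_real_derivative \<kappa> * ?A' t * v t powr (?q + 1)) (at t)" if "t > 0" for t
    using W.DP[OF that] V.DP[OF that] by (auto simp: \<kappa>_def)
  \<comment> \<open>the multiplier increases on an initial interval\<close>
  obtain \<epsilon> where \<epsilon>: "\<epsilon> > 0" "\<And>t. 0 < t \<Longrightarrow> t \<le> \<epsilon> \<Longrightarrow> ?A' t > 0"
  proof -
    have "(?A' \<longlongrightarrow> ?A' 0) (at_right 0)"
      using W.dmult_cont[of 0 c] by (simp add: isCont_def filterlim_at_split)
    then have "eventually (\<lambda>t. 0 < ?A' t) (at_right 0)" using A'0 by (rule order_tendstoD)
    then obtain b where "b > 0" "\<And>t. 0 < t \<Longrightarrow> t < b \<Longrightarrow> 0 < ?A' t"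
      by (auto simp: eventually_at_right_field)
    then show ?thesis by (intro that[of "b / 2"]) auto
  qed
  have P_pos_if_incr: "W.P c t > 0" if t: "t > 0" "\<And>s. 0 < s \<Longrightarrow> s \<le> t \<Longrightarrow> ?A' s > 0" for t
  proof (rule mono_gt_limit_at_right[OF DP(1) _ W.P_0[OF l0] t(1)])
    show "0 < \<kappa> * ?A' s * w s powr (?q + 1)" if "0 < s" "s \<le> t" for s
      using t(2)[OF that] \<kappa> W.w_pos[OF that(1)] by simp
  qed
  \<comment> \<open>\<open>P\<close> rises from \<open>0\<close> before it falls to \<open>0\<close>\<close>
  have P_nonneg: "W.P c t \<ge> 0" if t: "t > 0" for t
  proof (cases "?A' t \<le> 0")
    case True
    have "?A' s \<le> 0" if "s \<ge> t" for s
      using W.dmult_nonpos_after[OF lam mpos t _ True, of s] that True by (cases "s = t") auto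
    then have "\<kappa> * ?A' s * w s powr (?q + 1) \<le> 0" if "s \<ge> t" for s
      using that \<kappa> by (simp add: mult_nonneg_nonpos mult_nonpos_nonneg)
    then show ?thesis
      using t by (intro antimono_ge_limit[OF DP(1) _ W.P_lim]) auto
  next
    case False
    have "?A' s > 0" if s: "0 < s" "s \<le> t" for s
    proof (rule ccontr)
      assume "\<not> ?A' s > 0"
      then have "?A' t \<le> 0"
        using W.dmult_nonpos_after[OF lam mpos s(1), of t] s False by (cases "s = t") auto
      then show False using False by simp
    qed
    then show ?thesis using P_pos_if_incr[OF t] by (simp add: less_imp_le)
  qed
  define \<rho> where "\<rho> = (\<lambda>t. v t / w t)"
  define R where "R = (\<lambda>t. w t * v1 t - w1 t * v t)"
  have DR: "(R has_real_derivative w t powr ?q * v t - w t * v t powr ?q) (at t)" if t: "t > 0" for t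
    unfolding R_def
    by (rule derivative_eq_intros W.Dw W.Dw1_q V.Dw V.Dw1_q t refl)+ (simp add: algebra_simps)
  have D\<rho>: "(\<rho> has_real_derivative R t / (w t)\<^sup>2) (at t)" if t: "t > 0" for t
  proof -
    have "(\<rho> has_real_derivative (v1 t * w t - v t * w1 t) / (w t * w t)) (at t)"
      unfolding \<rho>_def using W.w_pos[OF t] by (intro DERIV_divide V.Dw W.Dw t) auto
    then show ?thesis by (simp add: R_def power2_eq_square algebra_simps)
  qed
  have \<rho>_pos: "\<rho> t > 0" if "t > 0" for t using W.w_pos[OF that] V.w_pos[OF that] by (simp add: \<rho>_def)
  have \<rho>_lim: "(\<rho> \<longlongrightarrow> \<gamma>' / \<gamma>) at_top"
  proof -
    have "((\<lambda>t. (exp (\<nu> * t) * v t) / (exp (\<nu> * t) * w t)) \<longlongrightarrow> \<gamma>' / \<gamma>) at_top"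
      using W.\<gamma> by (intro tendsto_divide W.w_lim V.w_lim) auto
    then show ?thesis by (simp add: \<rho>_def)
  qed
  have R_lim: "(R \<longlongrightarrow> 0) at_top"
  proof -
    have e: "((\<lambda>t. exp (- (2 * \<nu> * t))) \<longlongrightarrow> 0) at_top" using W.nu by real_asymp
    have "((\<lambda>t. exp (- (2 * \<nu> * t)) * ((exp (\<nu> * t) * w t) * (exp (\<nu> * t) * v1 t)
       - (exp (\<nu> * t) * w1 t) * (exp (\<nu> * t) * v t))) \<longlongrightarrow> 0 * (\<gamma> * (- (\<nu> * \<gamma>')) - (- (\<nu> * \<gamma>)) * \<gamma>')) at_top"
      by (intro tendsto_intros e W.w_lim W.w1_lim V.w_lim V.w1_lim)
    moreover have "exp (- (2 * \<nu> * t)) * ((exp (\<nu> * t) * w t) * (exp (\<nu> * t) * v1 t)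
       - (exp (\<nu> * t) * w1 t) * (exp (\<nu> * t) * v t)) = R t" for t
    proof -
      have *: "e0 * ((e1 * p) * (e1 * r) - (e1 * s) * (e1 * u)) = (e0 * (e1 * e1)) * (p * r - s * u)" for e0 e1 p r s u :: real
        by (simp add: algebra_simps)
      have **: "exp (- (2 * \<nu> * t)) * (exp (\<nu> * t) * exp (\<nu> * t)) = 1" by (simp add: exp_add[symmetric])
      show ?thesis unfolding * ** R_def by simp
    qed
    ultimately show ?thesis by simp
  qed
  \<comment> \<open>\<open>R\<close> falls where \<open>v > w\<close> and rises where \<open>v < w\<close>\<close>
  have DR_sign: "w t powr ?q * v t - w t * v t powr ?q < 0 \<longleftrightarrow> \<rho> t > 1"
    "w t powr ?q * v t - w t * v t powr ?q \<le> 0 \<longleftrightarrow> \<rho> t \<ge> 1" if t: "t > 0" for t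
  proof -
    have p: "w t > 0" "v t > 0" using W.w_pos V.w_pos t by auto
    have e: "x powr ?q = x powr (?q - 1) * x" if "x > 0" for x
      using powr_add[of x "?q - 1" 1] that by simp
    have eq: "w t powr ?q * v t - w t * v t powr ?q = w t * v t * (w t powr (?q - 1) - v t powr (?q - 1))"
      using e[OF p(1)] e[OF p(2)] by (simp add: algebra_simps)
    have wv: "w t * v t > 0" using p by simp
    have "w t powr (?q - 1) < v t powr (?q - 1) \<longleftrightarrow> w t < v t"
      "w t powr (?q - 1) \<le> v t powr (?q - 1) \<longleftrightarrow> w t \<le> v t"
      using p W.q powr_less_mono2[of "?q - 1"] powr_mono2[of "?q - 1"]
      by (smt (verit))+
    then show "w t powr ?q * v t - w t * v t powr ?q < 0 \<longleftrightarrow> \<rho> t > 1"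
      "w t powr ?q * v t - w t * v t powr ?q \<le> 0 \<longleftrightarrow> \<rho> t \<ge> 1"
      unfolding eq using wv p by (auto simp: mult_less_0_iff mult_le_0_iff \<rho>_def)
  qed
  obtain T where T: "T > 0" "\<And>t. t \<ge> T \<Longrightarrow> R t > 0"
  proof -
    have "1 < \<gamma>' / \<gamma>" using less W.\<gamma> by simp
    with \<rho>_lim have "eventually (\<lambda>t. 1 < \<rho> t) at_top" by (rule order_tendstoD)
    then obtain T where T: "\<And>t. t \<ge> T \<Longrightarrow> 1 < \<rho> t" by (auto simp: eventually_at_top_linorder)
    have "R t > 0" if t: "t \<ge> max T 1" for t
    proof (rule antimono_gt_limit[OF DR _ R_lim])
      show "s > 0" if "s \<ge> t" for s using that t by simp
      show "w s powr ?q * v s - w s * v s powr ?q < 0" if "s \<ge> t" for s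
        using DR_sign(1)[of s] T[of s] that t by simp
    qed
    then show ?thesis by (intro that[of "max T 1"]) auto
  qed
  \<comment> \<open>the factor is such that the two derivatives of \<open>P\<close> cancel in \<open>X'\<close>\<close>
  define X where "X = (\<lambda>t. \<rho> t powr (?q + 1) * W.P c t - V.P c t)"
  have DX: "(X has_real_derivative (?q + 1) * \<rho> t powr ?q * (R t / (w t)\<^sup>2) * W.P c t) (at t)" if t: "t > 0" for t
  proof -
    have "((\<lambda>x. x powr (?q + 1)) has_real_derivative (?q + 1) * \<rho> t powr ?q) (at (\<rho> t))"
      using \<rho>_pos[OF t] by (auto intro!: derivative_eq_intros)
    from DERIV_chain2[OF this D\<rho>[OF t]]
    have "((\<lambda>t. \<rho> t powr (?q + 1)) has_real_derivative (?q + 1) * \<rho> t powr ?q * (R t / (w t)\<^sup>2)) (at t)" .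
    from DERIV_diff[OF DERIV_mult[OF this DP(1)[OF t]] DP(2)[OF t]]
    have "(X has_real_derivative ((?q + 1) * \<rho> t powr ?q * (R t / (w t)\<^sup>2) * W.P c t
       + \<kappa> * ?A' t * w t powr (?q + 1) * \<rho> t powr (?q + 1) - \<kappa> * ?A' t * v t powr (?q + 1))) (at t)"
      unfolding X_def .
    moreover have "v t powr (?q + 1) = w t powr (?q + 1) * \<rho> t powr (?q + 1)"
    proof -
      have "v t = w t * \<rho> t" using W.w_pos[OF t] by (simp add: \<rho>_def)
      then show ?thesis using W.w_pos[OF t] \<rho>_pos[OF t] by (simp add: powr_mult)
    qed
    ultimately show ?thesis by simp
  qed
  have X_lim: "(X \<longlongrightarrow> 0) at_top"
  proof -
    have "((\<lambda>t. \<rho> t powr (?q + 1) * W.P c t - V.P c t) \<longlongrightarrow> (\<gamma>' / \<gamma>) powr (?q + 1) * 0 - 0) at_top"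
      using W.\<gamma> V.\<gamma> by (intro tendsto_intros \<rho>_lim W.P_lim V.P_lim) auto
    then show ?thesis unfolding X_def by simp
  qed
  have DX_nonneg: "0 \<le> (?q + 1) * \<rho> t powr ?q * (R t / (w t)\<^sup>2) * W.P c t" if "t > 0" "R t \<ge> 0" for t
    using that P_nonneg W.q by (intro mult_nonneg_nonneg) auto
  show False
  proof (cases "\<forall>t>0. R t > 0")
    case True
    have \<rho>_le: "\<rho> t \<le> \<gamma>' / \<gamma>" if "t > 0" for t
    proof (rule mono_le_limit[OF D\<rho> _ \<rho>_lim])
      show "s > 0" if "s \<ge> t" for s using that \<open>t > 0\<close> by simp
      show "0 \<le> R s / (w s)\<^sup>2" if "s \<ge> t" for s using True that \<open>t > 0\<close> by (simp add: less_imp_le)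
    qed
    have X0: "(X \<longlongrightarrow> 0) (at_right 0)"
    proof -
      have "eventually (\<lambda>t. \<bar>\<rho> t powr (?q + 1)\<bar> \<le> (\<gamma>' / \<gamma>) powr (?q + 1)) (at_right 0)"
        using eventually_at_right_less[of 0]
        by (rule eventually_mono) (use \<rho>_le \<rho>_pos W.q in \<open>auto intro!: powr_mono2 intro: less_imp_le\<close>)
      from tendsto_diff[OF tendsto_null_mult_bounded[OF W.P_0[OF l0] this] V.P_0[OF l0]]
      show ?thesis unfolding X_def by (simp add: mult.commute)
    qed
    have "0 < X \<epsilon>"
    proof (rule mono_gt_limit_at_right[OF DX _ X0 \<epsilon>(1)])
      show "0 < (?q + 1) * \<rho> s powr ?q * (R s / (w s)\<^sup>2) * W.P c s" if "0 < s" "s \<le> \<epsilon>" for s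
      proof -
        have "W.P c s > 0" using P_pos_if_incr[of s] \<epsilon>(2) that by simp
        then show ?thesis
          using that True \<rho>_pos[of s] W.w_pos[of s] W.q by (intro mult_pos_pos divide_pos_pos) auto
      qed
    qed
    moreover have "X \<epsilon> \<le> 0"
    proof (rule mono_le_limit[OF DX _ X_lim])
      fix s assume "s \<ge> \<epsilon>"
      then have s: "s > 0" using \<epsilon>(1) by simp
      then show "s > 0" .
      show "0 \<le> (?q + 1) * \<rho> s powr ?q * (R s / (w s)\<^sup>2) * W.P c s"
        using True s by (intro DX_nonneg) (auto intro: less_imp_le)
    qed
    ultimately show False by simp
  next
    case False
    then obtain t0 where t0: "t0 > 0" "R t0 \<le> 0" by (auto simp: not_less)
    then have "t0 \<le> T" using T(2)[of t0] by linarith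
    moreover have "isCont R t" if "t0 \<le> t" for t using DR[of t] that t0 by (auto intro: DERIV_isCont)
    ultimately obtain \<tau> where \<tau>: "t0 \<le> \<tau>" "\<tau> < T" "R \<tau> = 0" "\<forall>s. \<tau> < s \<and> s \<le> T \<longrightarrow> R s > 0"
      using last_zero[of t0 T R] t0 T by auto
    have \<tau>0: "\<tau> > 0" using \<tau> t0 by simp
    have R_pos: "R s > 0" if "s > \<tau>" for s using \<tau>(4) T(2)[of s] that by (cases "s \<le> T") auto
    have R_nonneg: "R s \<ge> 0" if "s \<ge> \<tau>" for s using R_pos[of s] \<tau>(3) that by (cases "s = \<tau>") auto
    \<comment> \<open>otherwise \<open>v \<ge> w\<close> from \<open>\<tau>\<close> on, so that \<open>R\<close> could not become positive\<close>
    have \<rho>1: "\<rho> \<tau> < 1"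
    proof (rule ccontr)
      assume "\<not> \<rho> \<tau> < 1"
      have "\<rho> s \<ge> 1" if s: "s \<ge> \<tau>" for s
      proof -
        have "\<rho> \<tau> \<le> \<rho> s"
        proof (rule DERIV_nonneg_imp_nondecreasing[OF s])
          fix x assume "\<tau> \<le> x" "x \<le> s"
          then show "\<exists>y. (\<rho> has_real_derivative y) (at x) \<and> 0 \<le> y"
            using D\<rho>[of x] R_nonneg[of x] \<tau>0 by (intro exI[of _ "R x / (w x)\<^sup>2"]) auto
        qed
        then show ?thesis using \<open>\<not> \<rho> \<tau> < 1\<close> by simp
      qed
      then have "R (\<tau> + 1) \<le> R \<tau>"
      proof (intro DERIV_nonpos_imp_nonincreasing[of \<tau> "\<tau> + 1" R])
        fix x assume ge: "\<And>s. \<tau> \<le> s \<Longrightarrow> 1 \<le> \<rho> s" and "\<tau> \<le> x" "x \<le> \<tau> + 1"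
        then show "\<exists>y. (R has_real_derivative y) (at x) \<and> y \<le> 0"
          using DR[of x] DR_sign(2)[of x] \<tau>0 by (metis less_le_trans)
      qed simp
      then show False using R_pos[of "\<tau> + 1"] \<tau>(3) by simp
    qed
    have "X \<tau> \<le> 0"
    proof (rule mono_le_limit[OF DX _ X_lim])
      fix s assume "s \<ge> \<tau>"
      then show "s > 0" "0 \<le> (?q + 1) * \<rho> s powr ?q * (R s / (w s)\<^sup>2) * W.P c s"
        using DX_nonneg[of s] R_nonneg[of s] \<tau>0 by auto
    qed
    moreover have "X \<tau> > 0"
    proof -
      let ?r = "\<rho> \<tau>"
      have w: "w \<tau> > 0" using W.w_pos \<tau>0 by simp
      have v: "v \<tau> = ?r * w \<tau>" using w by (simp add: \<rho>_def)
      have v1: "v1 \<tau> = ?r * w1 \<tau>" using \<tau>(3) w by (simp add: \<rho>_def R_def field_simps)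
      have N: "V.N1 \<tau> = ?r * W.N1 \<tau>" "V.N2 c \<tau> = ?r * W.N2 c \<tau>"
        by (simp_all add: V.N1_def W.N1_def V.N2_def W.N2_def v v1 algebra_simps)
      have pw: "v \<tau> powr (?q + 1) = ?r powr (?q + 1) * w \<tau> powr (?q + 1)"
        unfolding v using w \<rho>_pos[OF \<tau>0] by (simp add: powr_mult)
      have X: "X \<tau> = (?r powr (?q + 1) - ?r\<^sup>2) * (W.N1 \<tau> * W.N2 c \<tau> / 2)"
        unfolding X_def W.P_def V.P_def N pw by (simp add: power2_eq_square algebra_simps)
      have "W.N1 \<tau> > 0" using \<tau>0 phi by (intro W.N1_pos) auto
      moreover have "0 < - W.N2 c \<tau>"
      proof (rule mono_gt_limit_at_right[OF DERIV_minus[OF W.DN2] _ _ \<tau>0])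
        show "((\<lambda>t. - W.N2 c t) \<longlongrightarrow> 0) (at_right 0)"
          using tendsto_minus[OF W.N2_0[OF l0]] by simp
        show "0 < - (- (w s powr ?q * ?l s))" if "0 < s" for s
          using W.w_pos[OF that] l_pos[OF that] by simp
      qed
      moreover have "?r powr (?q + 1) - ?r\<^sup>2 < 0"
      proof -
        have "?r powr (?q + 1) < ?r powr 2"
          using W.q \<rho>_pos[OF \<tau>0] \<rho>1 by (intro powr_less_mono') auto
        then show ?thesis using \<rho>_pos[OF \<tau>0] by simp
      qed
      ultimately show ?thesis unfolding X by (simp add: mult_neg_neg mult_less_0_iff zero_less_mult_iff)
    qed
    ultimately show False by simp
  qed
qed

section \<open>From the radial equation to the Emden-Fowler equation\<close>

text \<open>The change of variable produces a factor \<open>r\<^sup>2\<close> in front of the nonlinear term; since \<open>\<nu> + 2 = \<nu> q\<close> it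
  is absorbed by the power of \<open>w = r\<^sup>\<nu> u\<close>.\<close>

lemma emden_fowler_of_radial_ode:
  assumes ode: "radial_ode \<nu> lam G G1 G2" and nu: "0 < \<nu>" "\<nu> < 1"
  shows "emden_fowler \<nu> lam (G 0) 0 (\<lambda>t. exp (- (\<nu> * t)) * G (exp (- (2 * t))))
     (\<lambda>t. - (exp (- (\<nu> * t)) * (\<nu> * G (exp (- (2 * t))) + 2 * (exp (- (2 * t)) * G1 (exp (- (2 * t)))))))"
proof
  show "0 < \<nu>" "\<nu> < 1" by (fact nu)+
  show "G 0 > 0" using ode by (simp add: radial_ode_def)
  have ode': "(G has_real_derivative G1 y) (at y)" "(G1 has_real_derivative G2 y) (at y)" "G y > 0"
    "4 * y * G2 y + 4 * (\<nu> + 1) * G1 y + lam * G y + G y powr (1 + 2 / \<nu>) = 0" if "0 < y" "y < 1" for y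
    using ode that by (auto simp: radial_ode_def)
  fix t :: real assume t: "0 < t"
  let ?x = "exp (- (2 * t))"
  have x: "0 < ?x" "?x < 1" using t by auto
  have dx: "((\<lambda>t. exp (- (2 * t))) has_real_derivative - 2 * ?x) (at t)"
    by (auto intro!: derivative_eq_intros)
  have de: "((\<lambda>t. exp (- (\<nu> * t))) has_real_derivative - \<nu> * exp (- (\<nu> * t))) (at t)"
    by (auto intro!: derivative_eq_intros)
  note dG = DERIV_chain2[OF ode'(1)[OF x] dx] and dG1 = DERIV_chain2[OF ode'(2)[OF x] dx]
  show "((\<lambda>t. exp (- (\<nu> * t)) * G (exp (- (2 * t)))) has_real_derivative
     - (exp (- (\<nu> * t)) * (\<nu> * G ?x + 2 * (?x * G1 ?x)))) (at t)"
    using DERIV_mult[OF de dG] by (simp add: algebra_simps)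
  show "0 < exp (- (\<nu> * t)) * G ?x" using ode'(3)[OF x] by simp
  have "((\<lambda>t. - (exp (- (\<nu> * t)) * (\<nu> * G (exp (- (2 * t))) + 2 * (exp (- (2 * t)) * G1 (exp (- (2 * t)))))))
     has_real_derivative - ((- \<nu> * exp (- (\<nu> * t))) * (\<nu> * G ?x + 2 * (?x * G1 ?x))
       + (\<nu> * (G1 ?x * (- 2 * ?x)) + 2 * ((- 2 * ?x) * G1 ?x + (G2 ?x * (- 2 * ?x)) * ?x)) * exp (- (\<nu> * t)))) (at t)"
    by (intro DERIV_minus DERIV_mult DERIV_add DERIV_cmult de dG dG1 dx)
  moreover have "- ((- \<nu> * exp (- (\<nu> * t))) * (\<nu> * G ?x + 2 * (?x * G1 ?x))
       + (\<nu> * (G1 ?x * (- 2 * ?x)) + 2 * ((- 2 * ?x) * G1 ?x + (G2 ?x * (- 2 * ?x)) * ?x)) * exp (- (\<nu> * t)))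
     = exp (- (\<nu> * t)) * (\<nu>\<^sup>2 * G ?x + ?x * (4 * ?x * G2 ?x + 4 * (\<nu> + 1) * G1 ?x))"
    by (simp add: algebra_simps power2_eq_square)
  moreover have e2: "4 * ?x * G2 ?x + 4 * (\<nu> + 1) * G1 ?x = - (lam * G ?x + G ?x powr (1 + 2 / \<nu>))"
    using ode'(4)[OF x] by linarith
  moreover have e3: "exp (- (\<nu> * t)) * (?x * G ?x powr (1 + 2 / \<nu>)) = (exp (- (\<nu> * t)) * G ?x) powr (1 + 2 / \<nu>)"
  proof -
    have "(exp (- (\<nu> * t)) * G ?x) powr (1 + 2 / \<nu>) = exp (- (\<nu> * t)) powr (1 + 2 / \<nu>) * G ?x powr (1 + 2 / \<nu>)"
      using ode'(3)[OF x] by (simp add: powr_mult)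
    also have "exp (- (\<nu> * t)) powr (1 + 2 / \<nu>) = exp (- (\<nu> * t) + - (2 * t))"
      using nu by (simp add: powr_def field_simps)
    also have "\<dots> = exp (- (\<nu> * t)) * ?x" by (rule exp_add)
    finally show ?thesis by simp
  qed
  moreover have "exp (- (\<nu> * t)) * (\<nu>\<^sup>2 * G ?x + ?x * (4 * ?x * G2 ?x + 4 * (\<nu> + 1) * G1 ?x))
     = (\<nu>\<^sup>2 - lam * ?x) * (exp (- (\<nu> * t)) * G ?x) - (exp (- (\<nu> * t)) * G ?x) powr (1 + 2 / \<nu>)"
    unfolding e2 e3[symmetric] by (simp add: algebra_simps)
  ultimately show "((\<lambda>t. - (exp (- (\<nu> * t)) * (\<nu> * G (exp (- (2 * t))) + 2 * (exp (- (2 * t)) * G1 (exp (- (2 * t)))))))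
     has_real_derivative (\<nu>\<^sup>2 - lam * ?x) * (exp (- (\<nu> * t)) * G ?x) - (exp (- (\<nu> * t)) * G ?x) powr (1 + 2 / \<nu>)) (at t)"
    by (simp only:)
next
  have cancel: "exp (\<nu> * t) * (exp (- (\<nu> * t)) * y) = y" for t y :: real
    by (simp add: mult.assoc[symmetric] exp_add[symmetric])
  have fl: "filterlim (\<lambda>t::real. exp (- (2 * t))) (at_right 0) at_top" by real_asymp
  have G0: "((\<lambda>t. G (exp (- (2 * t)))) \<longlongrightarrow> G 0) at_top"
    by (rule filterlim_compose[OF _ fl]) (use ode in \<open>simp add: radial_ode_def\<close>)
  have yG1: "((\<lambda>t. exp (- (2 * t)) * G1 (exp (- (2 * t)))) \<longlongrightarrow> 0) at_top"
    by (rule filterlim_compose[OF _ fl, where g = "\<lambda>y. y * G1 y"]) (use ode in \<open>simp add: radial_ode_def\<close>)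
  show "((\<lambda>t. exp (\<nu> * t) * (exp (- (\<nu> * t)) * G (exp (- (2 * t))))) \<longlongrightarrow> G 0) at_top"
    unfolding cancel by (rule G0)
  have "((\<lambda>t. - (\<nu> * G (exp (- (2 * t))) + 2 * (exp (- (2 * t)) * G1 (exp (- (2 * t)))))) \<longlongrightarrow> - (\<nu> * G 0 + 2 * 0)) at_top"
    by (intro tendsto_intros G0 yG1)
  then show "((\<lambda>t. exp (\<nu> * t) * - (exp (- (\<nu> * t)) * (\<nu> * G (exp (- (2 * t))) + 2 * (exp (- (2 * t)) * G1 (exp (- (2 * t)))))))
      \<longlongrightarrow> - (\<nu> * G 0)) at_top"
    unfolding mult_minus_right cancel by simp
qed

lemma emden_fowler_dirichlet_of_radial_ode:
  assumes ode: "radial_ode \<nu> lam G G1 G2" and van: "vanishing_at_1 G G1" and nu: "0 < \<nu>" "\<nu> < 1"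
  shows "emden_fowler_dirichlet \<nu> lam (G 0) (\<lambda>t. exp (- (\<nu> * t)) * G (exp (- (2 * t))))
     (\<lambda>t. - (exp (- (\<nu> * t)) * (\<nu> * G (exp (- (2 * t))) + 2 * (exp (- (2 * t)) * G1 (exp (- (2 * t)))))))"
proof (intro emden_fowler_dirichlet.intro emden_fowler_of_radial_ode[OF ode nu] emden_fowler_dirichlet_axioms.intro)
  have fl: "filterlim (\<lambda>t::real. exp (- (2 * t))) (at_left 1) (at_right 0)" by real_asymp
  have G1: "((\<lambda>t. G (exp (- (2 * t)))) \<longlongrightarrow> 0) (at_right 0)"
    by (rule filterlim_compose[OF _ fl]) (use van in \<open>simp add: vanishing_at_1_def\<close>)
  have e: "((\<lambda>t. exp (- (\<nu> * t))) \<longlongrightarrow> exp (- (\<nu> * 0))) (at_right 0)" by (intro tendsto_intros)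
  show "((\<lambda>t. exp (- (\<nu> * t)) * G (exp (- (2 * t)))) \<longlongrightarrow> 0) (at_right 0)"
    using tendsto_mult[OF e G1] by simp
  obtain B where B: "\<And>y. y \<in> {1/2<..<1} \<Longrightarrow> \<bar>G1 y\<bar> \<le> B"
    using van unfolding vanishing_at_1_def by blast
  have "eventually (\<lambda>t. \<bar>G (exp (- (2 * t)))\<bar> < 1) (at_right 0)"
    using order_tendstoD(2)[OF tendsto_rabs_zero[OF G1], of 1] by simp
  moreover have "eventually (\<lambda>t::real. exp (- (2 * t)) > 1/2) (at_right 0)" by real_asymp
  ultimately have "eventually (\<lambda>t. t > 0 \<and> \<bar>G (exp (- (2 * t)))\<bar> < 1 \<and> exp (- (2 * t)) > 1/2) (at_right 0)"
    using eventually_at_right_less[of "0::real"] by eventually_elim simp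
  then obtain b where b: "b > 0" "\<And>t. 0 < t \<Longrightarrow> t < b \<Longrightarrow> \<bar>G (exp (- (2 * t)))\<bar> < 1 \<and> exp (- (2 * t)) > 1/2"
    unfolding eventually_at_right_field by blast
  have "\<bar>- (exp (- (\<nu> * t)) * (\<nu> * G (exp (- (2 * t))) + 2 * (exp (- (2 * t)) * G1 (exp (- (2 * t))))))\<bar> \<le> 1 * (\<nu> * 1 + 2 * (1 * B))"
    if t: "0 < t" "t < b" for t
  proof -
    let ?x = "exp (- (2 * t))"
    have x: "?x \<in> {1/2<..<1}" using b(2)[OF t] t by auto
    have "\<bar>?x * G1 ?x\<bar> \<le> 1 * B"
      unfolding abs_mult using B[OF x] x by (intro mult_mono) auto
    moreover have "\<bar>\<nu> * G ?x\<bar> \<le> \<nu> * 1"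
      unfolding abs_mult using b(2)[OF t] nu by (intro mult_mono) auto
    ultimately have *: "\<bar>\<nu> * G ?x + 2 * (?x * G1 ?x)\<bar> \<le> \<nu> * 1 + 2 * (1 * B)"
      by linarith
    show ?thesis
      unfolding abs_minus_cancel abs_mult
      using * nu t by (intro mult_mono) (auto simp: abs_mult[symmetric])
  qed
  then show "\<exists>B b. b > 0 \<and> (\<forall>t. 0 < t \<and> t < b \<longrightarrow>
     \<bar>- (exp (- (\<nu> * t)) * (\<nu> * G (exp (- (2 * t))) + 2 * (exp (- (2 * t)) * G1 (exp (- (2 * t))))))\<bar> \<le> B)"
    using b(1) by blast
qed

text \<open>Uniqueness for the singular initial value problem, by a supremum weighted with \<open>e\<^sup>-\<^sup>L\<^sup>y\<close>, where
  \<open>L\<close> is a Lipschitz constant of the nonlinearity: integrating twice gains the factor \<open>1/4\<close>.\<close>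

lemma radial_ode_unique:
  assumes odeG: "radial_ode \<nu> lam G G1 G2" and odeH: "radial_ode \<nu> lam H H1 H2"
    and nu: "\<nu> > 0" and eq0: "G 0 = H 0" and y: "0 \<le> y" "y < 1"
  shows "G y = H y"
proof (cases "y = 0")
  case True
  then show ?thesis using eq0 by simp
next
  case False
  with y have y0: "0 < y" by simp
  define q where "q = 1 + 2 / \<nu>"
  have q: "q > 1" using nu by (simp add: q_def)
  define f where "f = (\<lambda>g::real. lam * g + g powr q)"
  have G: "(G has_real_derivative G1 s) (at s)" "(G1 has_real_derivative G2 s) (at s)" "G s > 0"
    "4 * s * G2 s + 4 * (\<nu> + 1) * G1 s + f (G s) = 0" if "0 < s" "s < 1" for s
    using odeG that by (auto simp: radial_ode_def f_def q_def add.assoc)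
  have H: "(H has_real_derivative H1 s) (at s)" "(H1 has_real_derivative H2 s) (at s)" "H s > 0"
    "4 * s * H2 s + 4 * (\<nu> + 1) * H1 s + f (H s) = 0" if "0 < s" "s < 1" for s
    using odeH that by (auto simp: radial_ode_def f_def q_def add.assoc)
  have lims: "(G \<longlongrightarrow> G 0) (at_right 0)" "(H \<longlongrightarrow> H 0) (at_right 0)" "G 0 > 0" "H 0 > 0"
    "((\<lambda>y. y * G1 y) \<longlongrightarrow> 0) (at_right 0)" "((\<lambda>y. y * H1 y) \<longlongrightarrow> 0) (at_right 0)"
    using odeG odeH by (auto simp: radial_ode_def)
  have cont: "continuous_on {0..y} F"
    if F: "(F \<longlongrightarrow> F 0) (at_right 0)" "\<And>s. 0 < s \<Longrightarrow> s < 1 \<Longrightarrow> (F has_real_derivative F1 s) (at s)" for F F1 :: "real \<Rightarrow> real"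
    unfolding continuous_on_eq_continuous_within
  proof
    fix s assume s: "s \<in> {0..y}"
    show "continuous (at s within {0..y}) F"
    proof (cases "s = 0")
      case True
      have "(F \<longlongrightarrow> F 0) (at 0 within {0..y})"
        using F(1) by (simp add: at_within_Icc_at_right[OF y0])
      then show ?thesis using True by (simp add: continuous_within)
    next
      case False
      then show ?thesis using F(2)[of s] s y by (auto intro: continuous_at_imp_continuous_within DERIV_isCont)
    qed
  qed
  have cG: "continuous_on {0..y} G" and cH: "continuous_on {0..y} H"
    using cont[OF lims(1) G(1)] cont[OF lims(2) H(1)] by auto
  have pos: "G s > 0" "H s > 0" if "0 \<le> s" "s \<le> y" for s
    using G(3)[of s] H(3)[of s] lims(3,4) that y by (cases "s = 0"; auto)+
  obtain M where M: "\<And>s. s \<in> {0..y} \<Longrightarrow> G s \<le> M" "\<And>s. s \<in> {0..y} \<Longrightarrow> H s \<le> M"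
  proof -
    obtain a where "\<forall>s\<in>{0..y}. G s \<le> G a" using continuous_attains_sup[OF _ _ cG] y0 by auto
    moreover obtain b where "\<forall>s\<in>{0..y}. H s \<le> H b" using continuous_attains_sup[OF _ _ cH] y0 by auto
    ultimately show ?thesis by (intro that[of "max (G a) (H b)"]) (auto simp: le_max_iff_disj)
  qed
  define L where "L = \<bar>lam\<bar> + q * M powr (q - 1) + 1"
  have L: "L > 0" using q by (simp add: L_def add_nonneg_pos)
  have lip: "\<bar>f a - f b\<bar> \<le> L * \<bar>a - b\<bar>" if ab: "0 < a" "a \<le> M" "0 < b" "b \<le> M" for a b
  proof -
    have d: "(f has_real_derivative lam + q * g powr (q - 1)) (at g within {0<..M})" if "g \<in> {0<..M}" for g
      unfolding f_def using that by (auto intro!: derivative_eq_intros)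
    have bd: "norm (lam + q * g powr (q - 1)) \<le> L" if "g \<in> {0<..M}" for g
    proof -
      have "g powr (q - 1) \<le> M powr (q - 1)" using that q by (intro powr_mono2) auto
      then have "q * g powr (q - 1) \<le> q * M powr (q - 1)" using q by (intro mult_left_mono) auto
      moreover have "q * g powr (q - 1) \<ge> 0" using q by simp
      ultimately show ?thesis by (simp add: L_def)
    qed
    have "norm (f a - f b) \<le> L * norm (a - b)"
      by (rule field_differentiable_bound[OF _ d bd]) (use ab in auto)
    then show ?thesis by simp
  qed
  define D where "D = (\<lambda>s. G s - H s)"
  define S0 where "S0 = (\<lambda>s. exp (- (L * s)) * \<bar>D s\<bar>)"
  have "continuous_on {0..y} S0"
    unfolding S0_def D_def by (intro continuous_intros cG cH)
  then obtain s0 where s0: "s0 \<in> {0..y}" "\<And>s. s \<in> {0..y} \<Longrightarrow> S0 s \<le> S0 s0"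
    using continuous_attains_sup[of "{0..y}" S0] y0 by auto
  define S where "S = S0 s0"
  have S: "S \<ge> 0" by (simp add: S_def S0_def)
  have D_le: "\<bar>D s\<bar> \<le> S * exp (L * s)" if "s \<in> {0..y}" for s
  proof -
    have "exp (- (L * s)) * \<bar>D s\<bar> * exp (L * s) \<le> S * exp (L * s)"
      using s0(2)[OF that] by (intro mult_right_mono) (auto simp: S_def S0_def)
    moreover have "exp (- (L * s)) * \<bar>D s\<bar> * exp (L * s) = \<bar>D s\<bar>"
      by (simp add: exp_minus)
    ultimately show ?thesis by simp
  qed
  define C where "C = L * S / 4"
  have C: "C \<ge> 0" using L S by (simp add: C_def)
  define K where "K = (\<lambda>s. s powr (\<nu> + 1) * (G1 s - H1 s))"
  have DK: "(K has_real_derivative - (s powr \<nu> * (f (G s) - f (H s)) / 4)) (at s)" if s: "0 < s" "s < 1" for s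
  proof -
    have "((\<lambda>s. s powr (\<nu> + 1)) has_real_derivative (\<nu> + 1) * s powr \<nu>) (at s)"
      using s by (auto intro!: derivative_eq_intros)
    from DERIV_mult[OF this DERIV_diff[OF G(2)[OF s] H(2)[OF s]]]
    have "(K has_real_derivative (\<nu> + 1) * s powr \<nu> * (G1 s - H1 s) + (G2 s - H2 s) * s powr (\<nu> + 1)) (at s)"
      unfolding K_def .
    moreover have "(\<nu> + 1) * s powr \<nu> * (G1 s - H1 s) + (G2 s - H2 s) * s powr (\<nu> + 1)
      = s powr \<nu> * ((4 * s * G2 s + 4 * (\<nu> + 1) * G1 s) - (4 * s * H2 s + 4 * (\<nu> + 1) * H1 s)) / 4"
      using s by (simp add: powr_add field_simps)
    moreover have "4 * s * G2 s + 4 * (\<nu> + 1) * G1 s = - f (G s)" "4 * s * H2 s + 4 * (\<nu> + 1) * H1 s = - f (H s)"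
      using G(4)[OF s] H(4)[OF s] by linarith+
    ultimately have "(K has_real_derivative s powr \<nu> * (- f (G s) - - f (H s)) / 4) (at s)" by (simp only:)
    then show ?thesis by (simp add: algebra_simps diff_divide_distrib)
  qed
  have p0: "((\<lambda>s. s powr \<nu>) \<longlongrightarrow> 0) (at_right 0)" "((\<lambda>s. s powr (\<nu> + 1)) \<longlongrightarrow> 0) (at_right 0)"
    using nu by real_asymp+
  have K0: "(K \<longlongrightarrow> 0) (at_right 0)"
  proof (rule Lim_transform_eventually)
    show "((\<lambda>s. s powr \<nu> * (s * G1 s - s * H1 s)) \<longlongrightarrow> 0) (at_right 0)"
      using tendsto_mult[OF p0(1) tendsto_diff[OF lims(5,6)]] by simp
    show "eventually (\<lambda>s. s powr \<nu> * (s * G1 s - s * H1 s) = K s) (at_right 0)"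
      using eventually_at_right_less[of 0] by (rule eventually_mono) (simp add: K_def powr_add algebra_simps)
  qed
  have K_le: "\<sigma> * K s \<le> C * exp (L * s) * s powr (\<nu> + 1)" if s: "0 < s" "s \<le> y" and \<sigma>: "\<bar>\<sigma>\<bar> = 1" for s \<sigma> :: real
  proof -
    have "0 \<le> C * exp (L * s) * s powr (\<nu> + 1) - \<sigma> * K s"
    proof (rule mono_ge_limit_at_right[OF _ _ _ s(1)])
      fix r assume r: "0 < r" "r \<le> s"
      then have r1: "r < 1" "r \<in> {0..y}" using s y by auto
      have e: "((\<lambda>s. C * exp (L * s)) has_real_derivative C * exp (L * r) * L) (at r)"
        by (auto intro!: derivative_eq_intros)
      have p: "((\<lambda>s. s powr (\<nu> + 1)) has_real_derivative (\<nu> + 1) * r powr \<nu>) (at r)"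
        using r by (auto intro!: derivative_eq_intros)
      show "((\<lambda>s. C * exp (L * s) * s powr (\<nu> + 1) - \<sigma> * K s) has_real_derivative
         ((C * exp (L * r) * L) * r powr (\<nu> + 1) + ((\<nu> + 1) * r powr \<nu>) * (C * exp (L * r))
           - \<sigma> * - (r powr \<nu> * (f (G r) - f (H r)) / 4))) (at r)"
        by (intro DERIV_diff DERIV_mult DERIV_cmult e p DK r r1)
      have "- \<sigma> * (f (G r) - f (H r)) \<le> \<bar>f (G r) - f (H r)\<bar>"
        using \<sigma> by (metis abs_ge_self abs_minus_cancel abs_mult mult_1)
      also have "\<dots> \<le> L * \<bar>D r\<bar>"
        unfolding D_def using M r1 pos[of r] r s by (intro lip) auto
      also have "\<dots> \<le> L * (S * exp (L * r))" using D_le[OF r1(2)] L by (intro mult_left_mono) auto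
      finally have "- \<sigma> * (f (G r) - f (H r)) / 4 \<le> C * exp (L * r)" by (simp add: C_def)
      then have "r powr \<nu> * (- \<sigma> * (f (G r) - f (H r)) / 4) \<le> r powr \<nu> * (C * exp (L * r))"
        by (intro mult_left_mono) auto
      moreover have "0 \<le> (C * exp (L * r) * L) * r powr (\<nu> + 1)" "0 \<le> \<nu> * r powr \<nu> * (C * exp (L * r))"
        using C L nu by auto
      ultimately show "0 \<le> (C * exp (L * r) * L) * r powr (\<nu> + 1) + ((\<nu> + 1) * r powr \<nu>) * (C * exp (L * r))
           - \<sigma> * - (r powr \<nu> * (f (G r) - f (H r)) / 4)"
        by (simp add: algebra_simps diff_divide_distrib)
    next
      have "((\<lambda>s. C * exp (L * s)) \<longlongrightarrow> C * exp (L * 0)) (at_right 0)" by (intro tendsto_intros)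
      from tendsto_diff[OF tendsto_mult[OF this p0(2)] tendsto_mult[OF tendsto_const K0, of \<sigma>]]
      show "((\<lambda>s. C * exp (L * s) * s powr (\<nu> + 1) - \<sigma> * K s) \<longlongrightarrow> 0) (at_right 0)" by simp
    qed
    then show ?thesis by simp
  qed
  have D1_le: "\<sigma> * (G1 s - H1 s) \<le> C * exp (L * s)" if s: "0 < s" "s \<le> y" and \<sigma>: "\<bar>\<sigma>\<bar> = 1" for s \<sigma> :: real
  proof -
    have "s powr (\<nu> + 1) * (\<sigma> * (G1 s - H1 s)) \<le> s powr (\<nu> + 1) * (C * exp (L * s))"
      using K_le[OF s \<sigma>] by (simp add: K_def ac_simps)
    then show ?thesis using s by simp
  qed
  have D4: "\<sigma> * D s \<le> S * exp (L * s) / 4" if s: "0 < s" "s \<le> y" and \<sigma>: "\<bar>\<sigma>\<bar> = 1" for s \<sigma> :: real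
  proof -
    have "S / 4 \<le> S / 4 * exp (L * s) - \<sigma> * D s"
    proof (rule mono_ge_limit_at_right[OF _ _ _ s(1)])
      fix r assume r: "0 < r" "r \<le> s"
      then have r1: "r < 1" using s y by auto
      have e: "((\<lambda>s. S / 4 * exp (L * s)) has_real_derivative S / 4 * exp (L * r) * L) (at r)"
        by (auto intro!: derivative_eq_intros)
      show "((\<lambda>s. S / 4 * exp (L * s) - \<sigma> * D s) has_real_derivative (S / 4 * exp (L * r) * L - \<sigma> * (G1 r - H1 r))) (at r)"
        unfolding D_def by (intro DERIV_diff DERIV_cmult e G H r r1)
      show "0 \<le> S / 4 * exp (L * r) * L - \<sigma> * (G1 r - H1 r)"
        using D1_le[of r \<sigma>] r s \<sigma> by (simp add: C_def ac_simps)
    next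
      have "((\<lambda>s. S / 4 * exp (L * s) - \<sigma> * (G s - H s)) \<longlongrightarrow> S / 4 * exp (L * 0) - \<sigma> * (G 0 - H 0)) (at_right 0)"
        by (intro tendsto_intros lims)
      then show "((\<lambda>s. S / 4 * exp (L * s) - \<sigma> * D s) \<longlongrightarrow> S / 4) (at_right 0)"
        unfolding D_def using eq0 by simp
    qed
    then show ?thesis using S by simp
  qed
  have "S \<le> S / 4"
  proof (cases "s0 = 0")
    case True
    then have "S = 0" using eq0 by (simp add: S_def S0_def D_def)
    then show ?thesis by simp
  next
    case False
    then have s0': "0 < s0" "s0 \<le> y" using s0(1) by auto
    have "\<bar>D s0\<bar> \<le> S * exp (L * s0) / 4"
      using D4[OF s0', of 1] D4[OF s0', of "- 1"] by (simp add: abs_le_iff)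
    then have "exp (- (L * s0)) * \<bar>D s0\<bar> \<le> exp (- (L * s0)) * (S * exp (L * s0) / 4)"
      by (intro mult_left_mono) auto
    moreover have "exp (- (L * s0)) * (S * exp (L * s0) / 4) = S / 4"
      by (simp add: exp_minus)
    moreover have "S = exp (- (L * s0)) * \<bar>D s0\<bar>" by (simp add: S_def S0_def)
    ultimately show ?thesis by linarith
  qed
  then have "S = 0" using S by simp
  then have "\<bar>D y\<bar> \<le> 0" using D_le[of y] y0 by simp
  then show ?thesis by (simp add: D_def)
qed

lemma positive_radial_solution_range:
  fixes v :: "'a::euclidean_space \<Rightarrow> real"
  assumes sol: "positive_radial_solution \<delta> lam v"
    and \<nu>: "\<nu> = (real DIM('a) - 2 - \<delta>) / 2" "0 < \<nu>" "\<nu> < 1"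
  shows "(bessel_zero (- \<nu>) 1)\<^sup>2 < lam \<and> lam < (bessel_zero \<nu> 1)\<^sup>2"
proof -
  obtain G G1 G2 where "radial_ode \<nu> lam G G1 G2" "vanishing_at_1 G G1"
    using radial_ode_of_solution[OF sol \<nu>(1,2)] by blast
  then interpret emden_fowler_dirichlet \<nu> lam "G 0"
     "\<lambda>t. exp (- (\<nu> * t)) * G (exp (- (2 * t)))"
     "\<lambda>t. - (exp (- (\<nu> * t)) * (\<nu> * G (exp (- (2 * t))) + 2 * (exp (- (2 * t)) * G1 (exp (- (2 * t))))))"
    using \<nu> by (intro emden_fowler_dirichlet_of_radial_ode)
  show ?thesis using lam_range by simp
qed

lemma positive_radial_solution_unique:
  fixes u v :: "'a::euclidean_space \<Rightarrow> real"
  assumes u: "positive_radial_solution \<delta> lam u" and v: "positive_radial_solution \<delta> lam v"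
    and \<nu>: "\<nu> = (real DIM('a) - 2 - \<delta>) / 2" "0 < \<nu>" "\<nu> < 1" and x: "x \<in> ball 0 1"
  shows "v x = u x"
proof -
  obtain G G1 G2 where G: "radial_ode \<nu> lam G G1 G2" "vanishing_at_1 G G1" "\<forall>x\<in>ball 0 1. u x = G (x \<bullet> x)"
    using radial_ode_of_solution[OF u \<nu>(1,2)] by blast
  obtain H H1 H2 where H: "radial_ode \<nu> lam H H1 H2" "vanishing_at_1 H H1" "\<forall>x\<in>ball 0 1. v x = H (x \<bullet> x)"
    using radial_ode_of_solution[OF v \<nu>(1,2)] by blast
  have "\<not> G 0 < H 0" "\<not> H 0 < G 0"
    using central_value_unique[OF emden_fowler_dirichlet_of_radial_ode[OF G(1,2) \<nu>(2,3)]
        emden_fowler_dirichlet_of_radial_ode[OF H(1,2) \<nu>(2,3)]]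
      central_value_unique[OF emden_fowler_dirichlet_of_radial_ode[OF H(1,2) \<nu>(2,3)]
        emden_fowler_dirichlet_of_radial_ode[OF G(1,2) \<nu>(2,3)]] by blast+
  then have "G 0 = H 0" by simp
  moreover have "0 \<le> x \<bullet> x" "x \<bullet> x < 1" using x by (auto simp: dot_square_norm power_less_one_iff)
  ultimately have "G (x \<bullet> x) = H (x \<bullet> x)" using radial_ode_unique[OF G(1) H(1) \<nu>(2)] by blast
  then show ?thesis using G(3) H(3) x by simp
qed

section \<open>Large central values\<close>

lemma abs_le_of_deriv_exp_bound:
  fixes f :: "real \<Rightarrow> real"
  assumes d: "\<And>s. s \<ge> t \<Longrightarrow> (f has_real_derivative f' s) (at s)"
      "\<And>s. s \<ge> t \<Longrightarrow> \<bar>f' s\<bar> \<le> C * exp (- (k * s))"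
    and lim: "(f \<longlongrightarrow> 0) at_top" and k: "k > 0"
  shows "\<bar>f t\<bar> \<le> C / k * exp (- (k * t))"
proof -
  have e: "((\<lambda>s. C / k * exp (- (k * s))) has_real_derivative - (C * exp (- (k * s)))) (at s)" for s
    using k by (auto intro!: derivative_eq_intros)
  have el: "((\<lambda>s. C / k * exp (- (k * s))) \<longlongrightarrow> 0) at_top"
    using k by (intro tendsto_mult_right_zero) real_asymp
  have "0 \<le> C / k * exp (- (k * t)) - f t"
  proof (rule antimono_ge_limit[OF DERIV_diff[OF e d(1)]])
    show "- (C * exp (- (k * s))) - f' s \<le> 0" if "s \<ge> t" for s using d(2)[OF that] by linarith
    show "((\<lambda>s. C / k * exp (- (k * s)) - f s) \<longlongrightarrow> 0) at_top" using tendsto_diff[OF el lim] by simp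
  qed
  moreover have "0 \<le> C / k * exp (- (k * t)) + f t"
  proof (rule antimono_ge_limit[OF DERIV_add[OF e d(1)]])
    show "- (C * exp (- (k * s))) + f' s \<le> 0" if "s \<ge> t" for s using d(2)[OF that] by linarith
    show "((\<lambda>s. C / k * exp (- (k * s)) + f s) \<longlongrightarrow> 0) at_top" using tendsto_add[OF el lim] by simp
  qed
  ultimately show ?thesis by linarith
qed

context emden_fowler
begin

text \<open>For \<open>w = r\<^sup>\<nu> u\<close> the left-hand side is \<open>- r\<^sup>\<nu>\<^sup>+\<^sup>1 u'(r)\<close>. By the equation \<open>r\<^sup>2\<^sup>\<nu>\<^sup>+\<^sup>1 u'(r)\<close> decreases in \<open>r\<close>, and it
  vanishes at the centre.\<close>

lemma w1_plus_pos:
  assumes "lam > 0" "t > a"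
  shows "\<nu> * w t + w1 t > 0"
proof -
  define f where "f = (\<lambda>t. exp (- (\<nu> * t)) * (\<nu> * w t + w1 t))"
  have "0 < f t"
  proof (rule antimono_gt_limit[where f = f
        and f' = "\<lambda>s. - (exp (- (\<nu> * s)) * (lam * exp (- (2 * s)) * w s + w s powr q))"])
    fix s assume "s \<ge> t"
    then have s: "s > a" using assms by simp
    have e: "((\<lambda>t. exp (- (\<nu> * t))) has_real_derivative - \<nu> * exp (- (\<nu> * s))) (at s)"
      by (auto intro!: derivative_eq_intros)
    have "(f has_real_derivative (- \<nu> * exp (- (\<nu> * s))) * (\<nu> * w s + w1 s)
        + (\<nu> * w1 s + (Q s * w s - w s powr q)) * exp (- (\<nu> * s))) (at s)"
      unfolding f_def by (intro DERIV_mult DERIV_add DERIV_cmult e Dw Dw1_q s)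
    then show "(f has_real_derivative - (exp (- (\<nu> * s)) * (lam * exp (- (2 * s)) * w s + w s powr q))) (at s)"
      by (simp add: algebra_simps power2_eq_square)
    show "- (exp (- (\<nu> * s)) * (lam * exp (- (2 * s)) * w s + w s powr q)) < 0"
      using assms w_pos[OF s] by (simp add: add_pos_pos)
  next
    have e: "((\<lambda>t. exp (- (\<nu> * t))) \<longlongrightarrow> 0) at_top" using nu by real_asymp
    have "(f \<longlongrightarrow> 0 * (\<nu> * 0 + 0)) at_top"
      unfolding f_def by (intro tendsto_intros e w_lims w1_to_0)
    then show "(f \<longlongrightarrow> 0) at_top" by simp
  qed
  then show ?thesis by (simp add: f_def zero_less_mult_iff)
qed

text \<open>The corrected energy tends to \<open>0\<close> at infinity. Its derivative is a negative multiple of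
  \<open>w (\<nu> w + w')\<close>; the correction term is chosen to produce this combination, whose sign is known.\<close>

lemma corrected_energy_nonneg:
  assumes lam: "lam > 0" and t: "t > a"
  shows "0 \<le> energy t - lam * exp (- (2 * t)) * (w t)\<^sup>2 / (2 * \<nu> + 2)"
proof (rule antimono_ge_limit[where f = "\<lambda>t. energy t - lam * exp (- (2 * t)) * (w t)\<^sup>2 / (2 * \<nu> + 2)"
      and f' = "\<lambda>s. - (lam * exp (- (2 * s)) * w s * (\<nu> * w s + w1 s) * 2 / (2 * \<nu> + 2))"])
  fix s assume "s \<ge> t"
  then have s: "s > a" using t by simp
  have "((\<lambda>t. lam * exp (- (2 * t)) * (w t)\<^sup>2 / (2 * \<nu> + 2)) has_real_derivative
     (lam * exp (- (2 * s)) * (- 2) * (w s)\<^sup>2 + (2 * w s * w1 s) * (lam * exp (- (2 * s)))) / (2 * \<nu> + 2)) (at s)"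
    by (intro DERIV_cdivide DERIV_mult) (auto intro!: derivative_eq_intros Dw s)
  from DERIV_diff[OF D_energy[OF s] this]
  show "((\<lambda>t. energy t - lam * exp (- (2 * t)) * (w t)\<^sup>2 / (2 * \<nu> + 2)) has_real_derivative
    - (lam * exp (- (2 * s)) * w s * (\<nu> * w s + w1 s) * 2 / (2 * \<nu> + 2))) (at s)"
  proof (rule DERIV_cong)
    show "- (lam * exp (- (2 * s)) * (w s)\<^sup>2) - (lam * exp (- (2 * s)) * (- 2) * (w s)\<^sup>2
        + (2 * w s * w1 s) * (lam * exp (- (2 * s)))) / (2 * \<nu> + 2)
      = - (lam * exp (- (2 * s)) * w s * (\<nu> * w s + w1 s) * 2 / (2 * \<nu> + 2))"
    proof -
      have "- (l * w * w) - (l * (- 2) * (w * w) + (2 * w * w') * l) / (2 * \<nu> + 2)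
          = - (l * w * (\<nu> * w + w') * 2 / (2 * \<nu> + 2))" for l w w' :: real
        using nu by (simp add: field_simps)
      from this[of "lam * exp (- (2 * s))" "w s" "w1 s"] show ?thesis
        by (simp add: power2_eq_square mult.assoc)
    qed
  qed
  show "- (lam * exp (- (2 * s)) * w s * (\<nu> * w s + w1 s) * 2 / (2 * \<nu> + 2)) \<le> 0"
    using w1_plus_pos[OF lam s] w_pos[OF s] lam nu by simp
next
  have e: "((\<lambda>t::real. exp (- (2 * t))) \<longlongrightarrow> 0) at_top" by real_asymp
  have "((\<lambda>t. energy t - lam * exp (- (2 * t)) * (w t)\<^sup>2 / (2 * \<nu> + 2)) \<longlongrightarrow> 0 - lam * 0 * 0\<^sup>2 / (2 * \<nu> + 2)) at_top"
    using nu by (intro tendsto_intros energy_lim e w_lims) auto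
  then show "((\<lambda>t. energy t - lam * exp (- (2 * t)) * (w t)\<^sup>2 / (2 * \<nu> + 2)) \<longlongrightarrow> 0) at_top" by simp
qed

text \<open>The bubble \<open>u(r) = \<gamma> (1 + B r\<^sup>2)\<^sup>-\<^sup>\<nu>\<close> solves the equation with \<open>lam = 0\<close>, and \<open>u\<close> to the power \<open>- 1 / \<nu>\<close>
  is then linear in \<open>r\<^sup>2\<close>. For \<open>lam > 0\<close> the function \<open>Y\<close>, this power of \<open>u\<close>, is convex in \<open>r\<^sup>2\<close>: the second
  derivative is a positive multiple of the corrected energy. So \<open>Y\<close> lies above its tangent at the
  centre, whose slope is given by \<open>\<kappa> = - 2 G' 0\<close> in terms of \<open>u(r) = G(r\<^sup>2)\<close>.\<close>

lemma bubble_bound: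
  assumes lam: "lam > 0" and t: "t > a"
    and \<kappa>: "\<kappa> \<ge> \<gamma> powr q / 4" "((\<lambda>t. exp (2 * t) * (exp (\<nu> * t) * (\<nu> * w t + w1 t))) \<longlongrightarrow> \<kappa>) at_top"
  shows "exp (\<nu> * t) * w t \<le> (8 * \<nu>) powr \<nu> * exp (2 * \<nu> * t) / \<gamma>"
proof -
  define u where "u = (\<lambda>t. exp (\<nu> * t) * w t)"
  define Y where "Y = (\<lambda>t. u t powr (- (1 / \<nu>)))"
  define y where "y = (\<lambda>t. w1 t / w t)"
  define m where "m = (\<lambda>t. exp (2 * t) * (Y t * (\<nu> + y t)) / \<nu>)"
  have u_pos: "u s > 0" if "s > a" for s using w_pos[OF that] by (simp add: u_def)
  have Y_pos: "Y s > 0" if "s > a" for s using u_pos[OF that] by (simp add: Y_def)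
  have Du: "(u has_real_derivative u s * (\<nu> + y s)) (at s)" if s: "s > a" for s
  proof -
    have "(u has_real_derivative (\<nu> * exp (\<nu> * s)) * w s + w1 s * exp (\<nu> * s)) (at s)"
      unfolding u_def by (intro DERIV_mult Dw s) (auto intro!: derivative_eq_intros)
    then show ?thesis
      using w_pos[OF s] by (simp add: u_def y_def algebra_simps)
  qed
  have DY: "(Y has_real_derivative - (Y s * (\<nu> + y s) / \<nu>)) (at s)" if s: "s > a" for s
  proof -
    have "((\<lambda>x. x powr (- (1 / \<nu>))) has_real_derivative (- (1 / \<nu>)) * u s powr (- (1 / \<nu>) - 1)) (at (u s))"
      using u_pos[OF s] by (auto intro!: derivative_eq_intros)
    from DERIV_chain2[OF this Du[OF s]]
    have "(Y has_real_derivative (- (1 / \<nu>)) * u s powr (- (1 / \<nu>) - 1) * (u s * (\<nu> + y s))) (at s)"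
      unfolding Y_def .
    moreover have "u s powr (- (1 / \<nu>) - 1) * u s = Y s"
      using u_pos[OF s] by (simp add: Y_def powr_diff)
    then have "(- (1 / \<nu>)) * u s powr (- (1 / \<nu>) - 1) * (u s * (\<nu> + y s)) = - (Y s * (\<nu> + y s) / \<nu>)"
      by (metis (no_types, opaque_lifting) minus_mult_left mult.assoc mult.commute mult_1 times_divide_eq_left)
    ultimately show ?thesis by (simp only:)
  qed
  have Dy: "(y has_real_derivative Q s - w s powr (q - 1) - (y s)\<^sup>2) (at s)" if s: "s > a" for s
  proof -
    have w: "w s > 0" using w_pos[OF s] .
    have "(y has_real_derivative ((Q s * w s - w s powr q) * w s - w1 s * w1 s) / (w s * w s)) (at s)"
      unfolding y_def using w by (intro DERIV_divide Dw Dw1_q s) auto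
    moreover have "w s powr q = w s powr (q - 1) * w s" using w powr_add[of "w s" "q - 1" 1] by simp
    ultimately show ?thesis using w by (simp add: y_def field_simps power2_eq_square)
  qed
  have Dm: "(m has_real_derivative - (exp (2 * s) * Y s / \<nu> * (2 * (1 + \<nu>) / \<nu>)
      * ((energy s - lam * exp (- (2 * s)) * (w s)\<^sup>2 / (2 * \<nu> + 2)) / (w s)\<^sup>2))) (at s)" if s: "s > a" for s
  proof -
    have w: "w s > 0" using w_pos[OF s] .
    have e: "((\<lambda>t::real. exp (2 * t)) has_real_derivative 2 * exp (2 * s)) (at s)"
      by (auto intro!: derivative_eq_intros)
    have "(m has_real_derivative ((2 * exp (2 * s)) * (Y s * (\<nu> + y s))
      + ((- (Y s * (\<nu> + y s) / \<nu>)) * (\<nu> + y s) + (0 + (Q s - w s powr (q - 1) - (y s)\<^sup>2)) * Y s) * exp (2 * s)) / \<nu>) (at s)"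
      unfolding m_def by (intro DERIV_cdivide DERIV_mult DERIV_add e DY Dy s DERIV_const)
    moreover have "(energy s - lam * exp (- (2 * s)) * (w s)\<^sup>2 / (2 * \<nu> + 2)) / (w s)\<^sup>2
       = (y s)\<^sup>2 / 2 - Q s / 2 + w s powr (q - 1) / (q + 1) - lam * exp (- (2 * s)) / (2 * \<nu> + 2)"
    proof -
      have "w s powr (q + 1) = w s powr (q - 1) * (w s)\<^sup>2" using w powr_add[of "w s" "q - 1" 2] by (simp add: add.commute)
      then have "energy s = (w s)\<^sup>2 * ((y s)\<^sup>2 / 2 - Q s / 2 + w s powr (q - 1) / (q + 1))"
        using w by (simp add: energy_def y_def power_divide algebra_simps)
      then show ?thesis using w by (simp add: diff_divide_distrib)
    qed
    moreover have q1: "q + 1 = 2 * (1 + \<nu>) / \<nu>" using nu by (simp add: q_def field_simps)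
    have "((2 * E) * (Y' * (\<nu> + y')) + ((- (Y' * (\<nu> + y') / \<nu>)) * (\<nu> + y') + (0 + ((\<nu>\<^sup>2 - l) - p - y'\<^sup>2)) * Y') * E) / \<nu>
       = - (E * Y' / \<nu> * (2 * (1 + \<nu>) / \<nu>) * (y'\<^sup>2 / 2 - (\<nu>\<^sup>2 - l) / 2 + p / (2 * (1 + \<nu>) / \<nu>) - l / (2 * \<nu> + 2)))"
      for E Y' y' l p :: real
    proof -
      have eq: "(2 * (1 + \<nu>) / \<nu>) * (y'\<^sup>2 / 2 - (\<nu>\<^sup>2 - l) / 2 + p / (2 * (1 + \<nu>) / \<nu>) - l / (2 * \<nu> + 2))
          = - (\<nu> - y'\<^sup>2 / \<nu> + (\<nu>\<^sup>2 - l) - p - y'\<^sup>2)"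
      proof -
        define k where "k = 2 * (1 + \<nu>) / \<nu>"
        have k: "k \<noteq> 0" "k = (2 * \<nu> + 2) / \<nu>" using nu by (simp_all add: k_def)
        have e1: "k * (p / k) = p" using k(1) by simp
        have e2: "k * (l / (2 * \<nu> + 2)) = l / \<nu>" unfolding k(2) using nu by simp
        have e3: "k * (z / 2) = z / \<nu> + z" for z
          using nu by (simp add: k_def field_simps)
        have e4: "(\<nu>\<^sup>2 - l) / \<nu> = \<nu> - l / \<nu>"
          using nu by (simp add: diff_divide_distrib power2_eq_square)
        have e5: "k * (y'\<^sup>2 / 2 - (\<nu>\<^sup>2 - l) / 2 + p / k - l / (2 * \<nu> + 2))
          = k * (y'\<^sup>2 / 2) - k * ((\<nu>\<^sup>2 - l) / 2) + k * (p / k) - k * (l / (2 * \<nu> + 2))"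
          by (simp only: right_diff_distrib distrib_left)
        have "k * (y'\<^sup>2 / 2 - (\<nu>\<^sup>2 - l) / 2 + p / k - l / (2 * \<nu> + 2))
          = - (\<nu> - y'\<^sup>2 / \<nu> + (\<nu>\<^sup>2 - l) - p - y'\<^sup>2)" unfolding e5 e1 e2 e3 e4 by simp
        then show ?thesis unfolding k_def .
      qed
      have "- (E * Y' / \<nu> * ((2 * (1 + \<nu>) / \<nu>) * (y'\<^sup>2 / 2 - (\<nu>\<^sup>2 - l) / 2 + p / (2 * (1 + \<nu>) / \<nu>) - l / (2 * \<nu> + 2))))
         = E * Y' / \<nu> * (\<nu> - y'\<^sup>2 / \<nu> + (\<nu>\<^sup>2 - l) - p - y'\<^sup>2)"
        unfolding eq by (simp only: mult_minus_right minus_minus)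
      moreover have "((2 * E) * (Y' * (\<nu> + y')) + ((- (Y' * (\<nu> + y') / \<nu>)) * (\<nu> + y') + (0 + ((\<nu>\<^sup>2 - l) - p - y'\<^sup>2)) * Y') * E) / \<nu>
         = E * Y' / \<nu> * (\<nu> - y'\<^sup>2 / \<nu> + (\<nu>\<^sup>2 - l) - p - y'\<^sup>2)"
        using nu by (simp add: field_simps power2_eq_square)
      ultimately show ?thesis by (simp only: mult.assoc)
    qed
    from this[of "exp (2 * s)" "Y s" "y s" "lam * exp (- (2 * s))" "w s powr (q - 1)"]
    have "((2 * exp (2 * s)) * (Y s * (\<nu> + y s))
      + ((- (Y s * (\<nu> + y s) / \<nu>)) * (\<nu> + y s) + (0 + (Q s - w s powr (q - 1) - (y s)\<^sup>2)) * Y s) * exp (2 * s)) / \<nu>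
      = - (exp (2 * s) * Y s / \<nu> * (2 * (1 + \<nu>) / \<nu>)
        * ((y s)\<^sup>2 / 2 - Q s / 2 + w s powr (q - 1) / (q + 1) - lam * exp (- (2 * s)) / (2 * \<nu> + 2)))"
      unfolding q1 .
    ultimately show ?thesis by (simp only:)
  qed
  have Y_lim: "(Y \<longlongrightarrow> \<gamma> powr (- (1 / \<nu>))) at_top"
    unfolding Y_def u_def using \<gamma> by (intro tendsto_powr w_lim tendsto_const) auto
  have ev: "eventually (\<lambda>t. t > a) at_top" by (rule eventually_gt_at_top)
  have m_lim: "(m \<longlongrightarrow> \<gamma> powr (- (1 / \<nu>)) * (\<kappa> / \<gamma>) / \<nu>) at_top"
  proof (rule Lim_transform_eventually)
    show "((\<lambda>t. Y t * ((exp (2 * t) * (exp (\<nu> * t) * (\<nu> * w t + w1 t))) / (exp (\<nu> * t) * w t)) / \<nu>)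
        \<longlongrightarrow> \<gamma> powr (- (1 / \<nu>)) * (\<kappa> / \<gamma>) / \<nu>) at_top"
      using \<gamma> nu by (intro tendsto_intros Y_lim \<kappa>(2) w_lim) auto
    show "eventually (\<lambda>t. Y t * ((exp (2 * t) * (exp (\<nu> * t) * (\<nu> * w t + w1 t))) / (exp (\<nu> * t) * w t)) / \<nu> = m t) at_top"
      using ev
    proof (rule eventually_mono)
      fix s assume "s > a"
      then have "w s > 0" by (rule w_pos)
      then have "(exp (2 * s) * (exp (\<nu> * s) * (\<nu> * w s + w1 s))) / (exp (\<nu> * s) * w s) = exp (2 * s) * (\<nu> + y s)"
        by (simp add: y_def field_simps)
      then show "Y s * ((exp (2 * s) * (exp (\<nu> * s) * (\<nu> * w s + w1 s))) / (exp (\<nu> * s) * w s)) / \<nu> = m s"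
        by (simp add: m_def)
    qed
  qed
  define c where "c = \<gamma> powr (1 / \<nu>) / (4 * \<nu>)"
  have c: "c > 0" using \<gamma> nu by (simp add: c_def)
  have c_le: "c \<le> \<gamma> powr (- (1 / \<nu>)) * (\<kappa> / \<gamma>) / \<nu>"
  proof -
    have "\<gamma> powr (1 / \<nu>) = \<gamma> powr (- (1 / \<nu>)) * (\<gamma> powr q / \<gamma>)"
    proof -
      have "\<gamma> powr q / \<gamma> = \<gamma> powr (q - 1)" using \<gamma> by (simp add: powr_diff)
      then have "\<gamma> powr (- (1 / \<nu>)) * (\<gamma> powr q / \<gamma>) = \<gamma> powr (- (1 / \<nu>) + (q - 1))" by (simp only: powr_add)
      also have "- (1 / \<nu>) + (q - 1) = 1 / \<nu>" by (simp add: q_def field_simps)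
      finally show ?thesis by simp
    qed
    moreover have "\<gamma> powr (- (1 / \<nu>)) * (\<gamma> powr q / 4 / \<gamma>) / \<nu> \<le> \<gamma> powr (- (1 / \<nu>)) * (\<kappa> / \<gamma>) / \<nu>"
      using \<kappa>(1) \<gamma> nu by (intro divide_right_mono mult_left_mono) auto
    ultimately show ?thesis by (simp add: c_def)
  qed
  have m_ge: "c \<le> m s" if s: "s > a" for s
  proof -
    have "\<gamma> powr (- (1 / \<nu>)) * (\<kappa> / \<gamma>) / \<nu> \<le> m s"
    proof (rule antimono_ge_limit[OF Dm _ m_lim])
      fix r assume "r \<ge> s"
      then show r: "r > a" using s by simp
      show "- (exp (2 * r) * Y r / \<nu> * (2 * (1 + \<nu>) / \<nu>)
        * ((energy r - lam * exp (- (2 * r)) * (w r)\<^sup>2 / (2 * \<nu> + 2)) / (w r)\<^sup>2)) \<le> 0"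
        using corrected_energy_nonneg[OF lam r] Y_pos[OF r] nu
        unfolding neg_le_0_iff_le by (intro mult_nonneg_nonneg divide_nonneg_nonneg) auto
    qed
    then show ?thesis using c_le by simp
  qed
  have "\<gamma> powr (- (1 / \<nu>)) \<le> Y t - c / 2 * exp (- (2 * t))"
  proof (rule antimono_ge_limit[where f = "\<lambda>t. Y t - c / 2 * exp (- (2 * t))"
        and f' = "\<lambda>s. - (Y s * (\<nu> + y s) / \<nu>) - c / 2 * (exp (- (2 * s)) * (- 2))"])
    fix s assume "s \<ge> t"
    then have s: "s > a" using t by simp
    show "((\<lambda>t. Y t - c / 2 * exp (- (2 * t))) has_real_derivative - (Y s * (\<nu> + y s) / \<nu>) - c / 2 * (exp (- (2 * s)) * (- 2))) (at s)"
      by (intro DERIV_diff DERIV_cmult DY s) (auto intro!: derivative_eq_intros)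
    have "exp (- (2 * s)) * c \<le> exp (- (2 * s)) * m s" using m_ge[OF s] by (intro mult_left_mono) auto
    also have "\<dots> = Y s * (\<nu> + y s) / \<nu>" by (simp add: m_def exp_minus)
    finally show "- (Y s * (\<nu> + y s) / \<nu>) - c / 2 * (exp (- (2 * s)) * (- 2)) \<le> 0"
      by (simp add: mult.commute[of c])
  next
    have e: "((\<lambda>t::real. exp (- (2 * t))) \<longlongrightarrow> 0) at_top" by real_asymp
    show "((\<lambda>t. Y t - c / 2 * exp (- (2 * t))) \<longlongrightarrow> \<gamma> powr (- (1 / \<nu>))) at_top"
      using tendsto_diff[OF Y_lim tendsto_mult[OF tendsto_const e, of "c / 2"]] by simp
  qed
  moreover have "\<gamma> powr (- (1 / \<nu>)) > 0" using \<gamma> by simp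
  ultimately have Yge: "c / 2 * exp (- (2 * t)) \<le> Y t" by linarith
  have "u t = Y t powr (- \<nu>)"
    using nu u_pos[OF t] by (simp add: Y_def powr_powr)
  also have "\<dots> \<le> (c / 2 * exp (- (2 * t))) powr (- \<nu>)"
    using Yge c nu by (intro powr_mono2') auto
  also have "\<dots> = (8 * \<nu>) powr \<nu> * exp (2 * \<nu> * t) / \<gamma>"
  proof -
    have "c / 2 * exp (- (2 * t)) = (\<gamma> powr (1 / \<nu>) * exp (- (2 * t))) / (8 * \<nu>)"
      by (simp add: c_def)
    moreover have "(\<gamma> powr (1 / \<nu>) * exp (- (2 * t))) powr (- \<nu>) = exp (2 * \<nu> * t) / \<gamma>"
    proof -
      have "(\<gamma> powr (1 / \<nu>)) powr (- \<nu>) = 1 / \<gamma>"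
        using nu \<gamma> by (simp add: powr_powr powr_minus_divide)
      moreover have "exp (- (2 * t)) powr (- \<nu>) = exp (2 * \<nu> * t)"
        by (simp add: powr_def)
      ultimately show ?thesis using \<gamma> by (simp add: powr_mult)
    qed
    moreover have "(8 * \<nu>) powr (- \<nu>) = 1 / (8 * \<nu>) powr \<nu>" by (simp add: powr_minus_divide)
    ultimately show ?thesis using nu \<gamma> by (simp add: powr_divide)
  qed
  finally show ?thesis by (simp add: u_def)
qed

end

text \<open>For large \<open>\<gamma>\<close> the solution concentrates at the centre: away from it \<open>N1\<close> is at least of order
  \<open>1 / \<gamma>\<close>, whereas \<open>P = O(\<gamma>\<^sup>-\<^sup>1\<^sup>-\<^sup>1\<^sup>/\<^sup>\<nu>)\<close> by interpolating with weight \<open>3/4\<close> between \<open>u \<le> \<gamma>\<close> and the bubble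
  bound. Since \<open>\<nu> < 1\<close>, \<open>P\<close> is negligible against \<open>N1\<^sup>2\<close>: at \<open>t0\<close> the solution is nearly proportional to
  \<open>phi (-\<nu>)\<close> and cannot stay positive where \<open>phi (-\<nu>)\<close> is negative.\<close>

lemma not_positive_for_large_central_value:
  assumes nu: "0 < \<nu>" "\<nu> < 1" and lam: "(bessel_zero (- \<nu>) 1)\<^sup>2 < lam" "lam < (bessel_zero \<nu> 1)\<^sup>2"
  shows "\<exists>\<Gamma>. \<forall>\<gamma>\<ge>\<Gamma>. \<forall>w w1 \<kappa>. emden_fowler \<nu> lam \<gamma> 0 w w1 \<longrightarrow>
     (\<forall>t>0. \<gamma> - (lam * \<gamma> + \<gamma> powr (1 + 2 / \<nu>)) * exp (- (2 * t)) / 4 \<le> exp (\<nu> * t) * w t) \<longrightarrow>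
     (\<forall>t>0. exp (\<nu> * t) * w t \<le> \<gamma>) \<longrightarrow>
     \<kappa> \<ge> \<gamma> powr (1 + 2 / \<nu>) / 4 \<longrightarrow>
     ((\<lambda>t. exp (2 * t) * (exp (\<nu> * t) * (\<nu> * w t + w1 t))) \<longlongrightarrow> \<kappa>) at_top \<longrightarrow> False"
proof -
  interpret bessel_pair \<nu> lam by standard (rule nu)+
  have zm: "z_minus > 0" using z_minus nu by auto
  then have lam0: "lam > 0" using lam by linarith
  define d where "d = 2 * \<nu> + 2"
  have d: "d > 0" using nu by (simp add: d_def)
  have dq: "\<nu> * (q + 1) = d" using nu by (simp add: q_def d_def field_simps)
  \<comment> \<open>a point at which \<open>phi (-\<nu>)\<close> is negative\<close>
  define t0 where "t0 = ln (lam / z_minus) / 4"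
  have "1 < lam / z_minus" using lam(1) zm by (metis less_divide_eq_1_pos)
  from ln_gt_zero[OF this] have t0: "t0 > 0" unfolding t0_def by (rule divide_pos_pos) simp
  have phi2: "lin \<nu> lam 0 t0 < 0"
  proof -
    have e: "exp (- ln (lam / z_minus)) = z_minus / lam" using zm lam0 by (simp add: exp_minus)
    have "exp (- ln (lam / z_minus)) < exp (- (2 * t0))" using t0 by (simp add: t0_def)
    from mult_strict_left_mono[OF this lam0]
    have "lam * (z_minus / lam) < lam * exp (- (2 * t0))" unfolding e .
    moreover have "lam * (z_minus / lam) = z_minus" using lam0 by simp
    ultimately have "z_minus < lam * exp (- (2 * t0))" by (simp only:)
    then show ?thesis using phi_minus_neg[OF lam0 lam(2), of t0] t0 by (simp add: lin_def)
  qed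
  have phi: "\<phi> t > 0" if "t \<ge> 0" for t using phi_pos[OF lam0 lam(2) that] .
  \<comment> \<open>constants that do not depend on \<open>\<gamma>\<close>\<close>
  obtain b where b: "b > 0" "\<And>t. t \<ge> 0 \<Longrightarrow> \<phi> t \<ge> b * exp (- (\<nu> * t))"
  proof -
    have "continuous_on {0..lam} (bes \<nu>)"
      using bes_cont(1)[of \<nu>] nu by (auto intro!: continuous_at_imp_continuous_on)
    then obtain x0 where x0: "x0 \<in> {0..lam}" "\<And>x. x \<in> {0..lam} \<Longrightarrow> bes \<nu> x0 \<le> bes \<nu> x"
      using continuous_attains_inf[of "{0..lam}" "bes \<nu>"] lam0 by auto
    have "x0 < z_plus" using x0(1) lam(2) unfolding atLeastAtMost_iff by linarith
    then have "bes \<nu> x0 > 0" using z_plus(3)[of x0] x0(1) nu by auto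
    moreover have "\<phi> t \<ge> bes \<nu> x0 * exp (- (\<nu> * t))" if "t \<ge> 0" for t
    proof -
      have "lam * exp (- (2 * t)) \<le> lam * 1" using that lam0 by (intro mult_left_mono) auto
      then have "bes \<nu> x0 \<le> bes \<nu> (lam * exp (- (2 * t)))" using lam0 by (intro x0(2)) auto
      then show ?thesis unfolding phi_def by (simp add: mult.commute)
    qed
    ultimately show ?thesis by (rule that)
  qed
  obtain C0 where C0: "C0 \<ge> 0" "\<And>t. t \<ge> 0 \<Longrightarrow> \<bar>dmult \<nu> lam 0 t\<bar> \<le> C0 * exp (- (2 * t))"
  proof -
    define h where "h = (\<lambda>y. bes1 \<nu> y * bes (- \<nu>) y + bes \<nu> y * bes1 (- \<nu>) y)"
    have "continuous_on {0..lam} h"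
      unfolding h_def using nu bes_cont by (intro continuous_at_imp_continuous_on ballI continuous_intros) auto
    then have "compact (h ` {0..lam})" by (intro compact_continuous_image) auto
    then obtain B where "\<forall>y\<in>{0..lam}. \<bar>h y\<bar> \<le> B"
      using compact_imp_bounded[THEN bounded_iff[THEN iffD1]] by fastforce
    then have B: "B \<ge> 0" "\<And>y. y \<in> {0..lam} \<Longrightarrow> \<bar>h y\<bar> \<le> B" using lam0 by (force intro: order.trans[OF abs_ge_zero])+
    have "\<bar>dmult \<nu> lam 0 t\<bar> \<le> (2 * lam * B) * exp (- (2 * t))" if "t \<ge> 0" for t
    proof -
      let ?x = "lam * exp (- (2 * t))"
      have "?x \<le> lam * 1" using that lam0 by (intro mult_left_mono) auto
      then have "\<bar>h ?x\<bar> \<le> B" using lam0 by (intro B) auto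
      then have "2 * ?x * \<bar>h ?x\<bar> \<le> 2 * ?x * B" using lam0 by (intro mult_left_mono) auto
      moreover have "\<bar>dmult \<nu> lam 0 t\<bar> = 2 * ?x * \<bar>h ?x\<bar>"
        unfolding dmult_0 h_def using lam0 by (simp add: abs_mult)
      ultimately show ?thesis by (simp add: ac_simps)
    qed
    then show ?thesis using B lam0 by (intro that[of "2 * lam * B"]) auto
  qed
  define K where "K = 1 / 2 + 1 / (q + 1)"
  have K: "K > 0" using q by (simp add: K_def add_pos_pos)
  define C where "C = (8 * \<nu>) powr \<nu>"
  have C: "C > 0" using nu by (simp add: C_def)
  define C1 where "C1 = K * C0 * C powr (3 / 4 * (q + 1)) / (1 - \<nu>)"
  have C1: "C1 \<ge> 0" using K C0 nu by (simp add: C1_def)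
  define c where "c = b * (1 / 2) powr q / d"
  have c: "c > 0" using b d by (simp add: c_def)
  have "((\<lambda>\<gamma>. \<gamma> powr (1 - 1 / \<nu>)) \<longlongrightarrow> 0) at_top"
    using nu by (intro tendsto_neg_powr filterlim_ident) (simp add: field_simps)
  from tendsto_mult[OF tendsto_const this, of "2 * C1 * \<phi> t0"]
  have "((\<lambda>\<gamma>. 2 * C1 * \<phi> t0 * \<gamma> powr (1 - 1 / \<nu>)) \<longlongrightarrow> 0) at_top" by simp
  moreover have "0 < c\<^sup>2 * - lin \<nu> lam 0 t0" using c phi2 by (intro mult_pos_pos) auto
  ultimately have "eventually (\<lambda>\<gamma>. 2 * C1 * \<phi> t0 * \<gamma> powr (1 - 1 / \<nu>) < c\<^sup>2 * - lin \<nu> lam 0 t0) at_top"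
    by (rule order_tendstoD)
  moreover have "eventually (\<lambda>\<gamma>. lam \<le> \<gamma> powr (q - 1)) at_top"
  proof -
    have "filterlim (\<lambda>\<gamma>. \<gamma> powr (q - 1)) at_top at_top" using q by real_asymp
    then show ?thesis by (simp add: filterlim_at_top)
  qed
  moreover have "eventually (\<lambda>\<gamma>. t0 \<le> ln \<gamma> / \<nu>) at_top"
  proof -
    have "filterlim (\<lambda>\<gamma>::real. ln \<gamma> / \<nu>) at_top at_top" using nu by real_asymp
    then show ?thesis by (simp add: filterlim_at_top)
  qed
  ultimately have "eventually (\<lambda>\<gamma>. 2 * C1 * \<phi> t0 * \<gamma> powr (1 - 1 / \<nu>) < c\<^sup>2 * - lin \<nu> lam 0 t0
      \<and> lam \<le> \<gamma> powr (q - 1) \<and> t0 \<le> ln \<gamma> / \<nu>) at_top"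
    by eventually_elim simp
  then obtain \<Gamma> where \<Gamma>: "\<And>\<gamma>. \<gamma> \<ge> \<Gamma> \<Longrightarrow> 2 * C1 * \<phi> t0 * \<gamma> powr (1 - 1 / \<nu>) < c\<^sup>2 * - lin \<nu> lam 0 t0
      \<and> lam \<le> \<gamma> powr (q - 1) \<and> t0 \<le> ln \<gamma> / \<nu>"
    by (auto simp: eventually_at_top_linorder)
  have False
    if \<gamma>\<Gamma>: "\<gamma> \<ge> \<Gamma>" and EF: "emden_fowler \<nu> lam \<gamma> 0 w w1"
      and low: "\<forall>t>0. \<gamma> - (lam * \<gamma> + \<gamma> powr (1 + 2 / \<nu>)) * exp (- (2 * t)) / 4 \<le> exp (\<nu> * t) * w t"
      and up: "\<forall>t>0. exp (\<nu> * t) * w t \<le> \<gamma>"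
      and \<kappa>: "\<kappa> \<ge> \<gamma> powr (1 + 2 / \<nu>) / 4" "((\<lambda>t. exp (2 * t) * (exp (\<nu> * t) * (\<nu> * w t + w1 t))) \<longlongrightarrow> \<kappa>) at_top"
    for \<gamma> w w1 \<kappa>
  proof -
    interpret EF: emden_fowler \<nu> lam \<gamma> 0 w w1 by (rule EF)
    have g: "\<gamma> > 0" by (rule EF.\<gamma>)
    have large: "2 * C1 * \<phi> t0 * \<gamma> powr (1 - 1 / \<nu>) < c\<^sup>2 * - lin \<nu> lam 0 t0"
      "lam \<le> \<gamma> powr (q - 1)" "t0 \<le> ln \<gamma> / \<nu>"
      using \<Gamma>[OF \<gamma>\<Gamma>] by auto
    have gq: "\<gamma> powr q = \<gamma> powr (q - 1) * \<gamma>" using g powr_add[of \<gamma> "q - 1" 1] by simp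
    have wu: "w t = exp (- (\<nu> * t)) * (exp (\<nu> * t) * w t)" for t
      by (simp add: mult.assoc[symmetric] exp_add[symmetric])
    \<comment> \<open>upper bound for \<open>P\<close>: the weight \<open>3 / 4\<close> is large enough to gain a power of \<open>\<gamma>\<close> and small enough
      for \<open>P'\<close> to stay integrable at infinity\<close>
    have w_le: "w t powr (q + 1) \<le> C powr (3 / 4 * (q + 1)) * \<gamma> powr (- (1 + 1 / \<nu>)) * exp (- (1 - \<nu> - 2) * t)"
      if t: "t > 0" for t
    proof -
      define u where "u = exp (\<nu> * t) * w t"
      have u: "0 < u" "u \<le> \<gamma>" "u \<le> C * exp (2 * \<nu> * t) / \<gamma>"
        using up t EF.w_pos[OF t] EF.bubble_bound[OF lam0 t _ \<kappa>(2)] \<kappa>(1) by (auto simp: u_def C_def q_def)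
      have "u = u powr (1 / 4) * u powr (3 / 4)" using u by (simp add: powr_add[symmetric])
      also have "\<dots> \<le> \<gamma> powr (1 / 4) * (C * exp (2 * \<nu> * t) / \<gamma>) powr (3 / 4)"
        using u by (intro mult_mono powr_mono2) auto
      finally have "u powr (q + 1) \<le> (\<gamma> powr (1 / 4) * (C * exp (2 * \<nu> * t) / \<gamma>) powr (3 / 4)) powr (q + 1)"
        using u q by (intro powr_mono2) auto
      also have "\<dots> = C powr (3 / 4 * (q + 1)) * \<gamma> powr (- (1 / 2 * (q + 1))) * exp (3 / 2 * (\<nu> * (q + 1)) * t)"
      proof -
        have "\<gamma> powr (1 / 4) * (C * exp (2 * \<nu> * t) / \<gamma>) powr (3 / 4)
           = exp (ln \<gamma> / 4 + 3 / 4 * (ln C + 2 * \<nu> * t - ln \<gamma>))"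
          using g C by (simp add: powr_def exp_add[symmetric] ln_mult ln_div)
        then have "(\<gamma> powr (1 / 4) * (C * exp (2 * \<nu> * t) / \<gamma>) powr (3 / 4)) powr (q + 1)
           = exp ((q + 1) * (ln \<gamma> / 4 + 3 / 4 * (ln C + 2 * \<nu> * t - ln \<gamma>)))"
          by (simp add: powr_def)
        also have "(q + 1) * (ln \<gamma> / 4 + 3 / 4 * (ln C + 2 * \<nu> * t - ln \<gamma>))
           = 3 / 4 * (q + 1) * ln C + - (1 / 2 * (q + 1)) * ln \<gamma> + 3 / 2 * (\<nu> * (q + 1)) * t"
          by (simp add: algebra_simps)
        also have "exp \<dots> = C powr (3 / 4 * (q + 1)) * \<gamma> powr (- (1 / 2 * (q + 1))) * exp (3 / 2 * (\<nu> * (q + 1)) * t)"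
          unfolding exp_add using g C by (simp add: powr_def)
        finally show ?thesis .
      qed
      finally have u_le: "u powr (q + 1) \<le> C powr (3 / 4 * (q + 1)) * \<gamma> powr (- (1 / 2 * (q + 1))) * exp (3 / 2 * d * t)"
        by (simp only: dq)
      have q2: "1 / 2 * (q + 1) = 1 + 1 / \<nu>" using nu by (simp add: q_def field_simps)
      have "w t powr (q + 1) = exp (- (\<nu> * t)) powr (q + 1) * u powr (q + 1)"
      proof -
        have wt: "w t = exp (- (\<nu> * t)) * u" unfolding u_def by (rule wu)
        show ?thesis by (simp only: wt powr_mult)
      qed
      also have "exp (- (\<nu> * t)) powr (q + 1) = exp (- (\<nu> * (q + 1) * t))"
        by (simp add: powr_def algebra_simps)
      also have "exp (- (\<nu> * (q + 1) * t)) * u powr (q + 1)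
        \<le> exp (- (\<nu> * (q + 1) * t)) * (C powr (3 / 4 * (q + 1)) * \<gamma> powr (- (1 / 2 * (q + 1))) * exp (3 / 2 * d * t))"
        using u_le by (intro mult_left_mono) auto
      also have "\<dots> = C powr (3 / 4 * (q + 1)) * \<gamma> powr (- (1 + 1 / \<nu>)) * (exp (- (d * t)) * exp (3 / 2 * d * t))"
        unfolding dq q2 by (simp add: ac_simps)
      also have "exp (- (d * t)) * exp (3 / 2 * d * t) = exp (- (1 - \<nu> - 2) * t)"
        unfolding exp_add[symmetric] by (simp add: d_def algebra_simps)
      finally show ?thesis .
    qed
    have "\<bar>EF.P 0 t0\<bar> \<le> (K * C0 * (C powr (3 / 4 * (q + 1)) * \<gamma> powr (- (1 + 1 / \<nu>)))) / (1 - \<nu>) * exp (- ((1 - \<nu>) * t0))"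
    proof (rule abs_le_of_deriv_exp_bound[OF EF.DP _ EF.P_lim])
      fix s assume "t0 \<le> s"
      then show s: "s > 0" using t0 by simp
      have "\<bar>(1 / 2 + 1 / (q + 1)) * dmult \<nu> lam 0 s * w s powr (q + 1)\<bar> = K * \<bar>dmult \<nu> lam 0 s\<bar> * w s powr (q + 1)"
        unfolding K_def[symmetric] using K by (simp add: abs_mult)
      also have "\<dots> \<le> K * (C0 * exp (- (2 * s))) * (C powr (3 / 4 * (q + 1)) * \<gamma> powr (- (1 + 1 / \<nu>)) * exp (- (1 - \<nu> - 2) * s))"
        using C0(2)[of s] w_le[OF s] K C0(1) s by (intro mult_mono mult_left_mono) auto
      also have "\<dots> = K * C0 * (C powr (3 / 4 * (q + 1)) * \<gamma> powr (- (1 + 1 / \<nu>))) * (exp (- (2 * s)) * exp (- (1 - \<nu> - 2) * s))"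
        by (simp only: ac_simps)
      also have "exp (- (2 * s)) * exp (- (1 - \<nu> - 2) * s) = exp (- ((1 - \<nu>) * s))"
        unfolding exp_add[symmetric] by (simp add: algebra_simps)
      finally show "\<bar>(1 / 2 + 1 / (q + 1)) * dmult \<nu> lam 0 s * w s powr (q + 1)\<bar>
        \<le> K * C0 * (C powr (3 / 4 * (q + 1)) * \<gamma> powr (- (1 + 1 / \<nu>))) * exp (- ((1 - \<nu>) * s))" .
    qed (use nu in simp)
    also have "\<dots> = C1 * \<gamma> powr (- (1 + 1 / \<nu>)) * exp (- ((1 - \<nu>) * t0))" by (simp add: C1_def)
    also have "\<dots> \<le> C1 * \<gamma> powr (- (1 + 1 / \<nu>)) * 1"
      using C1 nu t0 by (intro mult_left_mono) auto
    finally have P_le: "\<bar>EF.P 0 t0\<bar> \<le> C1 * \<gamma> powr (- (1 + 1 / \<nu>))" by simp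
    \<comment> \<open>lower bound for \<open>N1\<close>: the bubble occupies \<open>t \<ge> ln \<gamma> / \<nu>\<close>, where the solution is at least \<open>\<gamma> / 2\<close>\<close>
    define tg where "tg = ln \<gamma> / \<nu>"
    have tg: "t0 \<le> tg" using large(3) by (simp add: tg_def)
    have half: "\<gamma> / 2 \<le> exp (\<nu> * s) * w s" if s: "s \<ge> tg" for s
    proof -
      have "exp (- (2 * s)) \<le> exp (- (2 * tg))" using s by simp
      also have "exp (- (2 * tg)) = \<gamma> powr (- (q - 1))" using g by (simp add: tg_def powr_def q_def)
      finally have e: "exp (- (2 * s)) \<le> \<gamma> powr (- (q - 1))" .
      have "lam * \<gamma> + \<gamma> powr q \<le> 2 * (\<gamma> powr (q - 1) * \<gamma>)"
        using large(2) g by (simp add: gq mult_right_mono)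
      then have "(lam * \<gamma> + \<gamma> powr q) * exp (- (2 * s)) \<le> (2 * (\<gamma> powr (q - 1) * \<gamma>)) * \<gamma> powr (- (q - 1))"
        using e lam0 g by (intro mult_mono) auto
      also have "\<dots> = 2 * \<gamma> * (\<gamma> powr (q - 1) * \<gamma> powr (- (q - 1)))" by (simp only: ac_simps)
      also have "\<gamma> powr (q - 1) * \<gamma> powr (- (q - 1)) = 1" using g by (simp add: powr_add[symmetric])
      finally have "(lam * \<gamma> + \<gamma> powr q) * exp (- (2 * s)) / 4 \<le> \<gamma> / 2" by linarith
      moreover have "s > 0" using s tg t0 by simp
      then have "\<gamma> - (lam * \<gamma> + \<gamma> powr q) * exp (- (2 * s)) / 4 \<le> exp (\<nu> * s) * w s"
        using low unfolding q_def by blast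
      ultimately show ?thesis by linarith
    qed
    have N_low: "c * (\<gamma> powr q * exp (- (d * tg))) \<le> EF.N1 tg"
    proof -
      have "0 \<le> EF.N1 tg - c * \<gamma> powr q * exp (- (d * tg))"
      proof (rule antimono_ge_limit[where f = "\<lambda>s. EF.N1 s - c * \<gamma> powr q * exp (- (d * s))"
            and f' = "\<lambda>s. - (w s powr q * \<phi> s) - c * \<gamma> powr q * (exp (- (d * s)) * - d)"])
        fix s assume s: "tg \<le> s"
        then have s0: "s > 0" using tg t0 by simp
        show "((\<lambda>s. EF.N1 s - c * \<gamma> powr q * exp (- (d * s))) has_real_derivative
           - (w s powr q * \<phi> s) - c * \<gamma> powr q * (exp (- (d * s)) * - d)) (at s)"
          by (intro DERIV_diff DERIV_cmult EF.DN1 s0) (auto intro!: derivative_eq_intros)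
        have ed: "exp (- (d * s)) = exp (- (\<nu> * s)) powr q * exp (- (\<nu> * s))"
          unfolding dq[symmetric] by (simp add: powr_def exp_add[symmetric] algebra_simps)
        have "c * \<gamma> powr q * (exp (- (d * s)) * d) = b * ((\<gamma> / 2) powr q * exp (- (d * s)))"
          using d g by (simp add: c_def powr_divide)
        also have "b * ((\<gamma> / 2) powr q * exp (- (d * s)))
          = (exp (- (\<nu> * s)) * (\<gamma> / 2)) powr q * (b * exp (- (\<nu> * s)))"
          unfolding ed powr_mult by (simp only: ac_simps)
        also have "\<dots> \<le> w s powr q * \<phi> s"
        proof (intro mult_mono powr_mono2)
          have "exp (- (\<nu> * s)) * (\<gamma> / 2) \<le> exp (- (\<nu> * s)) * (exp (\<nu> * s) * w s)"
            using half[OF s] by (intro mult_left_mono) auto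
          then show "exp (- (\<nu> * s)) * (\<gamma> / 2) \<le> w s" using wu[of s] by simp
        qed (use q g b s0 in auto)
        finally show "- (w s powr q * \<phi> s) - c * \<gamma> powr q * (exp (- (d * s)) * - d) \<le> 0" by simp
      next
        have e: "((\<lambda>s. exp (- (d * s))) \<longlongrightarrow> 0) at_top" using d by real_asymp
        show "((\<lambda>s. EF.N1 s - c * \<gamma> powr q * exp (- (d * s))) \<longlongrightarrow> 0) at_top"
          using tendsto_diff[OF EF.N_lims(1) tendsto_mult[OF tendsto_const e, of "c * \<gamma> powr q"]] by simp
      qed
      then show ?thesis by simp
    qed
    have "\<gamma> powr q * exp (- (d * tg)) = \<gamma> powr (- 1)"
    proof -
      have "exp (- (d * tg)) = \<gamma> powr (- (q + 1))"
        using nu g unfolding dq[symmetric] by (simp add: tg_def powr_def algebra_simps)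
      then show ?thesis by (simp add: powr_add[symmetric])
    qed
    moreover have "EF.N1 tg \<le> EF.N1 t0"
      using tg t0 phi by (intro EF.N1_antimono) (auto simp: less_imp_le)
    ultimately have N1: "c * \<gamma> powr (- 1) \<le> EF.N1 t0" using N_low by simp
    have N1pos: "EF.N1 t0 > 0" using N1 c g by (smt (verit) mult_pos_pos powr_gt_zero)
    \<comment> \<open>\<open>w\<close> in terms of its two Wronskians; the first term is negative\<close>
    have "EF.N1 t0 * lin \<nu> lam 0 t0 - EF.N2 0 t0 * \<phi> t0 = w t0 * (2 * \<nu>)"
      unfolding wronskian[of t0 0, symmetric] EF.N1_def EF.N2_def by (simp add: algebra_simps)
    moreover have "w t0 * (2 * \<nu>) > 0" using EF.w_pos[OF t0] nu by simp
    ultimately have "EF.N2 0 t0 * \<phi> t0 < EF.N1 t0 * lin \<nu> lam 0 t0" by linarith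
    then have "EF.N1 t0 * (EF.N2 0 t0 * \<phi> t0) < EF.N1 t0 * (EF.N1 t0 * lin \<nu> lam 0 t0)"
      using N1pos by (intro mult_strict_left_mono)
    then have 1: "(EF.N1 t0)\<^sup>2 * - lin \<nu> lam 0 t0 < - (EF.N1 t0 * EF.N2 0 t0) * \<phi> t0"
      by (simp add: power2_eq_square algebra_simps)
    have "\<phi> t0 * lin \<nu> lam 0 t0 * (w t0 powr (q + 1) / (q + 1)) \<le> 0"
      using phi[of t0] phi2 t0 q by (intro mult_nonpos_nonneg mult_nonneg_nonpos) auto
    then have "EF.P 0 t0 \<le> EF.N1 t0 * EF.N2 0 t0 / 2"
      unfolding EF.P_def by linarith
    then have "- (EF.N1 t0 * EF.N2 0 t0) \<le> 2 * \<bar>EF.P 0 t0\<bar>"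
      by linarith
    also have "\<dots> \<le> 2 * (C1 * \<gamma> powr (- (1 + 1 / \<nu>)))" using P_le by simp
    finally have 2: "- (EF.N1 t0 * EF.N2 0 t0) * \<phi> t0 \<le> 2 * (C1 * \<gamma> powr (- (1 + 1 / \<nu>))) * \<phi> t0"
      using phi[of t0] t0 by (intro mult_right_mono) auto
    have "(c * \<gamma> powr (- 1))\<^sup>2 \<le> (EF.N1 t0)\<^sup>2" using N1 c by (intro power_mono) auto
    then have 3: "(c * \<gamma> powr (- 1))\<^sup>2 * - lin \<nu> lam 0 t0 \<le> (EF.N1 t0)\<^sup>2 * - lin \<nu> lam 0 t0"
      using phi2 by (intro mult_right_mono) auto
    have 4: "(c * \<gamma> powr (- 1))\<^sup>2 = c\<^sup>2 * \<gamma> powr (- 2)"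
    proof -
      have "\<gamma> powr (- 1) * \<gamma> powr (- 1) = \<gamma> powr (- 2)" by (simp only: powr_add[symmetric]) simp
      moreover have "(c * x)\<^sup>2 = c\<^sup>2 * (x * x)" for x by (simp add: power2_eq_square)
      ultimately show ?thesis by (simp only:)
    qed
    have "c\<^sup>2 * \<gamma> powr (- 2) * - lin \<nu> lam 0 t0 < 2 * (C1 * \<gamma> powr (- (1 + 1 / \<nu>))) * \<phi> t0"
      using le_less_trans[OF 3 less_le_trans[OF 1 2]] unfolding 4 .
    then have A: "\<gamma> powr 2 * (c\<^sup>2 * \<gamma> powr (- 2) * - lin \<nu> lam 0 t0) < \<gamma> powr 2 * (2 * (C1 * \<gamma> powr (- (1 + 1 / \<nu>))) * \<phi> t0)"
      using g by (intro mult_strict_left_mono) auto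
    have B: "\<gamma> powr 2 * (c\<^sup>2 * \<gamma> powr (- 2) * - lin \<nu> lam 0 t0) = (\<gamma> powr 2 * \<gamma> powr (- 2)) * (c\<^sup>2 * - lin \<nu> lam 0 t0)"
      by (simp only: ac_simps)
    have D: "\<gamma> powr 2 * \<gamma> powr (- 2) = 1" using g by (simp only: powr_add[symmetric]) simp
    have E: "\<gamma> powr 2 * (2 * (C1 * \<gamma> powr (- (1 + 1 / \<nu>))) * \<phi> t0) = 2 * C1 * \<phi> t0 * (\<gamma> powr 2 * \<gamma> powr (- (1 + 1 / \<nu>)))"
      by (simp only: ac_simps)
    have F: "\<gamma> powr 2 * \<gamma> powr (- (1 + 1 / \<nu>)) = \<gamma> powr (1 - 1 / \<nu>)"
      by (simp only: powr_add[symmetric]) simp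
    show False using A large(1) unfolding B D E F by simp
  qed
  then show ?thesis by blast
qed

section \<open>The radial initial value problem\<close>

text \<open>A solution of \<open>4 y G'' + 4 (\<nu> + 1) G' + g(G) = 0\<close> that is regular at \<open>y = 0\<close> satisfies
  \<open>y\<^sup>\<nu>\<^sup>+\<^sup>1 G' = - \<integral>\<^sub>0\<^sup>y s\<^sup>\<nu> g(G s) ds / 4\<close>, and the substitution \<open>s = y \<sigma>\<close> gives \<open>G' = - avg \<nu> (g \<circ> G) / 4\<close>. In this
  form the equation is regular at \<open>y = 0\<close> and makes sense for negative \<open>y\<close>, too.\<close>

definition avg :: "real \<Rightarrow> (real \<Rightarrow> real) \<Rightarrow> real \<Rightarrow> real" where
  "avg s h x = integral {0..1} (\<lambda>\<sigma>. \<sigma> powr s * h (x * \<sigma>))"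

lemma mult_unit_interval_in_convex:
  fixes J :: "real set"
  assumes "convex J" "0 \<in> J" "x \<in> J" "0 \<le> \<sigma>" "\<sigma> \<le> 1"
  shows "x * \<sigma> \<in> J"
  using convexD[OF assms(1,3,2), of \<sigma> "1 - \<sigma>"] assms(4,5) by (simp add: mult.commute)

lemma avg_integrand_continuous:
  fixes s x :: real and h :: "real \<Rightarrow> real"
  assumes s: "s > 0" and J: "convex J" "0 \<in> J" "x \<in> J" and h: "continuous_on J h"
  shows "continuous_on {0..1} (\<lambda>\<sigma>. \<sigma> powr s * h (x * \<sigma>))"
proof (rule continuous_on_mult)
  show "continuous_on {0..1} (\<lambda>\<sigma>. \<sigma> powr s)"
    using s by (intro continuous_on_powr') (auto intro!: continuous_intros)
  show "continuous_on {0..1} (\<lambda>\<sigma>. h (x * \<sigma>))"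
    using mult_unit_interval_in_convex[OF J]
    by (intro continuous_on_compose2[OF h]) (auto intro!: continuous_intros)
qed

lemma avg_integrable:
  fixes s x :: real and h :: "real \<Rightarrow> real"
  assumes "s > 0" "convex J" "0 \<in> J" "x \<in> J" "continuous_on J h"
  shows "(\<lambda>\<sigma>. \<sigma> powr s * h (x * \<sigma>)) integrable_on {0..1}"
  using avg_integrand_continuous[OF assms] by (rule integrable_continuous_real)

lemma continuous_on_avg:
  assumes s: "s > 0" and J: "convex J" "0 \<in> J" and h: "continuous_on J h"
  shows "continuous_on J (avg s h)"
proof -
  have "continuous_on (J \<times> cbox 0 1) (\<lambda>(x, \<sigma>). \<sigma> powr s * h (x * \<sigma>))"
    unfolding split_beta
  proof (rule continuous_on_mult)
    show "continuous_on (J \<times> cbox 0 1) (\<lambda>p. snd p powr s)"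
      using s by (intro continuous_on_powr') (auto intro!: continuous_intros)
    show "continuous_on (J \<times> cbox 0 1) (\<lambda>p. h (fst p * snd p))"
      using mult_unit_interval_in_convex[OF J]
      by (intro continuous_on_compose2[OF h]) (auto intro!: continuous_intros)
  qed
  from integral_continuous_on_param[OF this] show ?thesis
    unfolding avg_def by (simp add: cbox_interval)
qed

lemma DERIV_avg:
  assumes s: "s > 0" and J: "open J" "convex J" "0 \<in> J" "x \<in> J"
    and h: "\<And>y. y \<in> J \<Longrightarrow> (h has_real_derivative h' y) (at y)" and h': "continuous_on J h'"
  shows "(avg s h has_real_derivative avg (s + 1) h' x) (at x)"
proof -
  have hc: "continuous_on J h"
    using h by (auto intro!: continuous_at_imp_continuous_on DERIV_isCont)
  have "((\<lambda>x. integral (cbox 0 1) (\<lambda>\<sigma>. \<sigma> powr s * h (x * \<sigma>))) has_real_derivative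
      integral (cbox 0 1) (\<lambda>\<sigma>. \<sigma> powr (s + 1) * h' (x * \<sigma>))) (at x within J)"
  proof (rule leibniz_rule_field_derivative)
    fix x \<sigma> :: real assume x: "x \<in> J" and \<sigma>: "\<sigma> \<in> cbox 0 1"
    then have xs: "x * \<sigma> \<in> J" using mult_unit_interval_in_convex[OF J(2,3)] by auto
    have "((\<lambda>x. x * \<sigma>) has_real_derivative \<sigma>) (at x)" by (auto intro!: derivative_eq_intros)
    from DERIV_cmult[OF DERIV_chain2[OF h[OF xs] this], of "\<sigma> powr s"]
    have "((\<lambda>x. \<sigma> powr s * h (x * \<sigma>)) has_real_derivative \<sigma> powr s * (h' (x * \<sigma>) * \<sigma>)) (at x)" .
    moreover have "\<sigma> powr s * (h' (x * \<sigma>) * \<sigma>) = \<sigma> powr (s + 1) * h' (x * \<sigma>)"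
      using \<sigma> by (simp add: powr_add)
    ultimately show "((\<lambda>x. \<sigma> powr s * h (x * \<sigma>)) has_real_derivative \<sigma> powr (s + 1) * h' (x * \<sigma>)) (at x within J)"
      by (simp add: has_field_derivative_at_within)
  next
    fix x assume "x \<in> J"
    then show "(\<lambda>\<sigma>. \<sigma> powr s * h (x * \<sigma>)) integrable_on cbox 0 1"
      using avg_integrable[OF s J(2,3) _ hc] by (simp add: cbox_interval)
  next
    show "continuous_on (J \<times> cbox 0 1) (\<lambda>(x, \<sigma>). \<sigma> powr (s + 1) * h' (x * \<sigma>))"
      unfolding split_beta
    proof (rule continuous_on_mult)
      show "continuous_on (J \<times> cbox 0 1) (\<lambda>p. snd p powr (s + 1))"
        using s by (intro continuous_on_powr') (auto intro!: continuous_intros)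
      show "continuous_on (J \<times> cbox 0 1) (\<lambda>p. h' (fst p * snd p))"
        using mult_unit_interval_in_convex[OF J(2,3)]
        by (intro continuous_on_compose2[OF h']) (auto intro!: continuous_intros)
    qed
  qed (use J in auto)
  then show ?thesis
    unfolding avg_def at_within_open[OF J(4,1)] by (simp only: cbox_interval)
qed

lemma Ck_on_avg:
  assumes J: "open J" "convex J" "0 \<in> J"
  shows "s > 0 \<Longrightarrow> Ck_on k J h \<Longrightarrow> Ck_on k J (avg s h)"
proof (induction k arbitrary: s h)
  case 0
  then show ?case using continuous_on_avg[OF _ J(2,3)] by simp
next
  case (Suc k)
  note h = Ck_on_real_SucD[OF Suc.prems(2)]
  have "continuous_on J (partial_deriv 1 h)"
  proof -
    have "Ck_on 0 J (partial_deriv 1 h)" using h(2) by (induction k) (auto dest: Ck_on_Suc_imp simp del: Ck_on.simps(2))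
    then show ?thesis by simp
  qed
  note d = DERIV_avg[OF Suc.prems(1) J _ h(1) this]
  have "Ck_on k J (avg (s + 1) (partial_deriv 1 h))"
    using Suc.prems(1) h(2) by (intro Suc.IH) auto
  then show ?case using d by (intro Ck_on_real_SucI[OF J(1)])
qed

text \<open>The left-hand side is the integral over \<open>[0, 1]\<close> of the derivative of \<open>\<sigma>\<^sup>s\<^sup>+\<^sup>1 h(x \<sigma>)\<close>. The identity
  turns the averaged equation back into the differential equation.\<close>

lemma avg_euler:
  assumes s: "s > 0" and J: "open J" "convex J" "0 \<in> J" "x \<in> J"
    and h: "\<And>y. y \<in> J \<Longrightarrow> (h has_real_derivative h' y) (at y)" and h': "continuous_on J h'"
  shows "x * avg (s + 1) h' x + (s + 1) * avg s h x = h x"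
proof -
  have hc: "continuous_on J h"
    using h by (auto intro!: continuous_at_imp_continuous_on DERIV_isCont)
  have "((\<lambda>\<sigma>. (s + 1) * (\<sigma> powr s * h (x * \<sigma>)) + x * (\<sigma> powr (s + 1) * h' (x * \<sigma>))) has_integral
      (1 powr (s + 1) * h (x * 1) - 0 powr (s + 1) * h (x * 0))) {0..1}"
  proof (rule fundamental_theorem_of_calculus_interior[where f = "\<lambda>\<sigma>. \<sigma> powr (s + 1) * h (x * \<sigma>)"])
    show "continuous_on {0..1} (\<lambda>\<sigma>. \<sigma> powr (s + 1) * h (x * \<sigma>))"
      using s by (intro avg_integrand_continuous[of _ J] J hc) auto
    fix \<sigma> :: real assume \<sigma>: "\<sigma> \<in> {0<..<1}"
    then have xs: "x * \<sigma> \<in> J" using mult_unit_interval_in_convex[OF J(2,3,4)] by auto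
    have "((\<lambda>\<sigma>. x * \<sigma>) has_real_derivative x) (at \<sigma>)" by (auto intro!: derivative_eq_intros)
    note c = DERIV_chain2[OF h[OF xs] this]
    have "((\<lambda>\<sigma>. \<sigma> powr (s + 1)) has_real_derivative (s + 1) * \<sigma> powr s) (at \<sigma>)"
      using \<sigma> by (auto intro!: derivative_eq_intros)
    from DERIV_mult[OF this c]
    have "((\<lambda>\<sigma>. \<sigma> powr (s + 1) * h (x * \<sigma>)) has_real_derivative
       ((s + 1) * (\<sigma> powr s * h (x * \<sigma>)) + x * (\<sigma> powr (s + 1) * h' (x * \<sigma>)))) (at \<sigma>)"
      by (simp add: ac_simps)
    then show "((\<lambda>\<sigma>. \<sigma> powr (s + 1) * h (x * \<sigma>)) has_vector_derivative
       ((s + 1) * (\<sigma> powr s * h (x * \<sigma>)) + x * (\<sigma> powr (s + 1) * h' (x * \<sigma>)))) (at \<sigma>)"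
      by (simp add: has_real_derivative_iff_has_vector_derivative)
  qed simp
  then have 1: "((\<lambda>\<sigma>. (s + 1) * (\<sigma> powr s * h (x * \<sigma>)) + x * (\<sigma> powr (s + 1) * h' (x * \<sigma>))) has_integral h x) {0..1}"
    using s by simp
  have "((\<lambda>\<sigma>. \<sigma> powr s * h (x * \<sigma>)) has_integral avg s h x) {0..1}"
    "((\<lambda>\<sigma>. \<sigma> powr (s + 1) * h' (x * \<sigma>)) has_integral avg (s + 1) h' x) {0..1}"
    unfolding avg_def using s avg_integrable[OF _ J(2-4)] hc h' by (auto intro!: integrable_integral)
  from has_integral_add[OF has_integral_mult_right[OF this(1), of "s + 1"] has_integral_mult_right[OF this(2), of x]]
  have "((\<lambda>\<sigma>. (s + 1) * (\<sigma> powr s * h (x * \<sigma>)) + x * (\<sigma> powr (s + 1) * h' (x * \<sigma>)))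
    has_integral ((s + 1) * avg s h x + x * avg (s + 1) h' x)) {0..1}" .
  from has_integral_unique[OF this 1] show ?thesis by simp
qed

lemma avg_le:
  assumes s: "s > 0" and h: "continuous_on UNIV h" "\<And>\<sigma>. 0 \<le> \<sigma> \<Longrightarrow> \<sigma> \<le> 1 \<Longrightarrow> \<bar>h (x * \<sigma>)\<bar> \<le> M"
  shows "\<bar>avg s h x\<bar> \<le> M"
proof -
  have M: "M \<ge> 0" using h(2)[of 0] by simp
  have "norm (integral {0..1} (\<lambda>\<sigma>. \<sigma> powr s * h (x * \<sigma>))) \<le> M * (1 - 0)"
  proof (rule integral_bound)
    show "continuous_on {0..1} (\<lambda>\<sigma>. \<sigma> powr s * h (x * \<sigma>))"
      using s h(1) by (intro avg_integrand_continuous[of s UNIV]) auto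
    fix \<sigma> :: real assume \<sigma>: "\<sigma> \<in> {0..1}"
    have "\<sigma> powr s * \<bar>h (x * \<sigma>)\<bar> \<le> 1 * M"
      using \<sigma> h(2)[of \<sigma>] M s by (intro mult_mono powr_le1) auto
    then show "norm (\<sigma> powr s * h (x * \<sigma>)) \<le> M" by (simp add: abs_mult)
  qed simp
  then show ?thesis by (simp add: avg_def)
qed

lemma avg_diff:
  assumes "s > 0" "continuous_on UNIV h" "continuous_on UNIV k"
  shows "avg s h x - avg s k x = avg s (\<lambda>y. h y - k y) x"
  unfolding avg_def right_diff_distrib
  using assms by (intro integral_diff[symmetric] avg_integrable[of s UNIV]) auto

text \<open>The solutions for all initial values are obtained at once, as fixed points of a contraction in a
  supremum norm with the weight \<open>e\<^sup>-\<^sup>L\<^sup>|\<^sup>x\<^sup>|\<close>, which makes the Lipschitz constant \<open>1 / 4\<close>. Fixed points of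
  uniform contractions depend continuously on the parameter \<open>\<gamma>\<close>. The interval extends beyond \<open>[0, 1]\<close>
  to provide two-sided derivatives at both of its ends.\<close>

lemma radial_ivp:
  assumes s: "s > 0" and g: "\<And>a b. \<bar>g a - g b\<bar> \<le> L * \<bar>a - b\<bar>" and L: "L > 0"
  shows "\<exists>G :: real \<Rightarrow> real \<Rightarrow> real. (\<forall>\<gamma>. G \<gamma> 0 = \<gamma> \<and> continuous_on UNIV (G \<gamma>) \<and>
      (\<forall>x\<in>{-1<..<2}. (G \<gamma> has_real_derivative - avg s (\<lambda>y. g (G \<gamma> y)) x / 4) (at x))) \<and>
    continuous_on UNIV (\<lambda>\<gamma>. G \<gamma> 1)"
proof -
  have gc: "continuous_on UNIV g"
  proof (rule continuous_onI)
    fix x e :: real assume e: "e > 0"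
    have "dist (g y) (g x) < e" if "dist y x < e / L" for y
    proof -
      have "L * \<bar>y - x\<bar> < e" using that L by (simp add: dist_real_def field_simps)
      then show ?thesis using g[of y x] by (simp add: dist_real_def)
    qed
    then show "\<exists>d>0. \<forall>x'\<in>UNIV. dist x' x < d \<longrightarrow> dist (g x') (g x) \<le> e"
      using e L by (intro exI[of _ "e / L"]) (auto intro: less_imp_le)
  qed
  define wt where "wt = (\<lambda>x::real. exp (L * \<bar>x\<bar>))"
  have wt: "wt x > 0" "wt x \<ge> 1" for x using L by (auto simp: wt_def)
  have wtc: "continuous_on S wt" for S unfolding wt_def by (intro continuous_intros)
  define h where "h = (\<lambda>(H :: real \<Rightarrow>\<^sub>C real) y. g (wt y * apply_bcontfun H y))"
  have hc: "continuous_on S (h H)" for S H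
    unfolding h_def by (intro continuous_on_compose2[OF gc] continuous_on_mult wtc) auto
  have ac: "continuous_on S (avg s (h H))" for S H
    using continuous_on_avg[OF s convex_UNIV UNIV_I hc] by (rule continuous_on_subset) simp
  define I where "I = (\<lambda>H x. integral {-1..x} (avg s (h H)))"
  have DI: "(I H has_real_derivative avg s (h H) x) (at x within {-1..2})" if "x \<in> {-1..2}" for H x
    unfolding I_def by (rule integral_has_real_derivative[OF ac that])
  have Ic: "continuous_on {-1..2} (I H)" for H
    using DI by (meson DERIV_continuous_on)
  define cl where "cl = (\<lambda>x::real. max (-1) (min 2 x))"
  have cl: "cl x \<in> {-1..2}" "continuous_on S cl" for x S
    unfolding cl_def by (auto intro!: continuous_intros)
  have cl_id: "cl x = x" if "x \<in> {-1..2}" for x using that by (auto simp: cl_def)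
  define \<Psi>0 where "\<Psi>0 = (\<lambda>\<gamma> H x. (\<gamma> - (I H x - I H 0) / 4) / wt x)"
  have \<Psi>0c: "continuous_on {-1..2} (\<Psi>0 \<gamma> H)" for \<gamma> H
    unfolding \<Psi>0_def using wt by (intro continuous_intros Ic wtc) (auto simp: less_imp_neq[symmetric])
  have bc: "(\<lambda>x. \<Psi>0 \<gamma> H (cl x)) \<in> bcontfun" for \<gamma> H
  proof -
    have "compact (\<Psi>0 \<gamma> H ` {-1..2})" by (intro compact_continuous_image \<Psi>0c) simp
    then have "bounded (range (\<lambda>x. \<Psi>0 \<gamma> H (cl x)))"
      by (rule compact_imp_bounded[THEN bounded_subset]) (use cl in auto)
    moreover have "continuous_on UNIV (\<lambda>x. \<Psi>0 \<gamma> H (cl x))"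
      using cl by (intro continuous_on_compose2[OF \<Psi>0c]) auto
    ultimately show ?thesis by (simp add: bcontfun_def)
  qed
  define \<Psi> where "\<Psi> = (\<lambda>\<gamma> H. Bcontfun (\<lambda>x. \<Psi>0 \<gamma> H (cl x)))"
  have \<Psi>: "apply_bcontfun (\<Psi> \<gamma> H) x = \<Psi>0 \<gamma> H (cl x)" for \<gamma> H x
    unfolding \<Psi>_def by (simp add: Bcontfun_inverse[OF bc])
  have h_diff: "\<bar>h H y - h K y\<bar> \<le> L * dist H K * wt y" for H K y
  proof -
    have "\<bar>h H y - h K y\<bar> \<le> L * \<bar>wt y * H y - wt y * K y\<bar>" unfolding h_def by (rule g)
    also have "\<bar>wt y * H y - wt y * K y\<bar> = wt y * dist (H y) (K y)"
      using wt(1)[of y] by (simp add: dist_real_def right_diff_distrib[symmetric] abs_mult)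
    also have "wt y * dist (H y) (K y) \<le> wt y * dist H K"
      using dist_bounded[of H y K] wt(1)[of y] by (intro mult_left_mono) auto
    finally show ?thesis using L by (simp add: ac_simps)
  qed
  have a_diff: "\<bar>avg s (h H) y - avg s (h K) y\<bar> \<le> L * dist H K * wt y" for H K y
    unfolding avg_diff[OF s hc hc]
  proof (rule avg_le[OF s])
    show "continuous_on UNIV (\<lambda>y. h H y - h K y)" by (intro continuous_intros hc)
    fix \<sigma> :: real assume \<sigma>: "0 \<le> \<sigma>" "\<sigma> \<le> 1"
    have "\<bar>y * \<sigma>\<bar> \<le> \<bar>y\<bar> * 1" unfolding abs_mult using \<sigma> by (intro mult_left_mono) auto
    then have "wt (y * \<sigma>) \<le> wt y" using L by (simp add: wt_def)
    then have "L * dist H K * wt (y * \<sigma>) \<le> L * dist H K * wt y" using L by (intro mult_left_mono) auto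
    then show "\<bar>h H (y * \<sigma>) - h K (y * \<sigma>)\<bar> \<le> L * dist H K * wt y"
      using h_diff[of H "y * \<sigma>" K] by linarith
  qed
  have I_diff: "\<bar>(I H x - I H 0) - (I K x - I K 0)\<bar> \<le> dist H K * wt x" if x: "x \<in> {-1..2}" for H K x
  proof -
    define D where "D = (\<lambda>y. I H y - I K y)"
    have DD: "(D has_real_derivative (avg s (h H) y - avg s (h K) y)) (at y within {-1..2})" if "y \<in> {-1..2}" for y
      unfolding D_def by (intro DERIV_diff DI that)
    have Dc: "continuous_on S D" if "S \<subseteq> {-1..2}" for S
      unfolding D_def using that by (intro continuous_intros continuous_on_subset[OF Ic])
    have DD': "(D has_real_derivative (avg s (h H) y - avg s (h K) y)) (at y)" if "y \<in> {-1<..<2}" for y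
      using DD[of y] that at_within_Icc_at[of "-1" y 2] by simp
    let ?C = "dist H K"
    \<comment> \<open>compare with the primitive \<open>dist H K e\<^sup>L\<^sup>|\<^sup>y\<^sup>|\<close> of the bound, on either side of \<open>0\<close>\<close>
    have pos: "\<bar>D x - D 0\<bar> \<le> ?C * (exp (L * x) - 1)" if "0 \<le> x"
    proof -
      have "?C * exp (L * 0) + \<tau> * D 0 \<le> ?C * exp (L * x) + \<tau> * D x" if \<tau>: "\<bar>\<tau>\<bar> = 1" for \<tau> :: real
      proof (rule DERIV_nonneg_imp_increasing_open[OF \<open>0 \<le> x\<close>, of "\<lambda>y. ?C * exp (L * y) + \<tau> * D y"])
        fix y assume y: "0 < y" "y < x"
        have yi: "y \<in> {-1<..<2}" using y x by auto
        have e: "((\<lambda>y. ?C * exp (L * y)) has_real_derivative ?C * (exp (L * y) * L)) (at y)"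
          by (auto intro!: derivative_eq_intros)
        have "\<bar>\<tau> * (avg s (h H) y - avg s (h K) y)\<bar> \<le> L * ?C * wt y"
          using a_diff[of H y K] \<tau> by (simp add: abs_mult)
        then have "0 \<le> ?C * (exp (L * y) * L) + \<tau> * (avg s (h H) y - avg s (h K) y)"
          using y by (simp add: wt_def ac_simps abs_le_iff)
        then show "\<exists>z. ((\<lambda>y. ?C * exp (L * y) + \<tau> * D y) has_real_derivative z) (at y) \<and> 0 \<le> z"
          using DERIV_add[OF e DERIV_cmult[OF DD'[OF yi], of \<tau>]] by blast
      next
        show "continuous_on {0..x} (\<lambda>y. ?C * exp (L * y) + \<tau> * D y)"
          using x by (intro continuous_intros Dc) auto
      qed
      from this[of 1] this[of "-1"] show ?thesis by (simp add: abs_le_iff right_diff_distrib)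
    qed
    have neg: "\<bar>D x - D 0\<bar> \<le> ?C * (exp (- (L * x)) - 1)" if "x \<le> 0"
    proof -
      have "?C * exp (- (L * 0)) + \<tau> * D 0 \<le> ?C * exp (- (L * x)) + \<tau> * D x" if \<tau>: "\<bar>\<tau>\<bar> = 1" for \<tau> :: real
      proof (rule DERIV_nonpos_imp_decreasing_open[OF \<open>x \<le> 0\<close>, of "\<lambda>y. ?C * exp (- (L * y)) + \<tau> * D y"])
        fix y assume y: "x < y" "y < 0"
        have yi: "y \<in> {-1<..<2}" using y x by auto
        have e: "((\<lambda>y. ?C * exp (- (L * y))) has_real_derivative ?C * (exp (- (L * y)) * - L)) (at y)"
          by (auto intro!: derivative_eq_intros)
        have "\<bar>\<tau> * (avg s (h H) y - avg s (h K) y)\<bar> \<le> L * ?C * wt y"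
          using a_diff[of H y K] \<tau> by (simp add: abs_mult)
        then have "?C * (exp (- (L * y)) * - L) + \<tau> * (avg s (h H) y - avg s (h K) y) \<le> 0"
          using y by (simp add: wt_def ac_simps abs_le_iff)
        then show "\<exists>z. ((\<lambda>y. ?C * exp (- (L * y)) + \<tau> * D y) has_real_derivative z) (at y) \<and> z \<le> 0"
          using DERIV_add[OF e DERIV_cmult[OF DD'[OF yi], of \<tau>]] by blast
      next
        show "continuous_on {x..0} (\<lambda>y. ?C * exp (- (L * y)) + \<tau> * D y)"
          using x by (intro continuous_intros Dc) auto
      qed
      from this[of 1] this[of "-1"] show ?thesis by (simp add: abs_le_iff right_diff_distrib)
    qed
    have "\<bar>D x - D 0\<bar> \<le> ?C * (wt x - 1)"
      using pos neg by (cases "0 \<le> x") (auto simp: wt_def)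
    also have "\<dots> \<le> ?C * wt x" by (intro mult_left_mono) auto
    finally show ?thesis by (simp add: D_def algebra_simps)
  qed
  have \<Psi>_diff: "dist (\<Psi> \<gamma> H) (\<Psi> \<gamma>' K) \<le> 1 / 4 * dist H K + \<bar>\<gamma> - \<gamma>'\<bar>" for \<gamma> \<gamma>' H K
  proof (rule dist_bound)
    fix x
    let ?y = "cl x"
    let ?d = "(I H ?y - I H 0) - (I K ?y - I K 0)"
    have "dist (\<Psi> \<gamma> H x) (\<Psi> \<gamma>' K x) = \<bar>(\<gamma> - \<gamma>') - ?d / 4\<bar> / wt ?y"
    proof -
      have "\<Psi> \<gamma> H x - \<Psi> \<gamma>' K x = ((\<gamma> - \<gamma>') - ?d / 4) / wt ?y"
        unfolding \<Psi> \<Psi>0_def by (simp add: diff_divide_distrib)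
      then show ?thesis using wt(1)[of ?y] by (simp add: dist_real_def)
    qed
    also have "\<dots> \<le> (\<bar>\<gamma> - \<gamma>'\<bar> * wt ?y + dist H K * wt ?y / 4) / wt ?y"
    proof (intro divide_right_mono)
      have "\<bar>\<gamma> - \<gamma>'\<bar> * 1 \<le> \<bar>\<gamma> - \<gamma>'\<bar> * wt ?y" using wt by (intro mult_left_mono) auto
      moreover have "\<bar>?d / 4\<bar> \<le> dist H K * wt ?y / 4"
        using I_diff[OF cl(1), of H x K] by (simp only: abs_divide) simp
      ultimately have "\<bar>\<gamma> - \<gamma>'\<bar> * 1 + \<bar>?d / 4\<bar> \<le> \<bar>\<gamma> - \<gamma>'\<bar> * wt ?y + dist H K * wt ?y / 4"
        by (rule add_mono)
      then show "\<bar>(\<gamma> - \<gamma>') - ?d / 4\<bar> \<le> \<bar>\<gamma> - \<gamma>'\<bar> * wt ?y + dist H K * wt ?y / 4"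
        using abs_triangle_ineq4[of "\<gamma> - \<gamma>'" "?d / 4"] by (simp only: mult_1_right order.trans)
    qed (use wt(1)[of ?y] in simp)
    also have "\<dots> = 1 / 4 * dist H K + \<bar>\<gamma> - \<gamma>'\<bar>"
      using wt(1)[of ?y] by (simp add: add_divide_distrib)
    finally show "dist (\<Psi> \<gamma> H x) (\<Psi> \<gamma>' K x) \<le> 1 / 4 * dist H K + \<bar>\<gamma> - \<gamma>'\<bar>" .
  qed
  have "\<exists>!H. \<Psi> \<gamma> H = H" for \<gamma>
    using \<Psi>_diff[of \<gamma> _ \<gamma>] by (intro banach_fix_type[of "1/4"]) auto
  then have "\<forall>\<gamma>. \<exists>H. \<Psi> \<gamma> H = H" by blast
  from choice[OF this] obtain H where H: "\<And>\<gamma>. \<Psi> \<gamma> (H \<gamma>) = H \<gamma>" by blast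
  define G where "G = (\<lambda>\<gamma> x. wt x * H \<gamma> x)"
  have Gc: "continuous_on UNIV (G \<gamma>)" for \<gamma>
    unfolding G_def by (intro continuous_on_mult wtc) auto
  have Geq: "G \<gamma> x = \<gamma> - (I (H \<gamma>) x - I (H \<gamma>) 0) / 4" if "x \<in> {-1..2}" for \<gamma> x
  proof -
    have "H \<gamma> x = \<Psi>0 \<gamma> (H \<gamma>) x" using \<Psi>[of \<gamma> "H \<gamma>" x] H[of \<gamma>] cl_id[OF that] by simp
    then show ?thesis using wt(1)[of x] by (simp add: G_def \<Psi>0_def)
  qed
  have hG: "h (H \<gamma>) = (\<lambda>y. g (G \<gamma> y))" for \<gamma> by (simp add: h_def G_def)
  have DG: "(G \<gamma> has_real_derivative - avg s (\<lambda>y. g (G \<gamma> y)) x / 4) (at x)" if x: "x \<in> {-1<..<2}" for \<gamma> x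
  proof -
    have "(I (H \<gamma>) has_real_derivative avg s (h (H \<gamma>)) x) (at x)"
      using DI[of x "H \<gamma>"] x at_within_Icc_at[of "-1" x 2] by simp
    then have "((\<lambda>x. \<gamma> - (I (H \<gamma>) x - I (H \<gamma>) 0) / 4) has_real_derivative 0 - (avg s (h (H \<gamma>)) x - 0) / 4) (at x)"
      by (intro DERIV_diff DERIV_cdivide DERIV_const)
    then have "((\<lambda>x. \<gamma> - (I (H \<gamma>) x - I (H \<gamma>) 0) / 4) has_real_derivative - avg s (\<lambda>y. g (G \<gamma> y)) x / 4) (at x)"
      by (simp add: hG)
    then show ?thesis
      by (rule has_field_derivative_transform_within_open[where S = "{-1<..<2}"])
        (use x Geq in auto)
  qed
  have "continuous_on UNIV (\<lambda>\<gamma>. G \<gamma> 1)"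
  proof (rule continuous_onI)
    fix \<gamma> e :: real assume e: "e > 0"
    have "dist (G \<gamma>' 1) (G \<gamma> 1) \<le> wt 1 * (4 / 3 * \<bar>\<gamma>' - \<gamma>\<bar>)" for \<gamma>'
    proof -
      have "dist (H \<gamma>') (H \<gamma>) \<le> 1 / 4 * dist (H \<gamma>') (H \<gamma>) + \<bar>\<gamma>' - \<gamma>\<bar>"
        using \<Psi>_diff[of \<gamma>' "H \<gamma>'" \<gamma> "H \<gamma>"] by (simp only: H)
      then have "dist (H \<gamma>' 1) (H \<gamma> 1) \<le> 4 / 3 * \<bar>\<gamma>' - \<gamma>\<bar>"
      proof -
        have "d \<le> 4 / 3 * a" if "D \<le> 1 / 4 * D + a" "d \<le> D" for d D a :: real
          using that by simp
        then show ?thesis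
          using \<open>dist (H \<gamma>') (H \<gamma>) \<le> 1 / 4 * dist (H \<gamma>') (H \<gamma>) + \<bar>\<gamma>' - \<gamma>\<bar>\<close>
            dist_bounded[of "H \<gamma>'" 1 "H \<gamma>"] by blast
      qed
      then have "wt 1 * dist (H \<gamma>' 1) (H \<gamma> 1) \<le> wt 1 * (4 / 3 * \<bar>\<gamma>' - \<gamma>\<bar>)"
        using wt(1)[of 1] by (intro mult_left_mono) auto
      then show ?thesis
        using wt(1)[of 1] by (simp add: G_def dist_real_def right_diff_distrib[symmetric] abs_mult)
    qed
    moreover have "wt 1 * (4 / 3 * \<bar>\<gamma>' - \<gamma>\<bar>) \<le> e" if "dist \<gamma>' \<gamma> < 3 * e / (4 * wt 1)" for \<gamma>'
      using that wt(1)[of 1] by (simp add: dist_real_def field_simps)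
    ultimately have "dist (G \<gamma>' 1) (G \<gamma> 1) \<le> e" if "dist \<gamma>' \<gamma> < 3 * e / (4 * wt 1)" for \<gamma>'
      using that order.trans by blast
    moreover have "3 * e / (4 * wt 1) > 0" using e wt(1)[of 1] by simp
    ultimately show "\<exists>d>0. \<forall>\<gamma>'\<in>UNIV. dist \<gamma>' \<gamma> < d \<longrightarrow> dist (G \<gamma>' 1) (G \<gamma> 1) \<le> e"
      by blast
  qed
  moreover have "G \<gamma> 0 = \<gamma>" for \<gamma> using Geq[of 0 \<gamma>] by simp
  ultimately show ?thesis using Gc DG by blast
qed

section \<open>Shooting\<close>

text \<open>The nonlinearity is truncated to a Lipschitz function. On the radial solutions below the truncation
  is invisible for \<open>y \<ge> 0\<close> as long as they are positive. They decrease strictly, even after they have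
  become negative, so that the sign of \<open>G 1\<close> decides whether they are positive on the unit ball.\<close>

definition trunc :: "real \<Rightarrow> real \<Rightarrow> real" where
  "trunc B u = max 0 (min u B)"

definition nonlin :: "real \<Rightarrow> real \<Rightarrow> real \<Rightarrow> real \<Rightarrow> real" where
  "nonlin lam q B u = lam * trunc B u + trunc B u powr q"

lemma trunc_bounds: "B \<ge> 0 \<Longrightarrow> 0 \<le> trunc B u" "B \<ge> 0 \<Longrightarrow> trunc B u \<le> B"
  by (auto simp: trunc_def)

lemma powr_diff_le:
  fixes a b :: real
  assumes "0 \<le> a" "a \<le> b" "b \<le> B" "q > 1"
  shows "b powr q - a powr q \<le> q * B powr (q - 1) * (b - a)"
proof (cases "a = 0 \<or> a = b")
  case True
  then show ?thesis
  proof
    assume a: "a = 0"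
    show ?thesis
    proof (cases "b = 0")
      case False
      then have b: "b > 0" using assms by simp
      have "b powr q = b powr (q - 1) * b" using b powr_add[of b "q - 1" 1] by simp
      also have "\<dots> \<le> B powr (q - 1) * b" using assms b by (intro mult_right_mono powr_mono2) auto
      also have "\<dots> = 1 * (B powr (q - 1) * b)" by simp
      also have "\<dots> \<le> q * (B powr (q - 1) * b)" using assms b by (intro mult_right_mono) auto
      finally show ?thesis using a assms by simp
    qed (use a in simp)
  qed simp
next
  case False
  then have ab: "0 < a" "a < b" using assms by auto
  obtain z where z: "a < z" "z < b" "b powr q - a powr q = (b - a) * (q * z powr (q - 1))"
    using MVT2[OF ab(2), of "\<lambda>x. x powr q" "\<lambda>x. q * x powr (q - 1)"] ab(1)
    by (force intro!: derivative_eq_intros)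
  have "z powr (q - 1) \<le> B powr (q - 1)" using z ab assms by (intro powr_mono2) auto
  then have "(b - a) * (q * z powr (q - 1)) \<le> (b - a) * (q * B powr (q - 1))"
    using ab assms by (intro mult_left_mono) auto
  then show ?thesis using z(3) by (simp add: ac_simps)
qed

lemma nonlin_lipschitz:
  assumes "lam > 0" "q > 1" "B > 0"
  shows "\<bar>nonlin lam q B a - nonlin lam q B b\<bar> \<le> (lam + q * B powr (q - 1)) * \<bar>a - b\<bar>"
proof -
  have main: "\<bar>nonlin lam q B a - nonlin lam q B b\<bar> \<le> (lam + q * B powr (q - 1)) * \<bar>a - b\<bar>" if ab: "a \<le> b" for a b
  proof -
    define s t where "s = trunc B a" and "t = trunc B b"
    have st: "0 \<le> s" "s \<le> t" "t \<le> B" "t - s \<le> b - a"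
      using ab assms by (auto simp: s_def t_def trunc_def)
    have "s powr q \<le> t powr q" "lam * s \<le> lam * t" using st assms by (auto intro!: powr_mono2)
    then have "\<bar>nonlin lam q B a - nonlin lam q B b\<bar> = lam * (t - s) + (t powr q - s powr q)"
      by (simp add: nonlin_def s_def t_def algebra_simps)
    also have "\<dots> \<le> lam * (t - s) + q * B powr (q - 1) * (t - s)"
      using powr_diff_le[OF st(1-3) assms(2)] by simp
    also have "\<dots> = (lam + q * B powr (q - 1)) * (t - s)" by (simp add: algebra_simps)
    also have "\<dots> \<le> (lam + q * B powr (q - 1)) * \<bar>a - b\<bar>"
      using st assms by (intro mult_left_mono) auto
    finally show ?thesis .
  qed
  show ?thesis
    using main[of a b] main[of b a] by (cases "a \<le> b") (auto simp: abs_minus_commute)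
qed

lemma nonlin_nonneg: "lam > 0 \<Longrightarrow> B > 0 \<Longrightarrow> 0 \<le> nonlin lam q B u"
  using trunc_bounds[of B u] by (simp add: nonlin_def)

lemma nonlin_mono:
  assumes "lam > 0" "q > 1" "B > 0" "u \<le> v"
  shows "nonlin lam q B u \<le> nonlin lam q B v"
  unfolding nonlin_def using assms by (intro add_mono mult_left_mono powr_mono2) (auto simp: trunc_def)

lemma nonlin_eq: "0 \<le> u \<Longrightarrow> u \<le> B \<Longrightarrow> nonlin lam q B u = lam * u + u powr q"
  by (simp add: nonlin_def trunc_def)

locale shooting =
  fixes \<nu> lam B \<gamma> :: real and G :: "real \<Rightarrow> real"
  assumes nu: "0 < \<nu>" "\<nu> < 1" and lam: "lam > 0" and \<gamma>: "0 < \<gamma>" "\<gamma> < B"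
    and Gc: "continuous_on UNIV G" and G0: "G 0 = \<gamma>"
    and DG: "\<And>x. x \<in> {-1<..<2} \<Longrightarrow> (G has_real_derivative
        - avg \<nu> (\<lambda>y. nonlin lam (1 + 2 / \<nu>) B (G y)) x / 4) (at x)"
begin

definition q :: real where "q = 1 + 2 / \<nu>"

lemma q: "q > 1" using nu by (simp add: q_def)

definition h :: "real \<Rightarrow> real" where "h y = nonlin lam q B (G y)"

definition G1 :: "real \<Rightarrow> real" where "G1 x = - avg \<nu> h x / 4"

lemma DG1: "x \<in> {-1<..<2} \<Longrightarrow> (G has_real_derivative G1 x) (at x)"
  using DG[of x] by (simp add: G1_def h_def[abs_def] q_def)

lemma B: "B > 0" using \<gamma> by simp

lemma h_cont: "continuous_on S h"
proof -
  have "continuous_on UNIV (\<lambda>y. nonlin lam q B (G y))"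
    unfolding nonlin_def trunc_def using q Gc
    by (intro continuous_intros continuous_on_powr') auto
  then show ?thesis unfolding h_def[abs_def] by (rule continuous_on_subset) simp
qed

lemma h_nonneg: "h y \<ge> 0" unfolding h_def using lam B by (rule nonlin_nonneg)

lemma avg_h_nonneg: "avg \<nu> h x \<ge> 0"
  unfolding avg_def using nu avg_integrable[of \<nu> UNIV x h] h_cont
  by (intro integral_nonneg) (auto simp: h_nonneg)

text \<open>By continuity \<open>h\<close> is positive near \<open>0\<close>, and these values enter the average for every \<open>x\<close>.\<close>

lemma avg_h_pos: "avg \<nu> h x > 0"
proof -
  have "avg \<nu> h x \<noteq> 0"
  proof
    assume "avg \<nu> h x = 0"
    moreover have c: "continuous_on {0..1} (\<lambda>\<sigma>. \<sigma> powr \<nu> * h (x * \<sigma>))"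
      using nu h_cont by (intro avg_integrand_continuous[of _ UNIV]) auto
    ultimately have "\<forall>\<sigma>\<in>{0..1}. \<sigma> powr \<nu> * h (x * \<sigma>) = 0"
      unfolding avg_def using integral_eq_0_iff[of 0 1 "\<lambda>\<sigma>. \<sigma> powr \<nu> * h (x * \<sigma>)"] h_nonneg by auto
    then have z: "h (x * \<sigma>) = 0" if "0 < \<sigma>" "\<sigma> \<le> 1" for \<sigma>
    proof -
      have "\<sigma> powr \<nu> * h (x * \<sigma>) = 0"
        by (rule bspec[OF \<open>\<forall>\<sigma>\<in>{0..1}. \<sigma> powr \<nu> * h (x * \<sigma>) = 0\<close>]) (use that in simp)
      then show ?thesis using that by simp
    qed
    have "continuous_on UNIV (\<lambda>\<sigma>. h (x * \<sigma>))"
      by (intro continuous_on_compose2[OF h_cont[of UNIV]] continuous_intros) auto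
    then have "((\<lambda>\<sigma>. h (x * \<sigma>)) \<longlongrightarrow> h (x * 0)) (at_right 0)"
      unfolding continuous_on_eq_continuous_at[OF open_UNIV] isCont_def filterlim_at_split by blast
    moreover have "eventually (\<lambda>\<sigma>. h (x * \<sigma>) = 0) (at_right (0::real))"
      using z by (auto simp: eventually_at_right_field intro!: exI[of _ 1])
    then have "((\<lambda>\<sigma>. h (x * \<sigma>)) \<longlongrightarrow> 0) (at_right 0)" by (rule tendsto_eventually)
    ultimately have "h (x * 0) = 0" by (rule tendsto_unique[rotated]) simp
    moreover have "h 0 = lam * \<gamma> + \<gamma> powr q" using \<gamma> by (simp add: h_def G0 nonlin_eq)
    moreover have "lam * \<gamma> + \<gamma> powr q > 0" using lam \<gamma> by (simp add: add_pos_pos)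
    ultimately show False by simp
  qed
  then show ?thesis using avg_h_nonneg[of x] by linarith
qed

lemma G_less: "-1 < x \<Longrightarrow> x < y \<Longrightarrow> y < 2 \<Longrightarrow> G y < G x"
proof (rule DERIV_neg_imp_decreasing[of x y G])
  fix z assume "-1 < x" "y < 2" "x \<le> z" "z \<le> y"
  then show "\<exists>D. (G has_real_derivative D) (at z) \<and> D < 0"
    using DG1[of z] avg_h_pos[of z] by (intro exI[of _ "G1 z"]) (auto simp: G1_def)
qed auto

lemma G_le: "0 \<le> x \<Longrightarrow> x < 2 \<Longrightarrow> G x \<le> \<gamma>"
  using G_less[of 0 x] G0 by (cases "x = 0") auto

lemma avg_h_le:
  assumes "0 \<le> x" "x < 2"
  shows "avg \<nu> h x \<le> lam * \<gamma> + \<gamma> powr q"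
proof -
  have "\<bar>avg \<nu> h x\<bar> \<le> lam * \<gamma> + \<gamma> powr q"
  proof (rule avg_le[OF nu(1) h_cont])
    fix \<sigma> :: real assume \<sigma>: "0 \<le> \<sigma>" "\<sigma> \<le> 1"
    have "x * \<sigma> \<le> x * 1" using assms \<sigma> by (intro mult_left_mono) auto
    then have "G (x * \<sigma>) \<le> \<gamma>" using assms \<sigma> by (intro G_le) auto
    then have "h (x * \<sigma>) \<le> nonlin lam q B \<gamma>" unfolding h_def using lam q B by (intro nonlin_mono)
    then show "\<bar>h (x * \<sigma>)\<bar> \<le> lam * \<gamma> + \<gamma> powr q"
      using h_nonneg[of "x * \<sigma>"] nonlin_eq[of \<gamma> B lam q] \<gamma> by simp
  qed
  then show ?thesis by simp
qed

lemma G1_bound: "0 \<le> x \<Longrightarrow> x < 2 \<Longrightarrow> \<bar>G1 x\<bar> \<le> (lam * \<gamma> + \<gamma> powr q) / 4"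
  using avg_h_le[of x] avg_h_pos[of x] by (simp add: G1_def)

lemma G_ge: "0 \<le> x \<Longrightarrow> x \<le> y \<Longrightarrow> y < 2 \<Longrightarrow> G x - (lam * \<gamma> + \<gamma> powr q) / 4 * (y - x) \<le> G y"
proof -
  assume xy: "0 \<le> x" "x \<le> y" "y < 2"
  let ?K = "(lam * \<gamma> + \<gamma> powr q) / 4"
  have "G x + ?K * x \<le> G y + ?K * y"
  proof (rule DERIV_nonneg_imp_nondecreasing[of x y "\<lambda>z. G z + ?K * z", OF xy(2)])
    fix z assume z: "x \<le> z" "z \<le> y"
    have "((\<lambda>z. G z + ?K * z) has_real_derivative G1 z + ?K * 1) (at z)"
      using z xy by (intro DERIV_add DERIV_cmult DERIV_ident DG1) auto
    moreover have "\<bar>G1 z\<bar> \<le> ?K" using G1_bound[of z] z xy by auto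
    then have "G1 z + ?K * 1 \<ge> 0" by linarith
    ultimately show "\<exists>D. ((\<lambda>z. G z + ?K * z) has_real_derivative D) (at z) \<and> 0 \<le> D" by blast
  qed
  then show ?thesis by (simp add: right_diff_distrib)
qed

text \<open>The averaged equation gains one derivative, also across \<open>y = 0\<close>; the power in the nonlinearity is
  smooth away from \<open>0\<close>.\<close>

lemma smooth_while_positive:
  assumes b: "0 < b" "b \<le> 1" "\<And>y. 0 \<le> y \<Longrightarrow> y < b \<Longrightarrow> G y > 0"
  shows "\<exists>\<epsilon>>0. \<exists>G2. (\<forall>k. Ck_on k {-\<epsilon><..<b} G) \<and> (\<forall>y\<in>{-\<epsilon><..<b}. 0 < G y \<and>
     (G has_real_derivative G1 y) (at y) \<and> (G1 has_real_derivative G2 y) (at y) \<and>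
     4 * y * G2 y + 4 * (\<nu> + 1) * G1 y + lam * G y + G y powr q = 0)"
proof -
  have "isCont G 0" using Gc by (simp add: continuous_on_eq_continuous_at)
  then have "eventually (\<lambda>y. G y < B) (at 0)"
    using \<gamma> G0 by (auto simp: isCont_def intro!: order_tendstoD)
  then obtain d where d: "d > 0" "\<And>y. y \<noteq> 0 \<Longrightarrow> \<bar>y\<bar> < d \<Longrightarrow> G y < B"
    by (auto simp: eventually_at dist_real_def)
  define \<epsilon> where "\<epsilon> = min d 1"
  have \<epsilon>: "\<epsilon> > 0" "\<epsilon> \<le> 1" using d by (auto simp: \<epsilon>_def)
  define J where "J = {-\<epsilon><..<b}"
  have J: "open J" "convex J" "0 \<in> J" using \<epsilon> b by (auto simp: J_def)
  have Jsub: "y \<in> {-1<..<2}" if "y \<in> J" for y using that \<epsilon> b by (auto simp: J_def)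
  have Gpos: "0 < G y" if y: "y \<in> J" for y
  proof (cases "0 \<le> y")
    case True
    then show ?thesis using b(3) y by (simp add: J_def)
  next
    case False
    then show ?thesis using G_less[of y 0] G0 \<gamma> Jsub[OF y] by simp
  qed
  have GB: "G y \<le> B" if y: "y \<in> J" for y
  proof (cases "0 \<le> y")
    case True
    then show ?thesis using G_le[of y] \<gamma> Jsub[OF y] by simp
  next
    case False
    then show ?thesis using d(2)[of y] y by (auto simp: J_def \<epsilon>_def intro: less_imp_le)
  qed
  have h_eq: "h y = lam * G y + G y powr q" if "y \<in> J" for y
    unfolding h_def using Gpos[OF that] GB[OF that] by (intro nonlin_eq) auto
  have Ck_h: "Ck_on k J h" if "Ck_on k J G" for k
  proof (rule Ck_on_cong[OF J(1)])
    show "Ck_on k J (\<lambda>y. lam * G y + G y powr q)"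
      using that J(1) Gpos Ck_on_compose[OF J(1), of "{0<..}" G k "\<lambda>u. u powr q"] Ck_on_powr
      by (intro Ck_on_add Ck_on_mult Ck_on_const) auto
  qed (simp add: h_eq)
  have Ck_G: "Ck_on k J G" for k
  proof (induction k)
    case 0
    then show ?case using Gc by (auto intro: continuous_on_subset)
  next
    case (Suc k)
    have "Ck_on k J (\<lambda>x. (- 1 / 4) * avg \<nu> h x)"
      by (intro Ck_on_mult Ck_on_const Ck_on_avg J nu Ck_h Suc)
    then have "Ck_on k J G1" unfolding G1_def[abs_def] by simp
    then show ?case using DG1 Jsub by (intro Ck_on_real_SucI[OF J(1)]) auto
  qed
  define h' where "h' = partial_deriv 1 h"
  have h': "(h has_real_derivative h' y) (at y)" if "y \<in> J" for y
    unfolding h'_def using Ck_on_real_SucD(1)[OF Ck_h[OF Ck_G[of "Suc 0"]] that] .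
  have "Ck_on 0 J h'" unfolding h'_def using Ck_on_real_SucD(2)[OF Ck_h[OF Ck_G[of "Suc 0"]]] .
  then have h'c: "continuous_on J h'" by simp
  define G2 where "G2 = (\<lambda>y. - avg (\<nu> + 1) h' y / 4)"
  have "(G1 has_real_derivative G2 y) (at y)" if y: "y \<in> J" for y
    unfolding G1_def[abs_def] G2_def
    by (intro DERIV_cdivide DERIV_minus DERIV_avg[OF nu(1) J y h' h'c])
  moreover have "4 * y * G2 y + 4 * (\<nu> + 1) * G1 y + lam * G y + G y powr q = 0" if y: "y \<in> J" for y
    using avg_euler[OF nu(1) J y h' h'c] h_eq[OF y] by (simp add: G1_def G2_def field_simps)
  ultimately show ?thesis
    using \<epsilon>(1) Ck_G Gpos DG1 Jsub unfolding J_def by blast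
qed

lemma G1_cont: "isCont G1 x"
proof -
  have "continuous_on UNIV (avg \<nu> h)" using continuous_on_avg[OF nu(1) convex_UNIV UNIV_I h_cont] .
  then have "continuous_on UNIV G1" unfolding G1_def[abs_def] by (intro continuous_intros) auto
  then show ?thesis by (simp add: continuous_on_eq_continuous_at)
qed

lemma positive_if_nonneg_at_1:
  assumes "G 1 \<ge> 0" "0 \<le> y" "y < 1"
  shows "G y > 0"
  using G_less[of y 1] assms by simp

lemma radial_ode_if_nonneg_at_1:
  assumes "G 1 \<ge> 0"
  shows "\<exists>G2. radial_ode \<nu> lam G G1 G2"
proof -
  obtain \<epsilon> G2 where \<epsilon>: "\<epsilon> > 0" "\<forall>y\<in>{-\<epsilon><..<1}. 0 < G y \<and> (G has_real_derivative G1 y) (at y) \<and>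
      (G1 has_real_derivative G2 y) (at y) \<and> 4 * y * G2 y + 4 * (\<nu> + 1) * G1 y + lam * G y + G y powr q = 0"
    using smooth_while_positive[of 1] positive_if_nonneg_at_1[OF assms] by auto
  have "isCont G 0" using Gc by (simp add: continuous_on_eq_continuous_at)
  then have "(G \<longlongrightarrow> G 0) (at_right 0)" by (simp add: isCont_def filterlim_at_split)
  moreover have "((\<lambda>y. y * G1 y) \<longlongrightarrow> 0 * G1 0) (at_right 0)"
    using G1_cont[of 0] by (intro tendsto_mult tendsto_ident_at) (simp add: isCont_def filterlim_at_split)
  ultimately have "radial_ode \<nu> lam G G1 G2"
    using \<epsilon> G0 \<gamma> unfolding radial_ode_def q_def by auto
  then show ?thesis by blast
qed

text \<open>Sturm comparison: since \<open>G \<le> \<gamma>\<close>, the nonlinear equation is a linear one with a potential of at most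
  \<open>lam + \<gamma>\<^sup>q\<^sup>-\<^sup>1\<close>, and the solution of the linear equation with this parameter has no zero in \<open>[0, 1]\<close>.\<close>

lemma positive_for_small_central_value:
  assumes small: "lam + \<gamma> powr (q - 1) < (bessel_zero \<nu> 1)\<^sup>2"
  shows "G 1 > 0"
proof (rule ccontr)
  assume "\<not> G 1 > 0"
  moreover have "isCont G y" for y using Gc by (simp add: continuous_on_eq_continuous_at)
  ultimately obtain x0 where x0: "0 < x0" "x0 \<le> 1" "G x0 = 0" "\<forall>y. 0 \<le> y \<and> y < x0 \<longrightarrow> G y > 0"
    using first_zero[of 0 1 G] G0 \<gamma> by auto
  obtain \<epsilon> G2 where \<epsilon>: "\<epsilon> > 0" "\<forall>y\<in>{-\<epsilon><..<x0}. 0 < G y \<and> (G has_real_derivative G1 y) (at y) \<and>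
      (G1 has_real_derivative G2 y) (at y) \<and> 4 * y * G2 y + 4 * (\<nu> + 1) * G1 y + lam * G y + G y powr q = 0"
    using smooth_while_positive[of x0] x0 by auto
  define l where "l = lam + \<gamma> powr (q - 1)"
  have l: "l > 0" using lam by (simp add: l_def add_pos_nonneg)
  have nu1: "- 1 < \<nu>" using nu by simp
  define f f1 f2 where "f = (\<lambda>y. bes \<nu> (l * y))" and "f1 = (\<lambda>y. l * bes1 \<nu> (l * y))" and "f2 = (\<lambda>y. l * (l * bes2 \<nu> (l * y)))"
  have dl: "((\<lambda>y. l * y) has_real_derivative l) (at y)" for y by (auto intro!: derivative_eq_intros)
  have Df: "(f has_real_derivative f1 y) (at y)" "(f1 has_real_derivative f2 y) (at y)" for y
  proof -
    show "(f has_real_derivative f1 y) (at y)"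
      unfolding f_def f1_def by (rule DERIV_cong[OF DERIV_chain2[OF DERIV_bes[OF nu1] dl]]) simp
    show "(f1 has_real_derivative f2 y) (at y)"
      unfolding f1_def f2_def
      by (rule DERIV_cong[OF DERIV_cmult[OF DERIV_chain2[OF DERIV_bes1[OF nu1] dl]]]) simp
  qed
  have f_cont: "isCont f y" "isCont f1 y" for y
    using DERIV_isCont[OF Df(1)] DERIV_isCont[OF Df(2)] by auto
  have f_ode: "4 * y * f2 y + 4 * (\<nu> + 1) * f1 y + l * f y = 0" for y
  proof -
    have "4 * y * f2 y + 4 * (\<nu> + 1) * f1 y + l * f y
      = 4 * l * (l * y * bes2 \<nu> (l * y) + (\<nu> + 1) * bes1 \<nu> (l * y) + bes \<nu> (l * y) / 4)"
      by (simp add: f_def f1_def f2_def algebra_simps)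
    then show ?thesis using bes_ode[OF nu1, of "l * y"] by simp
  qed
  have f_pos: "f y > 0" if "0 \<le> y" "y \<le> 1" for y
  proof -
    have "l * y \<le> l * 1" using that l by (intro mult_left_mono) auto
    then have "l * y < (bessel_zero \<nu> 1)\<^sup>2" using small unfolding l_def mult_1_right by (rule le_less_trans)
    then show ?thesis unfolding f_def using that l nu by (intro bessel_zero_1_sq(3)) auto
  qed
  define W where "W = (\<lambda>y. y powr (\<nu> + 1) * (G1 y * f y - G y * f1 y))"
  have W_nonneg: "0 \<le> W y" if y: "0 < y" "y < x0" for y
  proof (rule mono_ge_limit_at_right[where f = W and
        f' = "\<lambda>r. r powr \<nu> * (G r * f r * (l - lam - G r powr (q - 1)) / 4)", OF _ _ _ y(1)])
    fix r assume r: "0 < r" "r \<le> y"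
    then have rJ: "r \<in> {-\<epsilon><..<x0}" using y \<epsilon>(1) by auto
    then have Gr: "0 < G r" "(G has_real_derivative G1 r) (at r)" "(G1 has_real_derivative G2 r) (at r)"
      "4 * r * G2 r + 4 * (\<nu> + 1) * G1 r + lam * G r + G r powr q = 0" using \<epsilon>(2) by auto
    have p: "((\<lambda>r. r powr (\<nu> + 1)) has_real_derivative (\<nu> + 1) * r powr \<nu>) (at r)"
      using r by (auto intro!: derivative_eq_intros)
    have "(W has_real_derivative ((\<nu> + 1) * r powr \<nu>) * (G1 r * f r - G r * f1 r)
       + ((G2 r * f r + f1 r * G1 r) - (G1 r * f1 r + f2 r * G r)) * r powr (\<nu> + 1)) (at r)"
      unfolding W_def by (intro DERIV_mult DERIV_diff p Gr Df)
    moreover have "((\<nu> + 1) * r powr \<nu>) * (G1 r * f r - G r * f1 r)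
       + ((G2 r * f r + f1 r * G1 r) - (G1 r * f1 r + f2 r * G r)) * r powr (\<nu> + 1)
      = r powr \<nu> * ((4 * r * G2 r + 4 * (\<nu> + 1) * G1 r) * f r - G r * (4 * r * f2 r + 4 * (\<nu> + 1) * f1 r)) / 4"
      using r by (simp add: powr_add field_simps)
    moreover have "4 * r * G2 r + 4 * (\<nu> + 1) * G1 r = - (lam * G r + G r powr q)"
      using Gr(4) by linarith
    moreover have "4 * r * f2 r + 4 * (\<nu> + 1) * f1 r = - (l * f r)" using f_ode[of r] by linarith
    moreover have "- (lam * G r + G r powr q) * f r - G r * (- (l * f r)) = G r * f r * (l - lam - G r powr (q - 1))"
      using Gr(1) powr_add[of "G r" "q - 1" 1] by (simp add: algebra_simps)
    ultimately show "(W has_real_derivative r powr \<nu> * (G r * f r * (l - lam - G r powr (q - 1)) / 4)) (at r)"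
      by (simp only: times_divide_eq_right)
    have "G r powr (q - 1) \<le> \<gamma> powr (q - 1)"
      using less_imp_le[OF Gr(1)] G_le[of r] r y x0(2) q by (intro powr_mono2) auto
    then show "0 \<le> r powr \<nu> * (G r * f r * (l - lam - G r powr (q - 1)) / 4)"
      using Gr(1) f_pos[of r] r y x0(2)
      by (intro mult_nonneg_nonneg divide_nonneg_nonneg) (auto simp: l_def)
  next
    have "((\<lambda>y. y powr (\<nu> + 1)) \<longlongrightarrow> 0) (at_right 0)" using nu by real_asymp
    moreover have "isCont G 0" "isCont f 0" "isCont f1 0"
      using Gc f_cont by (auto simp: continuous_on_eq_continuous_at)
    then have "isCont (\<lambda>y. G1 y * f y - G y * f1 y) 0" using G1_cont[of 0] by (intro continuous_intros)
    then have "((\<lambda>y. G1 y * f y - G y * f1 y) \<longlongrightarrow> G1 0 * f 0 - G 0 * f1 0) (at_right 0)"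
      by (simp add: isCont_def filterlim_at_split)
    ultimately show "(W \<longlongrightarrow> 0) (at_right 0)"
      unfolding W_def using tendsto_mult by fastforce
  qed
  have "isCont W x0"
  proof -
    have "isCont G1 x0" "isCont G x0" "isCont f x0" "isCont f1 x0"
      using G1_cont Gc f_cont by (auto simp: continuous_on_eq_continuous_at)
    moreover have "isCont (\<lambda>y. y powr (\<nu> + 1)) x0" using x0(1) by (intro continuous_intros) auto
    ultimately show ?thesis unfolding W_def using x0(1) by (intro continuous_intros) auto
  qed
  then have "(W \<longlongrightarrow> W x0) (at_left x0)" by (simp add: isCont_def filterlim_at_split)
  moreover have "eventually (\<lambda>y. 0 \<le> W y) (at_left x0)"
    using W_nonneg x0(1) by (auto simp: eventually_at_left_field intro!: exI[of _ 0])
  ultimately have "0 \<le> W x0" by (rule tendsto_lowerbound) simp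
  moreover have "W x0 < 0"
  proof -
    have "G1 x0 < 0" using avg_h_pos[of x0] by (simp add: G1_def)
    then have "G1 x0 * f x0 < 0" using f_pos[of x0] x0 by (simp add: mult_neg_pos)
    then show ?thesis using x0 by (simp add: W_def mult_pos_neg)
  qed
  ultimately show False by simp
qed

end

text \<open>The value at \<open>1\<close> is positive for small and negative for large central values, and it depends
  continuously on the central value.\<close>

lemma shooting_solution_exists:
  assumes nu: "0 < \<nu>" "\<nu> < 1" and range: "(bessel_zero (- \<nu>) 1)\<^sup>2 < lam" "lam < (bessel_zero \<nu> 1)\<^sup>2"
  shows "\<exists>\<gamma> B G. shooting \<nu> lam B \<gamma> G \<and> G 1 = 0"
proof -
  define q where "q = 1 + 2 / \<nu>"
  have q: "q > 1" using nu by (simp add: q_def)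
  have "(bessel_zero (- \<nu>) 1)\<^sup>2 > 0" using bessel_zero_1_sq(1)[of "- \<nu>"] nu by simp
  then have lam: "lam > 0" using range by linarith
  obtain \<Gamma> where \<Gamma>: "\<forall>\<gamma>\<ge>\<Gamma>. \<forall>w w1 \<kappa>. emden_fowler \<nu> lam \<gamma> 0 w w1 \<longrightarrow>
     (\<forall>t>0. \<gamma> - (lam * \<gamma> + \<gamma> powr (1 + 2 / \<nu>)) * exp (- (2 * t)) / 4 \<le> exp (\<nu> * t) * w t) \<longrightarrow>
     (\<forall>t>0. exp (\<nu> * t) * w t \<le> \<gamma>) \<longrightarrow>
     \<kappa> \<ge> \<gamma> powr (1 + 2 / \<nu>) / 4 \<longrightarrow>
     ((\<lambda>t. exp (2 * t) * (exp (\<nu> * t) * (\<nu> * w t + w1 t))) \<longlongrightarrow> \<kappa>) at_top \<longrightarrow> False"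
    using not_positive_for_large_central_value[OF nu range] by blast
  define d where "d = (bessel_zero \<nu> 1)\<^sup>2 - lam"
  have d: "d > 0" using range by (simp add: d_def)
  define \<gamma>a where "\<gamma>a = (d / 2) powr (1 / (q - 1))"
  have \<gamma>a: "\<gamma>a > 0" "lam + \<gamma>a powr (q - 1) < (bessel_zero \<nu> 1)\<^sup>2"
  proof -
    show "\<gamma>a > 0" using d by (simp add: \<gamma>a_def)
    have "\<gamma>a powr (q - 1) = d / 2" using d q by (simp add: \<gamma>a_def powr_powr)
    moreover have "a + (z - a) / 2 < z" if "a < z" for a z :: real using that by (simp add: field_simps)
    from this[OF range(2)] have "lam + d / 2 < (bessel_zero \<nu> 1)\<^sup>2" unfolding d_def .
    ultimately show "lam + \<gamma>a powr (q - 1) < (bessel_zero \<nu> 1)\<^sup>2" by simp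
  qed
  define \<gamma>b where "\<gamma>b = max \<Gamma> \<gamma>a"
  have \<gamma>b: "\<gamma>a \<le> \<gamma>b" "\<Gamma> \<le> \<gamma>b" "\<gamma>b > 0" using \<gamma>a by (auto simp: \<gamma>b_def)
  define B where "B = \<gamma>b + 1"
  have B: "B > 0" using \<gamma>b by (simp add: B_def)
  have L: "lam + q * B powr (q - 1) > 0" using lam q B by (intro add_pos_nonneg) auto
  obtain G :: "real \<Rightarrow> real \<Rightarrow> real" where G: "\<And>\<gamma>. G \<gamma> 0 = \<gamma>" "\<And>\<gamma>. continuous_on UNIV (G \<gamma>)"
      "\<And>\<gamma> x. x \<in> {-1<..<2} \<Longrightarrow> (G \<gamma> has_real_derivative - avg \<nu> (\<lambda>y. nonlin lam q B (G \<gamma> y)) x / 4) (at x)"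
      "continuous_on UNIV (\<lambda>\<gamma>. G \<gamma> 1)"
    using radial_ivp[OF nu(1) nonlin_lipschitz[OF lam q B] L] by blast
  have shoot: "shooting \<nu> lam B \<gamma> (G \<gamma>)" if "0 < \<gamma>" "\<gamma> \<le> \<gamma>b" for \<gamma>
    using nu lam that G unfolding shooting_def B_def q_def by auto
  have pos: "G \<gamma>a 1 > 0"
    using shooting.positive_for_small_central_value[OF shoot[OF \<gamma>a(1) \<gamma>b(1)]] \<gamma>a(2)
      shooting.q_def[OF shoot[OF \<gamma>a(1) \<gamma>b(1)]] by (simp add: q_def)
  have neg: "G \<gamma>b 1 < 0"
  proof (rule ccontr)
    assume "\<not> G \<gamma>b 1 < 0"
    then have nonneg: "G \<gamma>b 1 \<ge> 0" by simp
    interpret shooting \<nu> lam B \<gamma>b "G \<gamma>b" by (rule shoot) (use \<gamma>b in auto)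
    let ?G = "G \<gamma>b"
    define w where "w = (\<lambda>t. exp (- (\<nu> * t)) * ?G (exp (- (2 * t))))"
    define w1 where "w1 = (\<lambda>t. - (exp (- (\<nu> * t)) * (\<nu> * ?G (exp (- (2 * t))) + 2 * (exp (- (2 * t)) * G1 (exp (- (2 * t)))))))"
    obtain G2 where "radial_ode \<nu> lam ?G G1 G2" using radial_ode_if_nonneg_at_1[OF nonneg] by blast
    then have EF: "emden_fowler \<nu> lam \<gamma>b 0 w w1"
      using emden_fowler_of_radial_ode[OF _ nu, of lam ?G] G0 by (simp add: w_def w1_def)
    have cancel: "exp (\<nu> * t) * (exp (- (\<nu> * t)) * y) = y" for t y :: real
      by (simp add: mult.assoc[symmetric] exp_add[symmetric])
    have ew: "exp (\<nu> * t) * w t = ?G (exp (- (2 * t)))" for t unfolding w_def cancel ..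
    have 1: "\<gamma>b - (lam * \<gamma>b + \<gamma>b powr (1 + 2 / \<nu>)) * exp (- (2 * t)) / 4 \<le> exp (\<nu> * t) * w t" if "t > 0" for t
    proof -
      have "exp (- (2 * t)) < 2" by (rule less_trans[of _ 1]) (use that in auto)
      then show ?thesis using G_ge[of 0 "exp (- (2 * t))"] unfolding ew G0 q_def by simp
    qed
    have 2: "exp (\<nu> * t) * w t \<le> \<gamma>b" if "t > 0" for t
    proof -
      have "exp (- (2 * t)) < 2" by (rule less_trans[of _ 1]) (use that in auto)
      then show ?thesis unfolding ew by (intro G_le) auto
    qed
    have 3: "((\<lambda>t. exp (2 * t) * (exp (\<nu> * t) * (\<nu> * w t + w1 t))) \<longlongrightarrow> - 2 * G1 0) at_top"
    proof -
      have "((\<lambda>t::real. exp (- (2 * t))) \<longlongrightarrow> 0) at_top" by real_asymp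
      from isCont_tendsto_compose[OF G1_cont[of 0] this]
      have "((\<lambda>t. - 2 * G1 (exp (- (2 * t)))) \<longlongrightarrow> - 2 * G1 0) at_top" by (intro tendsto_intros)
      moreover have "exp (2 * t) * (exp (\<nu> * t) * (\<nu> * w t + w1 t)) = - 2 * G1 (exp (- (2 * t)))" for t
      proof -
        have "\<nu> * w t + w1 t = exp (- (\<nu> * t)) * (- 2 * (exp (- (2 * t)) * G1 (exp (- (2 * t)))))"
          by (simp add: w_def w1_def algebra_simps)
        then have "exp (\<nu> * t) * (\<nu> * w t + w1 t) = - 2 * (exp (- (2 * t)) * G1 (exp (- (2 * t))))"
          by (simp only: cancel)
        then show ?thesis by (simp add: exp_minus)
      qed
      ultimately show ?thesis by simp
    qed
    have 4: "- 2 * G1 0 \<ge> \<gamma>b powr (1 + 2 / \<nu>) / 4"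
    proof -
      have "((\<lambda>\<sigma>. \<sigma> powr \<nu>) has_integral (1 powr (\<nu> + 1) / (\<nu> + 1))) {0..1::real}"
        using nu by (intro has_integral_powr_from_0) auto
      then have "((\<lambda>\<sigma>. \<sigma> powr \<nu> * h 0) has_integral (1 powr (\<nu> + 1) / (\<nu> + 1)) * h 0) {0..1::real}"
        by (rule has_integral_mult_left)
      from integral_unique[OF this] have "avg \<nu> h 0 = (1 powr (\<nu> + 1) / (\<nu> + 1)) * h 0"
        unfolding avg_def mult_zero_left .
      then have "avg \<nu> h 0 = h 0 / (\<nu> + 1)" by simp
      moreover have "h 0 / (\<nu> + 1) \<ge> h 0 / 2" using h_nonneg[of 0] nu by (intro divide_left_mono) auto
      moreover have "h 0 = lam * \<gamma>b + \<gamma>b powr (1 + 2 / \<nu>)"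
        using \<gamma> nonlin_eq[of \<gamma>b B lam "1 + 2 / \<nu>"]
        unfolding h_def G0 shooting.q_def[OF shoot[OF \<gamma>b(3) order.refl]] by simp
      moreover have "lam * \<gamma>b \<ge> 0" using lam \<gamma>b by simp
      ultimately have "avg \<nu> h 0 \<ge> \<gamma>b powr (1 + 2 / \<nu>) / 2" by linarith
      then show ?thesis by (simp add: G1_def)
    qed
    show False using \<Gamma> \<gamma>b(2) EF 1 2 3 4 by blast
  qed
  have "\<exists>\<gamma>\<ge>\<gamma>a. \<gamma> \<le> \<gamma>b \<and> G \<gamma> 1 = 0"
    using pos neg \<gamma>b(1) continuous_on_subset[OF G(4)]
    by (intro IVT2'[of "\<lambda>\<gamma>. G \<gamma> 1"]) auto
  then obtain \<gamma> where "\<gamma> \<ge> \<gamma>a" "\<gamma> \<le> \<gamma>b" "G \<gamma> 1 = 0" by blast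
  then show ?thesis using shoot[of \<gamma>] \<gamma>a(1) by force
qed

lemma positive_radial_solution_exists:
  assumes \<nu>: "\<nu> = (real DIM('a::euclidean_space) - 2 - \<delta>) / 2" "0 < \<nu>" "\<nu> < 1"
    and range: "(bessel_zero (- \<nu>) 1)\<^sup>2 < lam" "lam < (bessel_zero \<nu> 1)\<^sup>2"
  shows "\<exists>u :: 'a \<Rightarrow> real. positive_radial_solution \<delta> lam u"
proof -
  obtain \<gamma> B G where sh: "shooting \<nu> lam B \<gamma> G" and Gone: "G 1 = 0"
    using shooting_solution_exists[OF \<nu>(2,3) range] by blast
  interpret shooting \<nu> lam B \<gamma> G by (rule sh)
  obtain \<epsilon> G2 where \<epsilon>: "\<epsilon> > 0" and G': "\<forall>k. Ck_on k {-\<epsilon><..<1} G" "\<forall>y\<in>{-\<epsilon><..<1}. 0 < G y \<and>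
      (G has_real_derivative G1 y) (at y) \<and> (G1 has_real_derivative G2 y) (at y) \<and>
      4 * y * G2 y + 4 * (\<nu> + 1) * G1 y + lam * G y + G y powr q = 0"
    using smooth_while_positive[of 1] positive_if_nonneg_at_1 Gone by auto
  have Ck: "\<And>k. Ck_on k {-\<epsilon><..<1} G" using G'(1) by blast
  have G: "\<And>y. y \<in> {-\<epsilon><..<1} \<Longrightarrow> 0 < G y" "\<And>y. y \<in> {-\<epsilon><..<1} \<Longrightarrow> (G has_real_derivative G1 y) (at y)"
      "\<And>y. y \<in> {-\<epsilon><..<1} \<Longrightarrow> (G1 has_real_derivative G2 y) (at y)"
      "\<And>y. y \<in> {-\<epsilon><..<1} \<Longrightarrow> 4 * y * G2 y + 4 * (\<nu> + 1) * G1 y + lam * G y + G y powr q = 0"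
    using G'(2) by blast+
  define u where "u = (\<lambda>x::'a. G (x \<bullet> x))"
  let ?B = "ball 0 1 :: 'a set"
  have inn: "x \<bullet> x \<in> {-\<epsilon><..<1}" "0 \<le> x \<bullet> x" "x \<bullet> x < 1" if "x \<in> ?B" for x
  proof -
    show a: "0 \<le> x \<bullet> x" "x \<bullet> x < 1" using that by (auto simp: dot_square_norm power_less_one_iff)
    then show "x \<bullet> x \<in> {-\<epsilon><..<1}" using \<epsilon> unfolding greaterThanLessThan_iff by linarith
  qed
  have smooth: "smooth_on ?B u"
    unfolding smooth_on_def u_def
  proof
    fix k
    show "Ck_on k ?B (\<lambda>x. G (x \<bullet> x))"
      by (rule Ck_on_compose[OF open_ball open_greaterThanLessThan _ Ck_on_inner_self Ck])
        (use inn in auto)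
  qed
  define K where "K = (lam * \<gamma> + \<gamma> powr q) / 4"
  have K: "K \<ge> 0" using lam \<gamma> by (simp add: K_def)
  have "H10 ?B u"
  proof (rule H10_intro[OF smooth, of "2 * K"])
    fix x assume x: "x \<in> ?B"
    have "G (x \<bullet> x) - K * (1 - x \<bullet> x) \<le> G 1"
      unfolding K_def using inn[OF x] by (intro G_ge) auto
    then have "u x \<le> K * (1 - x \<bullet> x)" by (simp add: u_def Gone)
    also have "\<dots> \<le> (2 * K) * (1 - x \<bullet> x)" using K inn[OF x] by (intro mult_right_mono) auto
    finally show "\<bar>u x\<bar> \<le> 2 * K * (1 - x \<bullet> x)"
      using G(1)[OF inn(1)[OF x]] by (simp add: u_def)
    fix b :: 'a assume b: "b \<in> Basis"
    have "partial_deriv b u x = 2 * (x \<bullet> b) * G1 (x \<bullet> x)"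
      using radial_partial_deriv(2)[OF open_ball x _ G(2)[OF inn(1)[OF x]], of u] by (simp add: u_def)
    moreover have "\<bar>x \<bullet> b\<bar> * \<bar>G1 (x \<bullet> x)\<bar> \<le> 1 * K"
      using Basis_le_norm[OF b, of x] x G1_bound[of "x \<bullet> x"] inn[OF x] by (intro mult_mono) (auto simp: K_def)
    ultimately show "\<bar>partial_deriv b u x\<bar> \<le> 2 * K" by (simp add: abs_mult)
  qed
  moreover have "- laplacian u x + \<delta> * (((1 / (norm x)\<^sup>2) *\<^sub>R x) \<bullet> grad u x)
          = lam * u x + \<bar>u x\<bar> powr (4 / (real DIM('a) - 2 - \<delta>)) * u x" if x: "x \<in> ?B - {0}" for x
  proof -
    have xB: "x \<in> ?B" using x by simp
    let ?y = "x \<bullet> x"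
    have y: "?y > 0" using x by simp
    have lap: "laplacian u x = 4 * ?y * G2 ?y + 2 * DIM('a) * G1 ?y" "x \<bullet> grad u x = 2 * ?y * G1 ?y"
      using radial_laplacian[OF open_ball xB, of u G G1 "G2 ?y"] G(2,3) inn xB by (auto simp: u_def)
    have "((1 / (norm x)\<^sup>2) *\<^sub>R x) \<bullet> grad u x = 2 * G1 ?y"
      using y by (simp add: lap(2) dot_square_norm[symmetric])
    moreover have "4 / (real DIM('a) - 2 - \<delta>) = 2 / \<nu>" using \<nu> by (simp add: field_simps)
    moreover have "\<bar>u x\<bar> powr (2 / \<nu>) * u x = G ?y powr q"
      using G(1)[OF inn(1)[OF xB]] by (simp add: u_def q_def powr_add)
    moreover have "4 * (\<nu> + 1) = 2 * DIM('a) - 2 * \<delta>" using \<nu>(1) by (simp add: field_simps)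
    then have "4 * (\<nu> + 1) * G1 ?y = 2 * DIM('a) * G1 ?y - \<delta> * (2 * G1 ?y)"
      by (simp add: left_diff_distrib)
    ultimately show ?thesis
      using G(4)[OF inn(1)[OF xB]] lap(1) by (simp add: u_def)
  qed
  ultimately have "solution \<delta> lam u" unfolding solution_def using smooth by blast
  moreover have "\<forall>x\<in>?B. u x > 0" using G(1) inn by (auto simp: u_def)
  moreover have "\<exists>U. \<forall>x\<in>?B. u x = U (norm x)"
    by (rule exI[of _ "\<lambda>r. G (r\<^sup>2)"]) (simp add: u_def dot_square_norm)
  ultimately have "positive_radial_solution \<delta> lam u"
    unfolding positive_radial_solution_def by blast
  then show ?thesis by blast
qed

section \<open>The problem with drift in the unit ball\<close>

lemma brezis_nirenberg_with_drift:
  assumes \<nu>: "\<nu> = (real DIM('a::euclidean_space) - 2 - \<delta>) / 2" "0 < \<nu>" "\<nu> < 1"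
  shows "((bessel_zero (- \<nu>) 1)\<^sup>2 < lam \<and> lam < (bessel_zero \<nu> 1)\<^sup>2 \<longrightarrow>
          (\<exists>u :: 'a \<Rightarrow> real. positive_radial_solution \<delta> lam u \<and>
             (\<forall>v. positive_radial_solution \<delta> lam v \<longrightarrow> (\<forall>x\<in>ball 0 1. v x = u x)))) \<and>
       (\<not> ((bessel_zero (- \<nu>) 1)\<^sup>2 < lam \<and> lam < (bessel_zero \<nu> 1)\<^sup>2) \<longrightarrow>
          \<not> (\<exists>u :: 'a \<Rightarrow> real. positive_radial_solution \<delta> lam u))"
proof (intro conjI impI)
  assume "(bessel_zero (- \<nu>) 1)\<^sup>2 < lam \<and> lam < (bessel_zero \<nu> 1)\<^sup>2"
  then obtain u :: "'a \<Rightarrow> real" where u: "positive_radial_solution \<delta> lam u"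
    using positive_radial_solution_exists[OF \<nu>] by blast
  then show "\<exists>u :: 'a \<Rightarrow> real. positive_radial_solution \<delta> lam u \<and>
      (\<forall>v. positive_radial_solution \<delta> lam v \<longrightarrow> (\<forall>x\<in>ball 0 1. v x = u x))"
    using positive_radial_solution_unique[OF u _ \<nu>] by blast
next
  assume "\<not> ((bessel_zero (- \<nu>) 1)\<^sup>2 < lam \<and> lam < (bessel_zero \<nu> 1)\<^sup>2)"
  then show "\<not> (\<exists>u :: 'a \<Rightarrow> real. positive_radial_solution \<delta> lam u)"
    using positive_radial_solution_range[OF _ \<nu>] by blast
qed

theorem theorem1p1:
  fixes \<delta> lam :: real
  shows
    "(-1 < \<delta> \<and> \<delta> < 1/2 \<longrightarrow>
       ((bessel_zero (- (1 - \<delta>) / 2) 1)\<^sup>2 < lam \<and> lam < (bessel_zero ((1 - \<delta>) / 2) 1)\<^sup>2 \<longrightarrow>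
          (\<exists>u :: real ^ 3 \<Rightarrow> real. positive_radial_solution \<delta> lam u \<and>
             (\<forall>v. positive_radial_solution \<delta> lam v \<longrightarrow> (\<forall>x\<in>ball 0 1. v x = u x)))) \<and>
       (\<not> ((bessel_zero (- (1 - \<delta>) / 2) 1)\<^sup>2 < lam \<and> lam < (bessel_zero ((1 - \<delta>) / 2) 1)\<^sup>2) \<longrightarrow>
          \<not> (\<exists>u :: real ^ 3 \<Rightarrow> real. positive_radial_solution \<delta> lam u))) \<and>
     (0 < \<delta> \<and> \<delta> < 1 \<longrightarrow>
       ((bessel_zero (- (2 - \<delta>) / 2) 1)\<^sup>2 < lam \<and> lam < (bessel_zero ((2 - \<delta>) / 2) 1)\<^sup>2 \<longrightarrow>
          (\<exists>u :: real ^ 4 \<Rightarrow> real. positive_radial_solution \<delta> lam u \<and>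
             (\<forall>v. positive_radial_solution \<delta> lam v \<longrightarrow> (\<forall>x\<in>ball 0 1. v x = u x)))) \<and>
       (\<not> ((bessel_zero (- (2 - \<delta>) / 2) 1)\<^sup>2 < lam \<and> lam < (bessel_zero ((2 - \<delta>) / 2) 1)\<^sup>2) \<longrightarrow>
          \<not> (\<exists>u :: real ^ 4 \<Rightarrow> real. positive_radial_solution \<delta> lam u))) \<and>
     (1 < \<delta> \<and> \<delta> < 3/2 \<longrightarrow>
       ((bessel_zero (- (3 - \<delta>) / 2) 1)\<^sup>2 < lam \<and> lam < (bessel_zero ((3 - \<delta>) / 2) 1)\<^sup>2 \<longrightarrow>
          (\<exists>u :: real ^ 5 \<Rightarrow> real. positive_radial_solution \<delta> lam u \<and>
             (\<forall>v. positive_radial_solution \<delta> lam v \<longrightarrow> (\<forall>x\<in>ball 0 1. v x = u x)))) \<and>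
       (\<not> ((bessel_zero (- (3 - \<delta>) / 2) 1)\<^sup>2 < lam \<and> lam < (bessel_zero ((3 - \<delta>) / 2) 1)\<^sup>2) \<longrightarrow>
          \<not> (\<exists>u :: real ^ 5 \<Rightarrow> real. positive_radial_solution \<delta> lam u)))"
  using brezis_nirenberg_with_drift[where 'a = "real ^ 3", of "(1 - \<delta>) / 2" \<delta> lam]
    brezis_nirenberg_with_drift[where 'a = "real ^ 4", of "(2 - \<delta>) / 2" \<delta> lam]
    brezis_nirenberg_with_drift[where 'a = "real ^ 5", of "(3 - \<delta>) / 2" \<delta> lam]
  unfolding minus_divide_left[symmetric]
  by (intro conjI impI) simp_all

end
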